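(* Let $d\ge2$ and $2<p<\infty$. Let $\Omega$ be a bounded Lipschitz domain in $\mathbb{R}^d$ and let $\Omega_{\varepsilon,\eta}$ be the periodically perforated domain defined in the context. If $0<\sigma_\varepsilon\le1$, then $$ A_p(\Omega_{\varepsilon,\eta})\ge \begin{cases} c\,\eta^{-d\left|\frac12-\frac1p\right|} & \text{if } d\ge3,\\ c\,\eta^{-2\left|\frac12-\frac1p\right|}|\ln\eta|^{-\frac12} & \text{if } d=2. \end{cases} $$ If $\sigma_\varepsilon\ge1$, then $$ A_p(\Omega_{\varepsilon,\eta})\ge \begin{cases} c\left(1+\varepsilon^{-1}\eta^{\frac dp-1}\right) & \text{if } d\ge3 \text{ and } 2<p<d,\\ c\,\varepsilon^{-1}\eta^{\frac dp-1} & \text{if } d\ge3 \text{ and } d\le p<\infty,\\ c\,\varepsilon^{-1}\eta^{\frac2p-1}|\ln\eta|^{-1} & \text{if } d=2 \text{ and } 2<p<\infty. \end{cases} $$ The constants $c>0$ depend only on $d$, $p$, $Y^s$ and $\Omega$ (in particular, they are independent of $\varepsilon$ and $\eta$).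
   Context: $Q(x,r)$ is the open cube centered at $x$ with side length $r$, and $B(x,r)$ the open ball. Let $Y^s$ be a bounded domain in $\mathbb{R}^d$ with connected $C^1$ boundary such that $B(0,c_0)\subset Y^s\subset B(0,1/4)$ for some $c_0>0$. For $0<\varepsilon\le1$ and $\eta\in(0,1/2)$ define $$\Omega_{\varepsilon,\eta}=\Omega\setminus\bigcup_z\varepsilon\left(z+\eta\overline{Y^s}\right),$$ where the union is over those $z\in\mathbb{Z}^d$ for which $\varepsilon Q(z,1)\subset\Omega$. Put $\sigma_\varepsilon=\varepsilon\eta^{1-\frac d2}$ if $d\ge3$ and $\sigma_\varepsilon=\varepsilon|\ln\eta|^{1/2}$ if $d=2$. For $p\ge 2$, $F\in L^p(\Omega_{\varepsilon,\eta})$ and $f\in L^p(\Omega_{\varepsilon,\eta};\mathbb{R}^d)$, let $u_\varepsilon\in H_0^1(\Omega_{\varepsilon,\eta})$ be the weak solution of $-\Delta u_\varepsilon=F+\mathrm{div}(f)$ in $\Omega_{\varepsilon,\eta}$, $u_\varepsilon=0$ on $\partial\Omega_{\varepsilon,\eta}$. $A_p(\Omega_{\varepsilon,\eta})$ and $B_p(\Omega_{\varepsilon,\eta})$ denote the smallest constants (in $[0,\infty]$) for which $$\|\nabla u_\varepsilon\|_{L^p(\Omega_{\varepsilon,\eta})}\le A_p(\Omega_{\varepsilon,\eta})\|f\|_{L^p(\Omega_{\varepsilon,\eta})}+B_p(\Omega_{\varepsilon,\eta})\|F\|_{L^p(\Omega_{\varepsilon,\eta})}$$ holds for all such $F,f$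 (equivalently, by linearity, $A_p$ is the best constant when $F=0$).
   Formalization: For σ_ε ≥ 1 and p > d it is additionally assumed that at least one hole exists (some z ∈ ℤ^d with εQ(z,1) ⊂ Ω); otherwise the claim fails, e.g. for Ω = B(0,1/4), ε = 1, where Ω_{ε,η} = Ω and A_p is a fixed finite number while the bound blows up as η → 0. *)

theory Defs
  imports "HOL-Analysis.Analysis"
begin

section \<open>Domains\<close>

text \<open>
  The graph condition is coordinate free: a unit vector \<open>e\<close> is the vertical direction,
  \<open>x - (x \<bullet> e) *\<^sub>R e\<close> is the horizontal part of \<open>x\<close>, and \<open>\<psi>\<close> is only evaluated on the
  hyperplane orthogonal to \<open>e\<close>. Asking \<open>\<psi>\<close> to be Lipschitz (or \<open>C\<^sup>1\<close>) on the whole space is no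
  restriction, since a function on the hyperplane extends by composition with the orthogonal
  projection.
\<close>

definition locally_graph_boundary ::
    "((real^'n \<Rightarrow> real) \<Rightarrow> bool) \<Rightarrow> (real^'n) set \<Rightarrow> bool" where
  "locally_graph_boundary P U \<longleftrightarrow>
     (\<forall>x0\<in>frontier U. \<exists>r>0. \<exists>e \<psi>. norm e = 1 \<and> P \<psi> \<and>
        U \<inter> ball x0 r = {x \<in> ball x0 r. x \<bullet> e > \<psi> (x - (x \<bullet> e) *\<^sub>R e)})"

definition C1_function :: "(real^'n \<Rightarrow> real) \<Rightarrow> bool" where
  "C1_function \<psi> \<longleftrightarrow>
     (\<exists>G. continuous_on UNIV G \<and> (\<forall>x. (\<psi> has_derivative (\<lambda>h. G x \<bullet> h)) (at x)))"

definition bounded_domain :: "(real^'n) set \<Rightarrow> bool" where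
  "bounded_domain U \<longleftrightarrow> open U \<and> connected U \<and> U \<noteq> {} \<and> bounded U"

definition bounded_lipschitz_domain :: "(real^'n) set \<Rightarrow> bool" where
  "bounded_lipschitz_domain U \<longleftrightarrow>
     bounded_domain U \<and> locally_graph_boundary (\<lambda>\<psi>. \<exists>L. L-lipschitz_on UNIV \<psi>) U"

definition bounded_C1_domain :: "(real^'n) set \<Rightarrow> bool" where
  "bounded_C1_domain U \<longleftrightarrow> bounded_domain U \<and> locally_graph_boundary C1_function U"


section \<open>The perforated domain\<close>

definition open_cube :: "real^'n \<Rightarrow> real \<Rightarrow> (real^'n) set" where
  "open_cube x r = {y. \<forall>i. \<bar>y $ i - x $ i\<bar> < r / 2}"

definition hole_centers :: "(real^'n) set \<Rightarrow> real \<Rightarrow> (real^'n) set" where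
  "hole_centers \<Omega> \<epsilon> = {z. (\<forall>i. z $ i \<in> \<int>) \<and> (\<lambda>y. \<epsilon> *\<^sub>R y) ` open_cube z 1 \<subseteq> \<Omega>}"

definition perforated :: "(real^'n) set \<Rightarrow> (real^'n) set \<Rightarrow> real \<Rightarrow> real \<Rightarrow> (real^'n) set" where
  "perforated \<Omega> Y \<epsilon> \<eta> =
     \<Omega> - (\<Union>z\<in>hole_centers \<Omega> \<epsilon>. (\<lambda>y. \<epsilon> *\<^sub>R (z + \<eta> *\<^sub>R y)) ` closure Y)"

text \<open>Only meant for \<open>d \<ge> 2\<close>.\<close>

definition sigma_eps :: "nat \<Rightarrow> real \<Rightarrow> real \<Rightarrow> real" where
  "sigma_eps d \<epsilon> \<eta> =
     (if d \<ge> 3 then \<epsilon> * \<eta> powr (1 - real d / 2) else \<epsilon> * \<bar>ln \<eta>\<bar> powr (1 / 2))"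


section \<open>Lebesgue and Sobolev spaces\<close>

definition Lp_norm ::
    "real \<Rightarrow> (real^'n) set \<Rightarrow> (real^'n \<Rightarrow> 'b::real_normed_vector) \<Rightarrow> ennreal" where
  "Lp_norm p U f =
     (let I = \<integral>\<^sup>+ x. ennreal (norm (f x) powr p) \<partial>(lebesgue_on U)
      in if I = \<infinity> then \<infinity> else ennreal (enn2real I powr (1 / p)))"

definition Lp :: "real \<Rightarrow> (real^'n) set \<Rightarrow> (real^'n \<Rightarrow> 'b::real_normed_vector) set" where
  "Lp p U = {f \<in> borel_measurable (lebesgue_on U). Lp_norm p U f < \<infinity>}"

definition pderiv_at :: "'n \<Rightarrow> (real^'n \<Rightarrow> real) \<Rightarrow> real^'n \<Rightarrow> real" where
  "pderiv_at i \<phi> x = frechet_derivative \<phi> (at x) (axis i 1)"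

definition grad :: "(real^'n \<Rightarrow> real) \<Rightarrow> real^'n \<Rightarrow> real^'n" where
  "grad \<phi> x = (\<chi> i. pderiv_at i \<phi> x)"

text \<open>
  \<open>C\<^sup>\<infinity>\<close> means that all iterated partial derivatives are (Frechet) differentiable everywhere, hence
  also continuous.
\<close>

definition smooth :: "(real^'n \<Rightarrow> real) \<Rightarrow> bool" where
  "smooth \<phi> \<longleftrightarrow> (\<forall>is x. foldr pderiv_at is \<phi> differentiable (at x))"

definition test_functions :: "(real^'n) set \<Rightarrow> (real^'n \<Rightarrow> real) set" where
  "test_functions U =
     {\<phi>. smooth \<phi> \<and> compact (closure {x. \<phi> x \<noteq> 0}) \<and> closure {x. \<phi> x \<noteq> 0} \<subseteq> U}"

text \<open>
  Functions are not identified when they agree almost everywhere, so the weak gradient is a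
  relation; \<open>H1 U u g\<close> says that \<open>u\<close> is in \<open>H\<^sup>1(U)\<close> with weak gradient \<open>g\<close>.
\<close>

definition weak_gradient ::
    "(real^'n) set \<Rightarrow> (real^'n \<Rightarrow> real) \<Rightarrow> (real^'n \<Rightarrow> real^'n) \<Rightarrow> bool" where
  "weak_gradient U u g \<longleftrightarrow>
     (\<forall>\<phi>\<in>test_functions U. \<forall>i.
        (LINT x|lebesgue_on U. u x * pderiv_at i \<phi> x) = - (LINT x|lebesgue_on U. g x $ i * \<phi> x))"

definition H1 :: "(real^'n) set \<Rightarrow> (real^'n \<Rightarrow> real) \<Rightarrow> (real^'n \<Rightarrow> real^'n) \<Rightarrow> bool" where
  "H1 U u g \<longleftrightarrow> u \<in> Lp 2 U \<and> g \<in> Lp 2 U \<and> weak_gradient U u g"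

text \<open>\<open>H\<^sup>1\<^sub>0(U)\<close> is the closure of the test functions in \<open>H\<^sup>1(U)\<close>.\<close>

definition H10 :: "(real^'n) set \<Rightarrow> (real^'n \<Rightarrow> real) \<Rightarrow> (real^'n \<Rightarrow> real^'n) \<Rightarrow> bool" where
  "H10 U u g \<longleftrightarrow> H1 U u g \<and>
     (\<exists>\<phi>. (\<forall>k::nat. \<phi> k \<in> test_functions U) \<and>
        (\<lambda>k. Lp_norm 2 U (\<lambda>x. u x - \<phi> k x) + Lp_norm 2 U (\<lambda>x. g x - grad (\<phi> k) x))
          \<longlonglongrightarrow> 0)"


section \<open>The Dirichlet problem and the best constant\<close>

text \<open>
  \<open>u\<close>, with weak gradient \<open>g\<close>, is a weak solution of \<open>-\<Delta>u = F + div f\<close> in \<open>U\<close>, \<open>u = 0\<close> on the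
  boundary. For bounded \<open>U\<close> and \<open>F, f\<close> in \<open>L\<^sup>p(U)\<close>, \<open>p \<ge> 2\<close>, all integrals below converge.
\<close>

definition weak_solution ::
    "(real^'n) set \<Rightarrow> (real^'n \<Rightarrow> real) \<Rightarrow> (real^'n \<Rightarrow> real^'n)
      \<Rightarrow> (real^'n \<Rightarrow> real) \<Rightarrow> (real^'n \<Rightarrow> real^'n) \<Rightarrow> bool" where
  "weak_solution U F f u g \<longleftrightarrow> H10 U u g \<and>
     (\<forall>\<phi>\<in>test_functions U.
        (LINT x|lebesgue_on U. g x \<bullet> grad \<phi> x)
          = (LINT x|lebesgue_on U. F x * \<phi> x) - (LINT x|lebesgue_on U. f x \<bullet> grad \<phi> x))"

definition gradient_estimate :: "real \<Rightarrow> (real^'n) set \<Rightarrow> ennreal \<Rightarrow> ennreal \<Rightarrow> bool" where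
  "gradient_estimate p U A B \<longleftrightarrow>
     (\<forall>F\<in>Lp p U. \<forall>f\<in>Lp p U. \<forall>u g. weak_solution U F f u g \<longrightarrow>
        Lp_norm p U g \<le> A * Lp_norm p U f + B * Lp_norm p U F)"

text \<open>
  By linearity the admissible pairs \<open>(A, B)\<close> in \<open>[0,\<infinity>]\<^sup>2\<close> are exactly those with \<open>A \<ge> A_p\<close> and
  \<open>B \<ge> B_p\<close>, so the joint minimum of the pair is attained in each component separately. Since
  \<open>\<infinity> * 0 = 0\<close>, the choice \<open>B = \<infinity>\<close> only leaves the estimate for \<open>F = 0\<close>.
\<close>

definition A_p :: "real \<Rightarrow> (real^'n) set \<Rightarrow> ennreal" where
  "A_p p U = Inf {A. \<exists>B. gradient_estimate p U A B}"

end

theory Submission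
  imports Defs
begin

text \<open>Take \<open>F = 0\<close> and \<open>f = - \<nabla>\<phi>\<close>. The gradient \<open>g\<close> of the solution is then the \<open>L\<^sup>2\<close>-projection of
  \<open>\<nabla>\<phi>\<close> onto the gradients of functions vanishing on the holes, and an upper bound \<open>a\<close> for the
  constant gives \<open>\<parallel>g\<parallel>\<^sub>p \<le> a \<parallel>\<nabla>\<phi>\<parallel>\<^sub>p\<close>. The function \<open>\<phi>\<close> is a plateau of height and width \<open>L\<close>, where
  \<open>L\<close> is comparable to \<open>min \<sigma>\<^sub>\<epsilon> 1\<close>. Two facts about \<open>g\<close> compete.

  If \<open>a\<close> is small, \<open>g\<close> is close to \<open>\<nabla>\<phi>\<close>. Cutting \<open>\<phi>\<close> off near the holes changes it by a function
  \<open>v\<close> that lives on balls of radius \<open>\<epsilon>\<eta>\<close>. As \<open>\<phi> - v\<close> is an admissible test function, the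
  projection property gives \<open>\<parallel>\<nabla>\<phi> - g\<parallel>\<^sub>2\<^sup>2 = \<integral> (\<nabla>\<phi> - g) \<bullet> \<nabla>v\<close>. These balls fill only a fraction \<open>\<eta>\<^sup>d\<close>
  of the volume, so a bound for \<open>g\<close> in \<open>L\<^sup>p\<close> with \<open>p > 2\<close> makes the integral small.

  On the other hand, \<open>g\<close> is never close to \<open>\<nabla>\<phi>\<close>. Let \<open>u\<close> be the solution. The function \<open>u - \<phi>\<close> is
  \<open>-L\<close> on the holes inside the plateau and \<open>0\<close> on the holes outside the support of \<open>\<phi>\<close>. Going from a
  hole of the first kind to one of the second kind, first radially out of the hole, then by a
  translation, then radially into the other hole, costs an amount of energy that is bounded below
  by the capacity of a hole. This is the lemma \<open>capacity_inequality\<close>.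

  The lemma \<open>core_inequality\<close> combines the two facts. For the lattice of holes it says that
  \<open>L / (\<epsilon> \<eta> l) \<le> C (1 + a \<eta>\<^bsup>-d/p\<^esup>)\<close>, where \<open>l = 1\<close> for \<open>d \<ge> 3\<close> and \<open>l = |ln \<eta>|\<close> for \<open>d = 2\<close>.
  Multiplying by \<open>\<eta>\<^bsup>d/p\<^esup>\<close> and using \<open>a \<ge> 1\<close>, which holds because a test function solves the problem
  with \<open>f\<close> its own negative gradient, one gets \<open>a \<ge> c min \<sigma>\<^sub>\<epsilon> 1 / (\<epsilon> l) \<eta>\<^bsup>d/p - 1\<^esup>\<close>. All cases of
  the theorem are instances of this one inequality. Only \<open>\<epsilon>\<close> bounded below, where there are few
  holes, and \<open>\<eta>\<close> bounded below, where the claimed lower bound is itself bounded, are treated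
  separately.\<close>


section \<open>Calculus of smooth functions\<close>

lemma smooth_iff:
  "smooth f \<longleftrightarrow> (\<forall>x. f differentiable (at x)) \<and> (\<forall>i. smooth (pderiv_at i f))"
proof
  assume s: "smooth f"
  have "f differentiable (at x)" for x
    using s[unfolded smooth_def, rule_format, of "[]" x] by simp
  moreover have "smooth (pderiv_at i f)" for i
    unfolding smooth_def
  proof (intro allI)
    fix "is" x
    show "foldr pderiv_at is (pderiv_at i f) differentiable (at x)"
      using s[unfolded smooth_def, rule_format, of "is @ [i]" x] by simp
  qed
  ultimately show "(\<forall>x. f differentiable (at x)) \<and> (\<forall>i. smooth (pderiv_at i f))" by blast
next
  assume a: "(\<forall>x. f differentiable (at x)) \<and> (\<forall>i. smooth (pderiv_at i f))"
  show "smooth f"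
    unfolding smooth_def
  proof (intro allI)
    fix "is" x
    show "foldr pderiv_at is f differentiable (at x)"
    proof (cases "is" rule: rev_cases)
      case Nil then show ?thesis using a by simp
    next
      case (snoc ys y)
      then show ?thesis using a by (auto simp: smooth_def)
    qed
  qed
qed

lemma smooth_pderiv: "smooth f \<Longrightarrow> smooth (pderiv_at i f)"
  by (subst (asm) smooth_iff) simp

lemma smooth_differentiable: "smooth f \<Longrightarrow> f differentiable (at x)"
  by (subst (asm) smooth_iff) simp

text \<open>Smoothness is the greatest class of differentiable functions that is stable under partial
  derivatives. This makes it possible to prove a function smooth without describing its iterated
  derivatives.\<close>

lemma smooth_coinduct:
  assumes f: "f \<in> X"
    and step: "\<And>h. h \<in> X \<Longrightarrow> (\<forall>x. h differentiable (at x)) \<and> (\<forall>i. pderiv_at i h \<in> X)"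
  shows "smooth f"
proof -
  have "\<forall>h\<in>X. foldr pderiv_at is h \<in> X" for "is"
    by (induction "is") (use step in auto)
  then show ?thesis unfolding smooth_def using f step by blast
qed

lemma pderiv_at_eq:
  "(f has_derivative f') (at x) \<Longrightarrow> pderiv_at i f x = f' (axis i 1)"
  by (simp add: pderiv_at_def flip: frechet_derivative_at)

lemma smooth_has_derivative:
  assumes "smooth f"
  shows "(f has_derivative (\<lambda>h. grad f x \<bullet> h)) (at x)"
proof -
  let ?D = "frechet_derivative f (at x)"
  have D: "(f has_derivative ?D) (at x)"
    using smooth_differentiable[OF assms] by (simp add: frechet_derivative_works)
  have "?D h = grad f x \<bullet> h" for h
  proof -
    have lin: "linear ?D" using D by (rule has_derivative_linear)
    have "?D h = ?D (\<Sum>i\<in>UNIV. h $ i *\<^sub>R axis i 1)"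
      using basis_expansion[of h] by (simp add: scalar_mult_eq_scaleR)
    also have "\<dots> = (\<Sum>i\<in>UNIV. h $ i * ?D (axis i 1))"
      by (simp add: linear_sum[OF lin] linear_scale[OF lin])
    also have "\<dots> = grad f x \<bullet> h"
      by (simp add: inner_vec_def grad_def pderiv_at_def mult.commute)
    finally show ?thesis .
  qed
  then have "?D = (\<lambda>h. grad f x \<bullet> h)" by auto
  with D show ?thesis by metis
qed

lemma continuous_on_smooth: "smooth f \<Longrightarrow> continuous_on A f"
  by (meson smooth_has_derivative has_derivative_at_withinI has_derivative_continuous_on)

lemma continuous_on_grad: "smooth f \<Longrightarrow> continuous_on A (grad f)"
  unfolding grad_def[abs_def]
  by (intro continuous_on_vec_lambda continuous_on_smooth smooth_pderiv)

lemma grad_eqI: "(f has_derivative (\<lambda>h. v \<bullet> h)) (at x) \<Longrightarrow> grad f x = v"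
  by (simp add: grad_def pderiv_at_eq vec_eq_iff inner_axis)

text \<open>The product rule and the chain rule do not stay within products or compositions, but they stay
  within finite sums of them with smooth coefficients. These sums are the invariant class to which
  coinduction is applied, both for products and for compositions.\<close>

inductive_set smooth_span :: "(real^'n \<Rightarrow> real) set \<Rightarrow> (real^'n \<Rightarrow> real) set" for C where
  prod: "smooth a \<Longrightarrow> b \<in> C \<Longrightarrow> (\<lambda>x. a x * b x) \<in> smooth_span C"
| sum: "f \<in> smooth_span C \<Longrightarrow> g \<in> smooth_span C \<Longrightarrow> (\<lambda>x. f x + g x) \<in> smooth_span C"

lemma smooth_span_smooth:
  assumes C: "\<And>b x. b \<in> C \<Longrightarrow> b differentiable (at x)"
    and D: "\<And>a b i. smooth a \<Longrightarrow> b \<in> C \<Longrightarrow> (\<lambda>x. a x * pderiv_at i b x) \<in> smooth_span C"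
    and f: "f \<in> smooth_span C"
  shows "smooth f"
proof (rule smooth_coinduct[OF f])
  fix h assume "h \<in> smooth_span C"
  then show "(\<forall>x. h differentiable (at x)) \<and> (\<forall>i. pderiv_at i h \<in> smooth_span C)"
  proof induction
    case (prod a b)
    have a: "(a has_derivative (\<lambda>h. grad a x \<bullet> h)) (at x)" for x
      using prod by (simp add: smooth_has_derivative)
    have b: "(b has_derivative frechet_derivative b (at x)) (at x)" for x
      using C[OF prod(2)] by (simp add: frechet_derivative_works)
    have p: "((\<lambda>x. a x * b x) has_derivative
        (\<lambda>h. a x * frechet_derivative b (at x) h + (grad a x \<bullet> h) * b x)) (at x)" for x
      by (rule has_derivative_mult[OF a b])
    have "pderiv_at i (\<lambda>x. a x * b x) = (\<lambda>x. pderiv_at i a x * b x + a x * pderiv_at i b x)" for i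
      by (rule ext) (simp add: pderiv_at_eq[OF p] pderiv_at_eq[OF a] pderiv_at_eq[OF b])
    then show ?case
      using p by (auto simp: differentiable_def intro!: smooth_span.sum smooth_span.prod D prod smooth_pderiv)
  next
    case (sum f g)
    have p: "((\<lambda>x. f x + g x) has_derivative
        (\<lambda>h. frechet_derivative f (at x) h + frechet_derivative g (at x) h)) (at x)" for x
      using sum by (intro has_derivative_add) (auto simp: frechet_derivative_works)
    have "pderiv_at i (\<lambda>x. f x + g x) = (\<lambda>x. pderiv_at i f x + pderiv_at i g x)" for i
      by (rule ext) (simp add: pderiv_at_eq[OF p] pderiv_at_def)
    then show ?case
      using p sum by (auto simp: differentiable_def intro!: smooth_span.sum)
  qed
qed

lemma smooth_mult:
  assumes "smooth f" "smooth g"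
  shows "smooth (\<lambda>x. f x * g x)"
proof (rule smooth_span_smooth[where C = "Collect smooth"])
  show "(\<lambda>x. f x * g x) \<in> smooth_span (Collect smooth)"
    using assms by (intro smooth_span.prod) auto
qed (auto simp: smooth_differentiable smooth_pderiv intro!: smooth_span.prod)

lemma smooth_const: "smooth (\<lambda>x. c)"
proof (rule smooth_coinduct[where X = "range (\<lambda>c x. c)"])
  have "pderiv_at i (\<lambda>x. c) = (\<lambda>x. 0)" for i and c :: real
    by (rule ext) (rule pderiv_at_eq, simp)
  then show "(\<forall>x. h differentiable (at x)) \<and> (\<forall>i. pderiv_at i h \<in> range (\<lambda>c x. c))"
    if "h \<in> range (\<lambda>c x. c)" for h
    using that by auto
qed simp

lemma smooth_add:
  assumes "smooth f" "smooth g"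
  shows "smooth (\<lambda>x. f x + g x)"
proof (rule smooth_span_smooth[where C = "Collect smooth"])
  have "(\<lambda>x. f x * 1 + g x * 1) \<in> smooth_span (Collect smooth)"
    using assms by (intro smooth_span.sum smooth_span.prod) (auto simp: smooth_const)
  then show "(\<lambda>x. f x + g x) \<in> smooth_span (Collect smooth)" by simp
qed (auto simp: smooth_differentiable smooth_pderiv intro!: smooth_span.prod)

lemma smooth_diff: "smooth f \<Longrightarrow> smooth g \<Longrightarrow> smooth (\<lambda>x. f x - g x)"
  using smooth_add[of f "\<lambda>x. (-1) * g x"] smooth_mult[OF smooth_const, of g "-1"] by simp

lemma smooth_sum: "(\<And>i. i \<in> I \<Longrightarrow> smooth (f i)) \<Longrightarrow> smooth (\<lambda>x. \<Sum>i\<in>I. f i x)"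
  by (induction I rule: infinite_finite_induct) (auto simp: smooth_const smooth_add)

lemma smooth_component: "smooth (\<lambda>x::real^'n. x $ i)"
proof -
  have d: "((\<lambda>x::real^'n. x $ i) has_derivative (\<lambda>h. h $ i)) (at x)" for x
    by (rule bounded_linear.has_derivative[OF bounded_linear_vec_nth has_derivative_ident])
  have "pderiv_at j (\<lambda>x. x $ i) = (\<lambda>x::real^'n. axis j 1 $ i)" for j
    by (rule ext) (rule pderiv_at_eq[OF d])
  with d show ?thesis
    by (subst smooth_iff) (auto simp: smooth_const differentiable_def)
qed

lemma smooth_norm_square: "smooth (\<lambda>x::real^'n. (norm x)\<^sup>2)"
proof -
  have "(\<lambda>x::real^'n. (norm x)\<^sup>2) = (\<lambda>x. \<Sum>i\<in>UNIV. x $ i * x $ i)"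
    by (rule ext) (simp add: power2_norm_eq_inner inner_vec_def)
  then show ?thesis by (simp add: smooth_sum smooth_mult smooth_component)
qed

text \<open>\<open>D\<close> stands for \<open>f\<close> with all its derivatives, which only have to exist on the range of \<open>q\<close>. The
  choice \<open>T = {0<..}\<close> later gives reciprocals.\<close>

lemma smooth_compose:
  fixes q :: "real^'n \<Rightarrow> real"
  assumes q: "smooth q" "range q \<subseteq> T" and f: "f \<in> D"
    and D: "\<And>f. f \<in> D \<Longrightarrow> \<exists>f'\<in>D. \<forall>t\<in>T. (f has_real_derivative f' t) (at t)"
  shows "smooth (\<lambda>x. f (q x))"
proof (rule smooth_span_smooth[where C = "(\<lambda>f x. f (q x)) ` D"])
  let ?C = "(\<lambda>f x. f (q x)) ` D"
  have chain: "\<exists>f'\<in>D. \<forall>x. ((\<lambda>x. f (q x)) has_derivative (\<lambda>h. (grad q x \<bullet> h) * f' (q x))) (at x)"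
    if fD: "f \<in> D" for f
  proof -
    obtain f' where f': "f' \<in> D" "\<forall>t\<in>T. (f has_real_derivative f' t) (at t)"
      using D[OF fD] by blast
    have "((\<lambda>x. f (q x)) has_derivative (\<lambda>h. (grad q x \<bullet> h) * f' (q x))) (at x)" for x
      using f' q(2) by (intro has_derivative_eq_rhs[OF
          DERIV_compose_FDERIV[OF _ smooth_has_derivative[OF q(1)]]]) auto
    with f' show ?thesis by blast
  qed
  show "b differentiable (at x)" if "b \<in> ?C" for b x
    using that chain unfolding differentiable_def by blast
  show "(\<lambda>x. a x * pderiv_at i b x) \<in> smooth_span ?C" if a: "smooth a" and "b \<in> ?C" for a b i
  proof -
    obtain f where f: "f \<in> D" "b = (\<lambda>x. f (q x))" using \<open>b \<in> ?C\<close> by blast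
    obtain f' where f': "f' \<in> D"
      "\<And>x. ((\<lambda>x. f (q x)) has_derivative (\<lambda>h. (grad q x \<bullet> h) * f' (q x))) (at x)"
      using chain[OF f(1)] by blast
    have "(\<lambda>x. a x * pderiv_at i b x) = (\<lambda>x. (a x * pderiv_at i q x) * f' (q x))"
      by (rule ext) (simp add: f(2) pderiv_at_eq[OF f'(2)] inner_axis grad_def)
    also have "\<dots> \<in> smooth_span ?C"
      using a q f' by (intro smooth_span.prod smooth_mult smooth_pderiv) auto
    finally show ?thesis .
  qed
  have "(\<lambda>x. 1 * f (q x)) \<in> smooth_span ?C"
    using f by (intro smooth_span.prod smooth_const) auto
  then show "(\<lambda>x. f (q x)) \<in> smooth_span ?C" by simp
qed

lemma smooth_affine:
  fixes f :: "real^'n \<Rightarrow> real"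
  assumes "smooth f"
  shows "smooth (\<lambda>x. f (c *\<^sub>R (x - a)))"
    and "grad (\<lambda>x. f (c *\<^sub>R (x - a))) x = c *\<^sub>R grad f (c *\<^sub>R (x - a))"
proof -
  have der: "((\<lambda>x. k * f (c *\<^sub>R (x - a))) has_derivative
      (\<lambda>h. (k *\<^sub>R c *\<^sub>R grad f (c *\<^sub>R (x - a))) \<bullet> h)) (at x)" if "smooth f" for f x k
  proof -
    have "((\<lambda>x. c *\<^sub>R (x - a)) has_derivative (\<lambda>h. c *\<^sub>R h)) (at x)"
      by (auto intro!: derivative_eq_intros)
    from has_derivative_compose[OF this smooth_has_derivative[OF that]]
    show ?thesis
      by (auto intro!: derivative_eq_intros simp: fun_eq_iff)
  qed
  let ?X = "{\<lambda>x. k * g (c *\<^sub>R (x - a)) |k g. smooth g}"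
  show "smooth (\<lambda>x. f (c *\<^sub>R (x - a)))"
  proof (rule smooth_coinduct[where X = ?X])
    have "(\<lambda>x. 1 * f (c *\<^sub>R (x - a))) \<in> ?X" using assms by blast
    then show "(\<lambda>x. f (c *\<^sub>R (x - a))) \<in> ?X" by simp
    fix h assume "h \<in> ?X"
    then obtain k g where h: "h = (\<lambda>x. k * g (c *\<^sub>R (x - a)))" and g: "smooth g" by blast
    have "pderiv_at i h = (\<lambda>x. (k * c) * pderiv_at i g (c *\<^sub>R (x - a)))" for i
      by (rule ext) (simp add: h pderiv_at_eq[OF der[OF g]] inner_axis grad_def)
    then show "(\<forall>x. h differentiable (at x)) \<and> (\<forall>i. pderiv_at i h \<in> ?X)"
      using der[OF g] g smooth_pderiv unfolding h differentiable_def by blast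
  qed
  show "grad (\<lambda>x. f (c *\<^sub>R (x - a))) x = c *\<^sub>R grad f (c *\<^sub>R (x - a))"
    using der[OF assms, of 1 x] by (intro grad_eqI) simp
qed

lemma grad_mult:
  assumes "smooth f" "smooth g"
  shows "grad (\<lambda>x. f x * g x) x = f x *\<^sub>R grad g x + g x *\<^sub>R grad f x"
  by (rule grad_eqI, rule has_derivative_eq_rhs[OF has_derivative_mult[OF
      smooth_has_derivative[OF assms(1)] smooth_has_derivative[OF assms(2)]]])
     (auto simp: inner_simps algebra_simps)

lemma grad_diff:
  assumes "smooth f" "smooth g"
  shows "grad (\<lambda>x. f x - g x) x = grad f x - grad g x"
  by (rule grad_eqI, rule has_derivative_eq_rhs[OF has_derivative_diff[OF
      smooth_has_derivative[OF assms(1)] smooth_has_derivative[OF assms(2)]]])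
     (auto simp: inner_simps algebra_simps)

lemma grad_add:
  assumes "smooth f" "smooth g"
  shows "grad (\<lambda>x. f x + g x) x = grad f x + grad g x"
  by (rule grad_eqI, rule has_derivative_eq_rhs[OF has_derivative_add[OF
      smooth_has_derivative[OF assms(1)] smooth_has_derivative[OF assms(2)]]])
     (auto simp: inner_simps algebra_simps)

lemma grad_const: "grad (\<lambda>x. c) x = 0"
  by (rule grad_eqI) simp

lemma grad_cmult:
  assumes "smooth f"
  shows "grad (\<lambda>x. c * f x) x = c *\<^sub>R grad f x"
  using grad_mult[OF smooth_const assms] by (simp add: grad_const)

lemma grad_sum:
  assumes "\<And>i. i \<in> I \<Longrightarrow> smooth (f i)"
  shows "grad (\<lambda>x. \<Sum>i\<in>I. f i x) x = (\<Sum>i\<in>I. grad (f i) x)"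
  using assms
  by (induction I rule: infinite_finite_induct) (auto simp: grad_const grad_add smooth_sum)

section \<open>A smooth plateau\<close>

text \<open>The functions \<open>P(1/t) e\<^bsup>-1/t\<^esup>\<close>, with \<open>P\<close> a polynomial, extended by zero to \<open>t \<le> 0\<close>, form a class
  that is stable under derivatives and contains the flat function \<open>e\<^bsup>-1/t\<^esup>\<close>.\<close>

definition poly_exp :: "real poly \<Rightarrow> real \<Rightarrow> real" where
  "poly_exp P t = (if t > 0 then poly P (inverse t) * exp (- inverse t) else 0)"

lemma poly_div_exp_tendsto_0:
  fixes P :: "real poly"
  shows "((\<lambda>s. poly P s * exp (- s)) \<longlongrightarrow> 0) at_top"
proof -
  have "((\<lambda>s. \<Sum>i\<le>degree P. coeff P i * (s ^ i / exp s)) \<longlongrightarrow> (\<Sum>i\<le>degree P. coeff P i * 0)) at_top"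
    by (intro tendsto_intros tendsto_power_div_exp_0)
  then show ?thesis
    by (simp add: poly_altdef sum_distrib_right exp_minus divide_inverse mult.assoc)
qed

lemma poly_exp_has_derivative:
  "(poly_exp P has_real_derivative poly_exp ([:0, 0, 1:] * (P - pderiv P)) t) (at t)"
proof -
  consider "t > 0" | "t < 0" | "t = 0" by linarith
  then show ?thesis
  proof cases
    case 1
    have "((\<lambda>t. poly P (inverse t) * exp (- inverse t)) has_real_derivative
        poly_exp ([:0, 0, 1:] * (P - pderiv P)) t) (at t)"
      using 1 by (auto intro!: derivative_eq_intros simp: poly_exp_def algebra_simps power2_eq_square)
    then show ?thesis
      by (rule has_field_derivative_transform_within_open[where S="{0<..}"])
         (use 1 in \<open>auto simp: poly_exp_def\<close>)
  next
    case 2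
    have "((\<lambda>t. 0) has_real_derivative poly_exp ([:0, 0, 1:] * (P - pderiv P)) t) (at t)"
      using 2 by (auto simp: poly_exp_def)
    then show ?thesis
      by (rule has_field_derivative_transform_within_open[where S="{..<0}"])
         (use 2 in \<open>auto simp: poly_exp_def\<close>)
  next
    case 3
    have "((\<lambda>h. poly ([:0, 1:] * P) (inverse h) * exp (- inverse h)) \<longlongrightarrow> 0) (at_right 0)"
      using poly_div_exp_tendsto_0[of "[:0,1:] * P"]
      by (subst filterlim_at_top_to_right [symmetric]) simp
    then have "((\<lambda>h. poly_exp P h / h) \<longlongrightarrow> 0) (at_right 0)"
      by (rule Lim_transform_eventually)
         (auto simp: eventually_at_filter poly_exp_def divide_inverse)
    moreover have "((\<lambda>h. poly_exp P h / h) \<longlongrightarrow> 0) (at_left 0)"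
      by (rule Lim_transform_eventually[OF tendsto_const])
         (auto simp: eventually_at_filter poly_exp_def)
    ultimately have "((\<lambda>h. poly_exp P h / h) \<longlongrightarrow> 0) (at 0)"
      by (simp add: filterlim_split_at)
    then show ?thesis
      using 3 by (simp add: DERIV_def poly_exp_def)
  qed
qed

lemma smooth_poly_exp: "smooth q \<Longrightarrow> smooth (\<lambda>x. poly_exp P (q x))"
  by (rule smooth_compose[where T = UNIV and D = "range poly_exp"])
     (use poly_exp_has_derivative in blast)+

lemma smooth_inverse:
  assumes "smooth q" "\<And>x. q x > 0"
  shows "smooth (\<lambda>x. inverse (q x))"
proof (rule smooth_compose[where T = "{0<..}" and D = "{\<lambda>t. c * inverse t ^ k |c k. True}", OF assms(1)])
  show "range q \<subseteq> {0<..}" using assms by auto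
  have "(\<lambda>t::real. 1 * inverse t ^ 1) \<in> {\<lambda>t::real. c * inverse t ^ k |c k. True}" by blast
  then show "inverse \<in> {\<lambda>t::real. c * inverse t ^ k |c k. True}" by simp
  fix f :: "real \<Rightarrow> real" assume "f \<in> {\<lambda>t. c * inverse t ^ k |c k. True}"
  then obtain c k where f: "f = (\<lambda>t. c * inverse t ^ k)" by auto
  have "(f has_real_derivative (- c * real k) * inverse t ^ (k + 1)) (at t)" if "t > 0" for t
  proof -
    have "((\<lambda>t. inverse t ^ k) has_real_derivative real k * ((- inverse (t ^ 2)) * inverse t ^ (k - 1))) (at t)"
      using DERIV_power[OF DERIV_inverse[of t UNIV], of k] that
      by (simp add: numeral_2_eq_2 power_inverse)
    then have "(f has_real_derivative c * (real k * ((- inverse (t ^ 2)) * inverse t ^ (k - 1)))) (at t)"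
      unfolding f by (rule DERIV_cmult)
    moreover have "c * (real k * ((- inverse (t ^ 2)) * inverse t ^ (k - 1))) = (- c * real k) * inverse t ^ (k + 1)"
      by (cases k) (simp_all add: power2_eq_square)
    ultimately show ?thesis by (simp only:)
  qed
  moreover have "(\<lambda>t. (- c * real k) * inverse t ^ (k + 1)) \<in> {\<lambda>t. c * inverse t ^ k |c k. True}"
    by blast
  ultimately show "\<exists>f'\<in>{\<lambda>t. c * inverse t ^ k |c k. True}. \<forall>t\<in>{0<..}. (f has_real_derivative f' t) (at t)"
    by (intro bexI[where x = "\<lambda>t. (- c * real k) * inverse t ^ (k + 1)"] ballI) auto
qed

text \<open>With \<open>a > 0\<close> exactly inside the unit ball and \<open>b > 0\<close> exactly outside the ball of radius \<open>1/2\<close>,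
  the quotient \<open>a / (a + b)\<close> has a positive denominator and is constant where \<open>a\<close> or \<open>b\<close> vanishes.\<close>

lemma smooth_plateau:
  obtains \<theta> :: "real^'n \<Rightarrow> real" where
    "smooth \<theta>" "\<And>x. 0 \<le> \<theta> x" "\<And>x. \<theta> x \<le> 1"
    "\<And>x. norm x \<le> 1/2 \<Longrightarrow> \<theta> x = 1" "\<And>x. norm x \<ge> 1 \<Longrightarrow> \<theta> x = 0"
proof -
  define a b where "a x = poly_exp 1 (1 - (norm x)\<^sup>2)"
    and "b x = poly_exp 1 ((norm x)\<^sup>2 - 1/4)" for x :: "real^'n"
  have sm: "smooth a" "smooth b"
    unfolding a_def b_def
    by (intro smooth_poly_exp smooth_diff smooth_const smooth_norm_square)+
  have nn: "a x \<ge> 0" "b x \<ge> 0" for x by (auto simp: a_def b_def poly_exp_def)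
  have a_pos: "a x > 0 \<longleftrightarrow> norm x < 1" for x
    using abs_square_less_1[of "norm x"] by (simp add: a_def poly_exp_def)
  have b_pos: "b x > 0 \<longleftrightarrow> norm x > 1/2" for x
  proof -
    have "(norm x)\<^sup>2 > 1/4 \<longleftrightarrow> norm x > 1/2"
      using abs_le_square_iff[of "norm x" "1/2"] by (simp add: power2_eq_square not_le[symmetric])
    then show ?thesis by (auto simp: b_def poly_exp_def)
  qed
  have pos: "a x + b x > 0" for x
    using nn[of x] a_pos[of x] b_pos[of x] by (smt (verit) field_sum_of_halves)
  show thesis
  proof
    show "smooth (\<lambda>x. a x * inverse (a x + b x))"
      by (intro smooth_mult smooth_inverse smooth_add sm pos)
    fix x :: "real^'n"
    show "0 \<le> a x * inverse (a x + b x)" using nn[of x] by simp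
    show "a x * inverse (a x + b x) \<le> 1" using nn[of x] pos[of x] by (simp add: field_simps)
    show "a x * inverse (a x + b x) = 1" if "norm x \<le> 1/2"
      using that b_pos[of x] nn[of x] pos[of x] by (auto simp: field_simps)
    show "a x * inverse (a x + b x) = 0" if "norm x \<ge> 1"
      using that a_pos[of x] nn[of x] by auto
  qed
qed

lemma grad_cong_open:
  assumes "open S" "x \<in> S" "\<And>y. y \<in> S \<Longrightarrow> f y = g y" "smooth f"
  shows "grad g x = grad f x"
  by (rule grad_eqI, rule has_derivative_transform_within_open[OF smooth_has_derivative[OF assms(4)]
      assms(1,2,3)])

lemma grad_eq_0:
  assumes "x \<notin> closure {x. f x \<noteq> 0}"
  shows "grad f x = 0"
proof -
  have "grad f x = grad (\<lambda>_. 0) x"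
    by (rule grad_cong_open[where S = "- closure {x. f x \<noteq> 0}"])
       (use assms closure_subset[of "{x. f x \<noteq> 0}"] in \<open>auto simp: smooth_const\<close>)
  then show ?thesis by (simp add: grad_const)
qed

lemma grad_bounded:
  assumes "smooth f" "compact (closure {x. f x \<noteq> 0})"
  obtains M where "M > 0" "\<And>x. norm (grad f x) \<le> M"
proof -
  have "bounded (grad f ` closure {x. f x \<noteq> 0})"
    using assms by (intro compact_imp_bounded compact_continuous_image continuous_on_grad)
  then obtain M where M: "\<And>y. y \<in> grad f ` closure {x. f x \<noteq> 0} \<Longrightarrow> norm y \<le> M"
    by (auto simp: bounded_iff)
  have "norm (grad f x) \<le> max M 1" for x
  proof (cases "x \<in> closure {x. f x \<noteq> 0}")
    case True then show ?thesis using M by (meson imageI max.coboundedI1)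
  qed (simp add: grad_eq_0)
  then show thesis by (intro that[of "max M 1"]) auto
qed

section \<open>Increments of a function and the energy\<close>

abbreviation sq_int :: "'a measure \<Rightarrow> ('a \<Rightarrow> 'b::real_normed_vector) \<Rightarrow> ennreal" where
  "sq_int M f \<equiv> (\<integral>\<^sup>+x. ennreal ((norm (f x))\<^sup>2) \<partial>M)"

lemma borel_measurable_grad [measurable]: "smooth f \<Longrightarrow> grad f \<in> borel_measurable borel"
  by (intro borel_measurable_continuous_onI continuous_on_grad)

lemma borel_measurable_smooth [measurable]: "smooth f \<Longrightarrow> f \<in> borel_measurable borel"
  by (intro borel_measurable_continuous_onI continuous_on_smooth)

lemma nn_integral_lborel_affine:
  fixes f :: "real^'n \<Rightarrow> ennreal"
  assumes [measurable]: "f \<in> borel_measurable borel" and "c > 0"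
  shows "(\<integral>\<^sup>+x. f x \<partial>lborel) = ennreal (c ^ CARD('n)) * (\<integral>\<^sup>+y. f (z + c *\<^sub>R y) \<partial>lborel)"
proof -
  have "(\<integral>\<^sup>+x. f x \<partial>lborel)
      = (\<integral>\<^sup>+x. f x \<partial>density (distr lborel borel (\<lambda>x. z + c *\<^sub>R x)) (\<lambda>_. \<bar>c\<bar> ^ CARD('n)))"
    using lborel_affine[of c z] assms by simp
  then show ?thesis
    using assms by (simp add: nn_integral_density nn_integral_distr nn_integral_cmult)
qed

lemma nn_integral_lborel_translate:
  fixes f :: "real^'n \<Rightarrow> ennreal"
  assumes "f \<in> borel_measurable borel"
  shows "(\<integral>\<^sup>+x. f (x + v) \<partial>lborel) = (\<integral>\<^sup>+x. f x \<partial>lborel)"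
  using nn_integral_lborel_affine[OF assms, of 1 v] by (simp add: add.commute)

lemma increment_le_gradient_integral:
  fixes \<zeta> :: "real^'n \<Rightarrow> real"
  assumes sm: "smooth \<zeta>" and "s0 \<le> s1"
  shows "ennreal \<bar>\<zeta> (a + s1 *\<^sub>R v) - \<zeta> (a + s0 *\<^sub>R v)\<bar>
    \<le> (\<integral>\<^sup>+s. ennreal (norm v * norm (grad \<zeta> (a + s *\<^sub>R v))) * indicator {s0..s1} s \<partial>lborel)"
proof -
  let ?f = "\<lambda>s. grad \<zeta> (a + s *\<^sub>R v) \<bullet> v"
  have "((\<lambda>s. \<zeta> (a + s *\<^sub>R v)) has_derivative (\<lambda>h. grad \<zeta> (a + s *\<^sub>R v) \<bullet> (h *\<^sub>R v))) (at s)" for s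
  proof -
    have "((\<lambda>s. a + s *\<^sub>R v) has_derivative (\<lambda>h. h *\<^sub>R v)) (at s)"
      by (auto intro!: derivative_eq_intros)
    from has_derivative_compose[OF this smooth_has_derivative[OF sm]] show ?thesis .
  qed
  then have der: "((\<lambda>s. \<zeta> (a + s *\<^sub>R v)) has_vector_derivative ?f s) (at s within {s0..s1})" for s
    unfolding has_vector_derivative_def
    by (auto intro: has_derivative_at_withinI)
  have cont: "continuous_on {s0..s1} ?f"
    by (intro continuous_intros continuous_on_compose2[OF continuous_on_grad[OF sm, of UNIV]]) auto
  have bi: "has_bochner_integral lborel (\<lambda>s. indicator {s0..s1} s *\<^sub>R ?f s)
      (\<zeta> (a + s1 *\<^sub>R v) - \<zeta> (a + s0 *\<^sub>R v))"
    using has_bochner_integral_FTC_Icc[OF assms(2) der cont] .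
  have "ennreal (norm (\<zeta> (a + s1 *\<^sub>R v) - \<zeta> (a + s0 *\<^sub>R v)))
      \<le> (\<integral>\<^sup>+s. norm (indicator {s0..s1} s *\<^sub>R ?f s) \<partial>lborel)"
    using integral_norm_bound_ennreal[OF integrable.intros[OF bi]]
    unfolding has_bochner_integral_integral_eq[OF bi] .
  also have "\<dots> \<le> (\<integral>\<^sup>+s. ennreal (norm v * norm (grad \<zeta> (a + s *\<^sub>R v))) * indicator {s0..s1} s \<partial>lborel)"
    by (intro nn_integral_mono)
      (auto simp: indicator_def mult.commute[of "norm v"] intro!: ennreal_leI Cauchy_Schwarz_ineq2)
  finally show ?thesis by simp
qed

text \<open>On the segment from \<open>x\<close> to \<open>x + \<tau>\<close> the increment is controlled by the Cauchy-Schwarz inequality.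
  By Tonelli's theorem, integration over \<open>x\<close> turns the integral along the segment into translates of
  the energy.\<close>

lemma translation_estimate:
  fixes \<zeta> :: "real^'n \<Rightarrow> real"
  assumes sm [measurable]: "smooth \<zeta>"
  shows "(\<integral>\<^sup>+x. ennreal ((\<zeta> (x + \<tau>) - \<zeta> x)\<^sup>2) \<partial>lborel)
    \<le> ennreal ((norm \<tau>)\<^sup>2) * sq_int lborel (grad \<zeta>)"
proof -
  have pt: "ennreal ((\<zeta> (x + \<tau>) - \<zeta> x)\<^sup>2)
      \<le> (\<integral>\<^sup>+s. ennreal ((norm \<tau>)\<^sup>2 * (norm (grad \<zeta> (x + s *\<^sub>R \<tau>)))\<^sup>2) * indicator {0..1} s \<partial>lborel)" for x
  proof -
    let ?h = "\<lambda>s. ennreal (norm \<tau> * norm (grad \<zeta> (x + s *\<^sub>R \<tau>))) * indicator {0..1} s"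
    have "ennreal ((\<zeta> (x + \<tau>) - \<zeta> x)\<^sup>2) = (ennreal \<bar>\<zeta> (x + 1 *\<^sub>R \<tau>) - \<zeta> (x + 0 *\<^sub>R \<tau>)\<bar>)\<^sup>2"
      by (simp add: ennreal_power)
    also have "\<dots> \<le> (\<integral>\<^sup>+s. ?h s * indicator {0..1} s \<partial>lborel)\<^sup>2"
      using increment_le_gradient_integral[OF sm, of 0 1 x \<tau>]
      by (intro power_mono) (auto simp: mult.assoc simp flip: indicator_inter_arith)
    also have "\<dots> \<le> (\<integral>\<^sup>+s. (?h s)\<^sup>2 \<partial>lborel) * (\<integral>\<^sup>+s. (indicator {0..1::real} s)\<^sup>2 \<partial>lborel)"
      by (intro Cauchy_Schwarz_nn_integral) auto
    also have "(\<integral>\<^sup>+s. (indicator {0..1::real} s)\<^sup>2 \<partial>lborel) = (1::ennreal)"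
      by (subst nn_integral_cong[of _ _ "indicator {0..1}"]) (auto simp: indicator_def)
    also have "(\<integral>\<^sup>+s. (?h s)\<^sup>2 \<partial>lborel) =
        (\<integral>\<^sup>+s. ennreal ((norm \<tau>)\<^sup>2 * (norm (grad \<zeta> (x + s *\<^sub>R \<tau>)))\<^sup>2) * indicator {0..1} s \<partial>lborel)"
      by (intro nn_integral_cong) (auto simp: indicator_def ennreal_power power_mult_distrib)
    finally show ?thesis by simp
  qed
  have "(\<integral>\<^sup>+x. ennreal ((\<zeta> (x + \<tau>) - \<zeta> x)\<^sup>2) \<partial>lborel)
      \<le> (\<integral>\<^sup>+x. (\<integral>\<^sup>+s. ennreal ((norm \<tau>)\<^sup>2 * (norm (grad \<zeta> (x + s *\<^sub>R \<tau>)))\<^sup>2) * indicator {0..1} s \<partial>lborel) \<partial>lborel)"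
    by (intro nn_integral_mono pt)
  also have "\<dots> = (\<integral>\<^sup>+s. (\<integral>\<^sup>+x. ennreal ((norm \<tau>)\<^sup>2 * (norm (grad \<zeta> (x + s *\<^sub>R \<tau>)))\<^sup>2) * indicator {0..1} s \<partial>lborel) \<partial>lborel)"
    by (rule lborel_pair.Fubini') measurable
  also have "\<dots> = (\<integral>\<^sup>+s. ennreal ((norm \<tau>)\<^sup>2) * sq_int lborel (grad \<zeta>) * indicator {0..1::real} s \<partial>lborel)"
  proof (intro nn_integral_cong)
    fix s :: real
    have "sq_int lborel (\<lambda>x. grad \<zeta> (x + s *\<^sub>R \<tau>)) = sq_int lborel (grad \<zeta>)"
      by (rule nn_integral_lborel_translate[where f = "\<lambda>x. ennreal ((norm (grad \<zeta> x))\<^sup>2)"]) measurable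
    then show "(\<integral>\<^sup>+x. ennreal ((norm \<tau>)\<^sup>2 * (norm (grad \<zeta> (x + s *\<^sub>R \<tau>)))\<^sup>2) * indicator {0..1} s \<partial>lborel)
      = ennreal ((norm \<tau>)\<^sup>2) * sq_int lborel (grad \<zeta>) * indicator {0..1} s"
      by (simp add: ennreal_mult nn_integral_cmult nn_integral_multc)
  qed
  also have "\<dots> = ennreal ((norm \<tau>)\<^sup>2) * sq_int lborel (grad \<zeta>)"
    by (subst nn_integral_cmult_indicator) auto
  finally show ?thesis .
qed

text \<open>The weight with which the energy density at distance \<open>m\<close> from the centre is counted in the lemma
  below.\<close>

lemma radial_weight_bound:
  fixes m :: real assumes "m \<ge> 0" "0 < \<rho>"
  shows "(\<integral>\<^sup>+s. ennreal (m / s\<^sup>2) * indicator {\<rho>..R} s * indicator {m<..} s \<partial>lborel) \<le> indicator {..<R} m"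
proof (cases "m < R \<and> m > 0")
  case True
  have "(\<integral>\<^sup>+s. ennreal (m / s\<^sup>2) * indicator {\<rho>..R} s * indicator {m<..} s \<partial>lborel)
    \<le> (\<integral>\<^sup>+s. ennreal (m / s\<^sup>2) * indicator {m..R} s \<partial>lborel)"
    by (intro nn_integral_mono) (auto simp: indicator_def)
  also have "\<dots> = ennreal ((- m / R) - (- m / m))"
    using True
    by (intro nn_integral_FTC_Icc)
       (auto intro!: derivative_eq_intros simp: power2_eq_square simp flip: has_real_derivative_iff_has_vector_derivative)
  also have "\<dots> \<le> 1" using True by (auto simp: ennreal_le_1)
  finally show ?thesis using True by (simp add: indicator_def)
next
  case False
  have "(\<integral>\<^sup>+s. ennreal (m / s\<^sup>2) * indicator {\<rho>..R} s * indicator {m<..} s \<partial>lborel) = nn_integral lborel (\<lambda>s::real. 0)"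
    using False assms by (intro nn_integral_cong) (auto simp: indicator_def)
  then show ?thesis by simp
qed

text \<open>The increment from \<open>z + \<rho>y\<close> to \<open>z + Ry\<close> is integrated along the ray. The integrand \<open>N = |\<nabla>\<zeta>|\<close> is
  split as \<open>N \<le> l s\<^bsup>d-1\<^esup> N\<^sup>2 + 1 / (4 l s\<^bsup>d-1\<^esup>)\<close>: after the substitution \<open>x = z + sy\<close> the weight
  \<open>s\<^bsup>d-1\<^esup>\<close> turns the first term into the energy on the ball, and the second one integrates to the
  reciprocal of the capacity of the ball of radius \<open>\<rho>\<close>. In dimension two this is \<open>ln (R/\<rho>)\<close>; the
  factor \<open>|y|\<close>, which is kept in the first term, prevents the square of the logarithm that averages
  over full balls would otherwise produce. The free parameter \<open>l\<close> does the work of the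
  Cauchy-Schwarz inequality and is optimised only after summation over all holes.\<close>

lemma radial_estimate:
  fixes \<zeta> :: "real^'n \<Rightarrow> real"
  assumes sm [measurable]: "smooth \<zeta>" and r: "0 < \<rho>" "\<rho> \<le> R" and l: "0 < l"
  shows "(\<integral>\<^sup>+y. ennreal \<bar>\<zeta> (z + R *\<^sub>R y) - \<zeta> (z + \<rho> *\<^sub>R y)\<bar> * indicator (ball 0 1) y \<partial>lborel)
    \<le> ennreal l * (\<integral>\<^sup>+x. ennreal ((norm (grad \<zeta> x))\<^sup>2) * indicator (ball z R) x \<partial>lborel)
      + ennreal (1 / (4 * l)) * emeasure lborel (ball 0 1 :: (real^'n) set)
        * (\<integral>\<^sup>+s. ennreal (1 / s ^ (CARD('n) - 1)) * indicator {\<rho>..R} s \<partial>lborel)"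
proof -
  let ?G = "\<lambda>x. ennreal ((norm (grad \<zeta> x))\<^sup>2)"
  let ?B = "ball 0 1 :: (real^'n) set"
  let ?k = "CARD('n) - 1"
  let ?A = "\<lambda>y s. ennreal (l * s ^ ?k * norm y) * ?G (z + s *\<^sub>R y) * indicator ?B y * indicator {\<rho>..R} s"
  let ?W = "\<lambda>x s. ennreal l * ?G x * (ennreal (norm (x - z) / s\<^sup>2) * indicator {\<rho>..R} s * indicator {norm (x - z)<..} s)"
  let ?V = "\<lambda>y s. ennreal l * ?G (z + s *\<^sub>R y) * (ennreal (norm (s *\<^sub>R y) / s\<^sup>2) * indicator {\<rho>..R} s * indicator {norm (s *\<^sub>R y)<..} s)"
  let ?C = "\<lambda>y s. ennreal (1 / (4 * l)) * indicator ?B y * (ennreal (1 / s ^ ?k) * indicator {\<rho>..R} s)"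
  have [measurable]: "?B \<in> sets borel" "{\<rho>..R} \<in> sets borel"
    "?B \<in> sets lborel" "{\<rho>..R} \<in> sets lborel" "ball z R \<in> sets borel" by auto
  have pt: "ennreal \<bar>\<zeta> (z + R *\<^sub>R y) - \<zeta> (z + \<rho> *\<^sub>R y)\<bar> * indicator ?B y
      \<le> (\<integral>\<^sup>+s. ?A y s + ?C y s \<partial>lborel)" for y
  proof (cases "y \<in> ?B")
    case True
    have "ennreal (norm y * norm (grad \<zeta> (z + s *\<^sub>R y))) * indicator {\<rho>..R} s \<le> ?A y s + ?C y s" for s
    proof (cases "s \<in> {\<rho>..R}")
      case s: True
      define N q where "N = norm (grad \<zeta> (z + s *\<^sub>R y))" and "q = l * s ^ ?k"
      have q: "q > 0" using s r l by (auto simp: q_def)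
      have "0 \<le> (2 * q * N - 1)\<^sup>2 / (4 * q)" using q by simp
      also have "\<dots> = q * N\<^sup>2 + 1 / (4 * q) - N"
        using q by (simp add: power2_eq_square field_simps)
      finally have "N \<le> q * N\<^sup>2 + 1 / (4 * q)" by simp
      then have "norm y * N \<le> norm y * (q * N\<^sup>2 + 1 / (4 * q))"
        by (rule mult_left_mono) simp
      also have "\<dots> \<le> q * norm y * N\<^sup>2 + 1 / (4 * q)"
        using True q mult_right_mono[of "norm y" 1 "1 / (4 * q)"] by (simp add: algebra_simps)
      finally have "ennreal (norm y * N) \<le> ennreal (q * norm y * N\<^sup>2 + 1 / (4 * l) * (1 / s ^ ?k))"
        by (intro ennreal_leI) (simp add: q_def)
      also have "\<dots> = ennreal (q * norm y) * ennreal (N\<^sup>2) + ennreal (1 / (4 * l)) * ennreal (1 / s ^ ?k)"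
      proof -
        have "ennreal (1 / (4 * l) * (1 / s ^ ?k)) = ennreal (1 / (4 * l)) * ennreal (1 / s ^ ?k)"
          using l s r by (intro ennreal_mult) auto
        moreover have "ennreal (q * norm y * N\<^sup>2) = ennreal (q * norm y) * ennreal (N\<^sup>2)"
          using q by (intro ennreal_mult) auto
        moreover have "0 \<le> q * norm y * N\<^sup>2" "0 \<le> 1 / (4 * l) * (1 / s ^ ?k)"
          using q l s r by auto
        ultimately show ?thesis by (simp only: ennreal_plus)
      qed
      finally show ?thesis using s True unfolding N_def q_def by simp
    qed simp
    then have "(\<integral>\<^sup>+s. ennreal (norm y * norm (grad \<zeta> (z + s *\<^sub>R y))) * indicator {\<rho>..R} s \<partial>lborel)
        \<le> (\<integral>\<^sup>+s. ?A y s + ?C y s \<partial>lborel)"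
      by (rule nn_integral_mono)
    with increment_le_gradient_integral[OF sm r(2), of z y] True show ?thesis
      by (auto intro: order_trans)
  qed simp
  have A: "(\<integral>\<^sup>+y. (\<integral>\<^sup>+s. ?A y s \<partial>lborel) \<partial>lborel) \<le> ennreal l * (\<integral>\<^sup>+x. ?G x * indicator (ball z R) x \<partial>lborel)"
  proof -
    have inner: "(\<integral>\<^sup>+y. ?A y s \<partial>lborel) =
        (\<integral>\<^sup>+x. ?W x s \<partial>lborel)" for s
    proof (cases "s \<in> {\<rho>..R}")
      case True
      then have s: "s > 0" using r by auto
      have k: "s ^ CARD('n) = s ^ ?k * s"
        by (metis One_nat_def Suc_diff_1 mult.commute power_Suc zero_less_card_finite)
      have "(\<integral>\<^sup>+x. ?W x s \<partial>lborel)
        = ennreal (s ^ CARD('n)) * (\<integral>\<^sup>+y. ?V y s \<partial>lborel)"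
      proof (subst nn_integral_lborel_affine[OF _ s, of _ z])
        show "(\<lambda>x. ?W x s) \<in> borel_measurable borel"
          unfolding indicator_def greaterThan_iff by measurable
      qed simp
      also have "\<dots> = (\<integral>\<^sup>+y. ennreal (s ^ CARD('n)) * (?V y s) \<partial>lborel)"
        unfolding indicator_def greaterThan_iff by (rule nn_integral_cmult[symmetric]) measurable
      also have "\<dots> = (\<integral>\<^sup>+y. ?A y s \<partial>lborel)"
      proof (intro nn_integral_cong)
        fix y :: "real^'n"
        have "s * norm y < s \<longleftrightarrow> norm y < 1" using s by simp
        then show "ennreal (s ^ CARD('n)) * (?V y s) = ?A y s"
          using True s l
          by (auto simp: indicator_def k power2_eq_square simp flip: ennreal_mult' intro!: arg_cong[where f=ennreal])
      qed
      finally show ?thesis by simp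
    qed simp
    have "(\<integral>\<^sup>+y. (\<integral>\<^sup>+s. ?A y s \<partial>lborel) \<partial>lborel) = (\<integral>\<^sup>+s. (\<integral>\<^sup>+y. ?A y s \<partial>lborel) \<partial>lborel)"
      by (rule lborel_pair.Fubini') measurable
    also have "\<dots> = (\<integral>\<^sup>+s. (\<integral>\<^sup>+x. ?W x s \<partial>lborel) \<partial>lborel)"
      by (simp only: inner)
    also have "\<dots> = (\<integral>\<^sup>+x. (\<integral>\<^sup>+s. ?W x s \<partial>lborel) \<partial>lborel)"
      unfolding indicator_def greaterThan_iff by (rule lborel_pair.Fubini') measurable
    also have "\<dots> = (\<integral>\<^sup>+x. ennreal l * ?G x * (\<integral>\<^sup>+s. (ennreal (norm (x - z) / s\<^sup>2) * indicator {\<rho>..R} s * indicator {norm (x - z)<..} s) \<partial>lborel) \<partial>lborel)"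
      by (intro nn_integral_cong nn_integral_cmult) measurable
    also have "\<dots> \<le> (\<integral>\<^sup>+x. ennreal l * ?G x * indicator {..<R} (norm (x - z)) \<partial>lborel)"
      using r by (intro nn_integral_mono mult_left_mono radial_weight_bound) auto
    also have "\<dots> = (\<integral>\<^sup>+x. ennreal l * (?G x * indicator (ball z R) x) \<partial>lborel)"
      by (intro nn_integral_cong) (auto simp: indicator_def dist_norm norm_minus_commute)
    also have "\<dots> = ennreal l * (\<integral>\<^sup>+x. ?G x * indicator (ball z R) x \<partial>lborel)"
      by (intro nn_integral_cmult) measurable
    finally show ?thesis .
  qed
  have C: "(\<integral>\<^sup>+y. (\<integral>\<^sup>+s. ?C y s \<partial>lborel) \<partial>lborel)
      = ennreal (1 / (4 * l)) * emeasure lborel ?B * (\<integral>\<^sup>+s. ennreal (1 / s ^ ?k) * indicator {\<rho>..R} s \<partial>lborel)"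
  proof -
    have "(\<integral>\<^sup>+y. (\<integral>\<^sup>+s. ?C y s \<partial>lborel) \<partial>lborel)
      = (\<integral>\<^sup>+y. (ennreal (1 / (4 * l)) * indicator ?B y) * (\<integral>\<^sup>+s. ennreal (1 / s ^ ?k) * indicator {\<rho>..R} s \<partial>lborel) \<partial>lborel)"
      by (intro nn_integral_cong nn_integral_cmult) measurable
    also have "\<dots> = (\<integral>\<^sup>+y. ennreal (1 / (4 * l)) * indicator ?B y \<partial>lborel) * (\<integral>\<^sup>+s. ennreal (1 / s ^ ?k) * indicator {\<rho>..R} s \<partial>lborel)"
      by (intro nn_integral_multc) measurable
    finally show ?thesis by (simp add: nn_integral_cmult_indicator)
  qed
  have "(\<integral>\<^sup>+y. ennreal \<bar>\<zeta> (z + R *\<^sub>R y) - \<zeta> (z + \<rho> *\<^sub>R y)\<bar> * indicator ?B y \<partial>lborel)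
      \<le> (\<integral>\<^sup>+y. (\<integral>\<^sup>+s. ?A y s + ?C y s \<partial>lborel) \<partial>lborel)"
    by (intro nn_integral_mono pt)
  also have "\<dots> = (\<integral>\<^sup>+y. (\<integral>\<^sup>+s. ?A y s \<partial>lborel) + (\<integral>\<^sup>+s. ?C y s \<partial>lborel) \<partial>lborel)"
    by (intro nn_integral_cong nn_integral_add) measurable
  also have "\<dots> = (\<integral>\<^sup>+y. (\<integral>\<^sup>+s. ?A y s \<partial>lborel) \<partial>lborel) + (\<integral>\<^sup>+y. (\<integral>\<^sup>+s. ?C y s \<partial>lborel) \<partial>lborel)"
    by (intro nn_integral_add) measurable
  also have "\<dots> \<le> ennreal l * (\<integral>\<^sup>+x. ?G x * indicator (ball z R) x \<partial>lborel)
      + ennreal (1 / (4 * l)) * emeasure lborel ?B * (\<integral>\<^sup>+s. ennreal (1 / s ^ ?k) * indicator {\<rho>..R} s \<partial>lborel)"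
    unfolding C by (intro add_right_mono A)
  finally show ?thesis .
qed

section \<open>The capacity inequality\<close>

text \<open>For each centre \<open>z\<close> and each \<open>y\<close> in the unit ball, the path \<open>z + \<rho>y\<close>, \<open>z + Ry\<close>, \<open>z + \<tau> + Ry\<close>,
  \<open>z + \<tau> + \<rho>y\<close> leads from a point where \<open>|\<zeta>| \<ge> L\<close> to a point where \<open>\<zeta> = 0\<close>. Its radial parts are
  bounded by \<open>radial_estimate\<close> and its middle part by \<open>translation_estimate\<close>; since the balls of
  radius \<open>R\<close> are disjoint, the energies add up to at most the total energy.\<close>

lemma capacity_inequality:
  fixes \<zeta> :: "real^'n \<Rightarrow> real" and Z :: "(real^'n) set"
  assumes sm [measurable]: "smooth \<zeta>" and Z: "finite Z" and r: "0 < \<rho>" "\<rho> \<le> R"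
    and disj: "\<And>z w. z \<in> Z \<Longrightarrow> w \<in> Z \<Longrightarrow> z \<noteq> w \<Longrightarrow> ball z R \<inter> ball w R = {}"
    and L: "0 < L" "\<And>z x. z \<in> Z \<Longrightarrow> x \<in> ball z \<rho> \<Longrightarrow> L \<le> \<bar>\<zeta> x\<bar>"
    and v: "\<And>z x. z \<in> Z \<Longrightarrow> x \<in> ball (z + \<tau>) \<rho> \<Longrightarrow> \<zeta> x = 0"
    and T: "0 < T" "norm \<tau> \<le> T"
    and J: "0 \<le> J" "(\<integral>\<^sup>+s. ennreal (1 / s ^ (CARD('n) - 1)) * indicator {\<rho>..R} s \<partial>lborel) \<le> ennreal J"
    and E: "0 \<le> E" "sq_int lborel (grad \<zeta>) \<le> ennreal E"
  shows "real (card Z) * L\<^sup>2 * measure lborel (ball 0 1 :: (real^'n) set)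
    \<le> 12 * (J / 2 + T\<^sup>2 / (4 * R ^ CARD('n))) * E"
proof -
  let ?B = "ball 0 1 :: (real^'n) set"
  define \<omega> where "\<omega> = measure lborel ?B"
  define K where "K = J / 2 + T\<^sup>2 / (4 * R ^ CARD('n))"
  \<comment> \<open>The sum of all terms that do not contain the energy will be \<open>card Z \<omega> K / l\<close>, which for this
    value of \<open>l\<close> is half of the left hand side \<open>card Z L \<omega>\<close>.\<close>
  define l where "l = 2 * K / L"
  \<comment> \<open>The same parameter for the translation, in the units of the integral over \<open>y\<close>.\<close>
  define m where "m = l * R ^ CARD('n) / T\<^sup>2"
  let ?G = "\<lambda>x. ennreal ((norm (grad \<zeta> x))\<^sup>2)"
  let ?D = "\<lambda>x. ennreal ((\<zeta> (x + \<tau>) - \<zeta> x)\<^sup>2)"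
  have R: "R > 0" using r by simp
  have K: "K > 0" using J T R unfolding K_def by (intro add_nonneg_pos) auto
  have l: "l > 0" using K L by (simp add: l_def)
  have m: "m > 0" using l T R by (simp add: m_def)
  have [measurable]: "?B \<in> sets borel" "?B \<in> sets lborel" by auto
  have [measurable]: "ball z R \<in> sets borel" for z :: "real^'n" by auto
  have \<omega>: "\<omega> > 0" unfolding \<omega>_def
    by (simp add: content_ball_pos)
  have em: "emeasure lborel ?B = ennreal \<omega>"
    unfolding \<omega>_def using emeasure_lborel_ball_finite[of "0::real^'n" 1]
    by (intro emeasure_eq_ennreal_measure) auto
  have disj_sum: "(\<Sum>z\<in>Z. \<integral>\<^sup>+x. F x * indicator (ball (z + c) R) x \<partial>lborel) \<le> (\<integral>\<^sup>+x. F x \<partial>lborel)"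
    if [measurable]: "F \<in> borel_measurable borel" for F :: "real^'n \<Rightarrow> ennreal" and c
  proof -
    have "(\<Sum>z\<in>Z. \<integral>\<^sup>+x. F x * indicator (ball (z + c) R) x \<partial>lborel)
        = (\<integral>\<^sup>+x. (\<Sum>z\<in>Z. F x * indicator (ball (z + c) R) x) \<partial>lborel)"
      by (rule nn_integral_sum[symmetric]) measurable
    also have "\<dots> \<le> (\<integral>\<^sup>+x. F x \<partial>lborel)"
    proof (intro nn_integral_mono)
      fix x
      have "(\<Sum>z\<in>Z. indicator (ball (z + c) R) x) \<le> (1::ennreal)"
      proof (cases "\<exists>w\<in>Z. x \<in> ball (w + c) R")
        case True
        then obtain w where w: "w \<in> Z" "x \<in> ball (w + c) R" by blast
        have "x \<notin> ball (z + c) R" if "z \<in> Z" "z \<noteq> w" for z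
        proof
          assume "x \<in> ball (z + c) R"
          then have "x - c \<in> ball z R \<inter> ball w R"
            using w by (simp add: dist_norm algebra_simps)
          with disj[OF that(1) w(1) that(2)] show False by blast
        qed
        then have "(\<Sum>z\<in>Z. indicator (ball (z + c) R) x) = (\<Sum>z\<in>Z. if z = w then 1 else 0 :: ennreal)"
          using w by (intro sum.cong) (auto simp: indicator_def)
        then show ?thesis using Z w by simp
      next
        case False
        then have "(\<Sum>z\<in>Z. indicator (ball (z + c) R) x) = (0::ennreal)"
          by (intro sum.neutral) (auto simp: indicator_def)
        then show ?thesis by simp
      qed
      then show "(\<Sum>z\<in>Z. F x * indicator (ball (z + c) R) x) \<le> F x"
        using mult_left_mono[of _ "1::ennreal" "F x"] by (simp flip: sum_distrib_left)
    qed
    finally show ?thesis .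
  qed
  let ?I = "\<lambda>z. \<integral>\<^sup>+y. ennreal \<bar>\<zeta> (z + R *\<^sub>R y) - \<zeta> (z + \<rho> *\<^sub>R y)\<bar> * indicator ?B y \<partial>lborel"
  let ?II = "\<lambda>z. \<integral>\<^sup>+y. ennreal \<bar>\<zeta> (z + R *\<^sub>R y + \<tau>) - \<zeta> (z + R *\<^sub>R y)\<bar> * indicator ?B y \<partial>lborel"
  have chain: "ennreal (L * \<omega>) \<le> ?I z + ?I (z + \<tau>) + ?II z" if z: "z \<in> Z" for z
  proof -
    have "ennreal (L * \<omega>) = (\<integral>\<^sup>+y. ennreal L * indicator ?B y \<partial>lborel)"
      using L \<omega> by (simp add: nn_integral_cmult_indicator em ennreal_mult)
    also have "\<dots> \<le> (\<integral>\<^sup>+y. ennreal \<bar>\<zeta> (z + R *\<^sub>R y) - \<zeta> (z + \<rho> *\<^sub>R y)\<bar> * indicator ?B y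
        + ennreal \<bar>\<zeta> (z + \<tau> + R *\<^sub>R y) - \<zeta> (z + \<tau> + \<rho> *\<^sub>R y)\<bar> * indicator ?B y
        + ennreal \<bar>\<zeta> (z + R *\<^sub>R y + \<tau>) - \<zeta> (z + R *\<^sub>R y)\<bar> * indicator ?B y \<partial>lborel)"
    proof (intro nn_integral_mono)
      fix y :: "real^'n"
      show "ennreal L * indicator ?B y \<le> ennreal \<bar>\<zeta> (z + R *\<^sub>R y) - \<zeta> (z + \<rho> *\<^sub>R y)\<bar> * indicator ?B y
        + ennreal \<bar>\<zeta> (z + \<tau> + R *\<^sub>R y) - \<zeta> (z + \<tau> + \<rho> *\<^sub>R y)\<bar> * indicator ?B y
        + ennreal \<bar>\<zeta> (z + R *\<^sub>R y + \<tau>) - \<zeta> (z + R *\<^sub>R y)\<bar> * indicator ?B y"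
      proof (cases "y \<in> ?B")
        case True
        then have "z + \<rho> *\<^sub>R y \<in> ball z \<rho>" "z + \<tau> + \<rho> *\<^sub>R y \<in> ball (z + \<tau>) \<rho>"
          using r by (auto simp: dist_norm)
        then have "L \<le> \<bar>\<zeta> (z + \<rho> *\<^sub>R y)\<bar>" "\<zeta> (z + \<tau> + \<rho> *\<^sub>R y) = 0"
          using L(2)[OF z] v[OF z] by blast+
        moreover have "z + \<tau> + R *\<^sub>R y = z + R *\<^sub>R y + \<tau>" by simp
        ultimately have "L \<le> \<bar>\<zeta> (z + R *\<^sub>R y) - \<zeta> (z + \<rho> *\<^sub>R y)\<bar> + \<bar>\<zeta> (z + \<tau> + R *\<^sub>R y) - \<zeta> (z + \<tau> + \<rho> *\<^sub>R y)\<bar>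
            + \<bar>\<zeta> (z + R *\<^sub>R y + \<tau>) - \<zeta> (z + R *\<^sub>R y)\<bar>"
          by (smt (verit))
        then show ?thesis using True by (simp flip: ennreal_plus)
      qed simp
    qed
    also have "\<dots> = ?I z + ?I (z + \<tau>) + ?II z"
      by (subst nn_integral_add; (subst nn_integral_add)?; measurable)
    finally show ?thesis .
  qed
  have I: "?I z \<le> ennreal l * (\<integral>\<^sup>+x. ?G x * indicator (ball z R) x \<partial>lborel) + ennreal (\<omega> * J / (4 * l))" for z
  proof -
    have "ennreal (1 / (4 * l)) * emeasure lborel ?B
        * (\<integral>\<^sup>+s. ennreal (1 / s ^ (CARD('n) - 1)) * indicator {\<rho>..R} s \<partial>lborel)
        \<le> ennreal (1 / (4 * l)) * ennreal \<omega> * ennreal J"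
      unfolding em by (intro mult_left_mono J) auto
    also have "\<dots> = ennreal (\<omega> * J / (4 * l))"
      using l \<omega> J by (simp flip: ennreal_mult)
    finally show ?thesis
      using radial_estimate[OF sm r l, of z] by (meson add_left_mono order_trans)
  qed
  have II: "?II z \<le> ennreal (l / T\<^sup>2) * (\<integral>\<^sup>+x. ?D x * indicator (ball z R) x \<partial>lborel) + ennreal (\<omega> / (4 * m))" for z
  proof -
    have "?II z \<le> (\<integral>\<^sup>+y. ennreal m * (?D (z + R *\<^sub>R y) * indicator (ball z R) (z + R *\<^sub>R y)) + ennreal (1 / (4 * m)) * indicator ?B y \<partial>lborel)"
    proof (intro nn_integral_mono)
      fix y :: "real^'n"
      define t where "t = \<bar>\<zeta> (z + R *\<^sub>R y + \<tau>) - \<zeta> (z + R *\<^sub>R y)\<bar>"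
      have "0 \<le> (2 * m * t - 1)\<^sup>2 / (4 * m)" using m by simp
      also have "\<dots> = m * t\<^sup>2 + 1 / (4 * m) - t"
        using m by (simp add: power2_eq_square field_simps)
      finally have "ennreal t \<le> ennreal (m * t\<^sup>2 + 1 / (4 * m))" by (intro ennreal_leI) simp
      also have "\<dots> = ennreal m * ennreal (t\<^sup>2) + ennreal (1 / (4 * m))"
        using m by (simp add: ennreal_mult)
      finally have "ennreal t \<le> ennreal m * ennreal (t\<^sup>2) + ennreal (1 / (4 * m))" .
      moreover have "z + R *\<^sub>R y \<in> ball z R" if "y \<in> ?B" using that R by (simp add: dist_norm)
      ultimately show "ennreal \<bar>\<zeta> (z + R *\<^sub>R y + \<tau>) - \<zeta> (z + R *\<^sub>R y)\<bar> * indicator ?B y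
        \<le> ennreal m * (?D (z + R *\<^sub>R y) * indicator (ball z R) (z + R *\<^sub>R y)) + ennreal (1 / (4 * m)) * indicator ?B y"
        by (auto simp: t_def indicator_def)
    qed
    also have "\<dots> = (\<integral>\<^sup>+y. ennreal m * (?D (z + R *\<^sub>R y) * indicator (ball z R) (z + R *\<^sub>R y)) \<partial>lborel)
        + (\<integral>\<^sup>+y. ennreal (1 / (4 * m)) * indicator ?B y \<partial>lborel)"
      by (rule nn_integral_add) measurable
    also have "(\<integral>\<^sup>+y. ennreal (1 / (4 * m)) * indicator ?B y \<partial>lborel) = ennreal (\<omega> / (4 * m))"
      using m \<omega> by (simp add: nn_integral_cmult_indicator em flip: ennreal_mult)
    also have "(\<integral>\<^sup>+y. ennreal m * (?D (z + R *\<^sub>R y) * indicator (ball z R) (z + R *\<^sub>R y)) \<partial>lborel)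
        = ennreal m * (\<integral>\<^sup>+y. ?D (z + R *\<^sub>R y) * indicator (ball z R) (z + R *\<^sub>R y) \<partial>lborel)"
      by (rule nn_integral_cmult) measurable
    also have "\<dots> = ennreal (l / T\<^sup>2) * (\<integral>\<^sup>+x. ?D x * indicator (ball z R) x \<partial>lborel)"
    proof -
      have "(\<integral>\<^sup>+x. ?D x * indicator (ball z R) x \<partial>lborel)
        = ennreal (R ^ CARD('n)) * (\<integral>\<^sup>+y. ?D (z + R *\<^sub>R y) * indicator (ball z R) (z + R *\<^sub>R y) \<partial>lborel)"
        by (rule nn_integral_lborel_affine[OF _ R]) measurable
      moreover have "ennreal m = ennreal (l / T\<^sup>2) * ennreal (R ^ CARD('n))"
        using l T R by (simp add: m_def flip: ennreal_mult)
      ultimately show ?thesis by (simp add: mult.assoc)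
    qed
    finally show ?thesis .
  qed
  have "ennreal (card Z * (L * \<omega>)) = (\<Sum>z\<in>Z. ennreal (L * \<omega>))"
    using L \<omega> by (simp add: ennreal_mult ennreal_of_nat_eq_real_of_nat)
  also have "\<dots> \<le> (\<Sum>z\<in>Z. ?I z + ?I (z + \<tau>) + ?II z)"
    by (intro sum_mono chain)
  also have "\<dots> \<le> (\<Sum>z\<in>Z. (ennreal l * (\<integral>\<^sup>+x. ?G x * indicator (ball (z + 0) R) x \<partial>lborel) + ennreal (\<omega> * J / (4 * l)))
      + (ennreal l * (\<integral>\<^sup>+x. ?G x * indicator (ball (z + \<tau>) R) x \<partial>lborel) + ennreal (\<omega> * J / (4 * l)))
      + (ennreal (l / T\<^sup>2) * (\<integral>\<^sup>+x. ?D x * indicator (ball (z + 0) R) x \<partial>lborel) + ennreal (\<omega> / (4 * m))))"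
    using I II by (intro sum_mono add_mono) (simp_all only: add_0_right)
  also have "\<dots> = ennreal l * (\<Sum>z\<in>Z. \<integral>\<^sup>+x. ?G x * indicator (ball (z + 0) R) x \<partial>lborel)
      + ennreal l * (\<Sum>z\<in>Z. \<integral>\<^sup>+x. ?G x * indicator (ball (z + \<tau>) R) x \<partial>lborel)
      + ennreal (l / T\<^sup>2) * (\<Sum>z\<in>Z. \<integral>\<^sup>+x. ?D x * indicator (ball (z + 0) R) x \<partial>lborel)
      + (\<Sum>z\<in>Z. ennreal (\<omega> * J / (4 * l)) + ennreal (\<omega> * J / (4 * l)) + ennreal (\<omega> / (4 * m)))"
    by (simp only: sum.distrib sum_distrib_left ac_simps)
  also have "\<dots> \<le> ennreal l * ennreal E + ennreal l * ennreal E + ennreal (l / T\<^sup>2) * ennreal (T\<^sup>2 * E)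
      + (\<Sum>z\<in>Z. ennreal (\<omega> * J / (4 * l)) + ennreal (\<omega> * J / (4 * l)) + ennreal (\<omega> / (4 * m)))"
  proof (intro add_mono mult_left_mono order_refl)
    show "(\<Sum>z\<in>Z. \<integral>\<^sup>+x. ?G x * indicator (ball (z + 0) R) x \<partial>lborel) \<le> ennreal E"
      by (rule order_trans[OF disj_sum E(2)]) measurable
    show "(\<Sum>z\<in>Z. \<integral>\<^sup>+x. ?G x * indicator (ball (z + \<tau>) R) x \<partial>lborel) \<le> ennreal E"
      by (rule order_trans[OF disj_sum E(2)]) measurable
    have "(\<Sum>z\<in>Z. \<integral>\<^sup>+x. ?D x * indicator (ball (z + 0) R) x \<partial>lborel) \<le> (\<integral>\<^sup>+x. ?D x \<partial>lborel)"
      by (rule disj_sum) measurable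
    also have "\<dots> \<le> ennreal ((norm \<tau>)\<^sup>2) * (\<integral>\<^sup>+x. ?G x \<partial>lborel)"
      by (rule translation_estimate[OF sm])
    also have "\<dots> \<le> ennreal (T\<^sup>2) * ennreal E"
      using T by (intro mult_mono E(2) ennreal_leI power_mono) auto
    finally show "(\<Sum>z\<in>Z. \<integral>\<^sup>+x. ?D x * indicator (ball (z + 0) R) x \<partial>lborel) \<le> ennreal (T\<^sup>2 * E)"
      using E by (simp add: ennreal_mult)
  qed auto
  also have "\<dots> = ennreal (3 * l * E + card Z * (\<omega> * J / (4 * l) + \<omega> * J / (4 * l) + \<omega> / (4 * m)))"
  proof -
    have "(\<Sum>z\<in>Z. ennreal (\<omega> * J / (4 * l)) + ennreal (\<omega> * J / (4 * l)) + ennreal (\<omega> / (4 * m)))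
      = ennreal (card Z * (\<omega> * J / (4 * l) + \<omega> * J / (4 * l) + \<omega> / (4 * m)))"
      using l m \<omega> J
      by (simp add: ennreal_mult ennreal_of_nat_eq_real_of_nat flip: ennreal_plus)
    moreover have "ennreal l * ennreal E + ennreal l * ennreal E + ennreal (l / T\<^sup>2) * ennreal (T\<^sup>2 * E) = ennreal (3 * l * E)"
      using l E T by (simp flip: ennreal_mult ennreal_plus)
    ultimately show ?thesis
      using l m \<omega> J E by (simp flip: ennreal_plus)
  qed
  finally have "card Z * (L * \<omega>) \<le> 3 * l * E + card Z * (\<omega> * J / (4 * l) + \<omega> * J / (4 * l) + \<omega> / (4 * m))"
    using l m \<omega> J E by (subst (asm) ennreal_le_iff) auto
  also have "\<omega> * J / (4 * l) + \<omega> * J / (4 * l) + \<omega> / (4 * m) = \<omega> * K / l"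
    using l T R by (simp add: m_def K_def field_simps)
  also have "\<omega> * K / l = L * \<omega> / 2"
    using K L by (simp add: l_def)
  finally have "card Z * (L * \<omega>) \<le> 6 * l * E" by (simp add: field_simps)
  then have "card Z * (L * \<omega>) * L \<le> 6 * l * E * L"
    using L by (intro mult_right_mono) auto
  also have "6 * l * E * L = 12 * K * E" using L by (simp add: l_def)
  finally show ?thesis by (simp add: K_def \<omega>_def power2_eq_square mult_ac)
qed

text \<open>A translation by \<open>2r\<close> moves the whole support off itself.\<close>

lemma poincare_inequality:
  fixes \<zeta> :: "real^'n \<Rightarrow> real"
  assumes sm: "smooth \<zeta>" and z: "\<And>x. norm x \<ge> r \<Longrightarrow> \<zeta> x = 0" and r: "r > 0"
  shows "(\<integral>\<^sup>+x. ennreal ((\<zeta> x)\<^sup>2) \<partial>lborel)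
    \<le> ennreal ((2 * r)\<^sup>2) * sq_int lborel (grad \<zeta>)"
proof -
  obtain e :: "real^'n" where e: "norm e = 1" using vector_choose_size[of 1] by auto
  define \<tau> where "\<tau> = (2 * r) *\<^sub>R e"
  have \<tau>: "norm \<tau> = 2 * r" using e r by (simp add: \<tau>_def)
  have "(\<integral>\<^sup>+x. ennreal ((\<zeta> x)\<^sup>2) \<partial>lborel) \<le> (\<integral>\<^sup>+x. ennreal ((\<zeta> (x + \<tau>) - \<zeta> x)\<^sup>2) \<partial>lborel)"
  proof (intro nn_integral_mono ennreal_leI)
    fix x
    show "(\<zeta> x)\<^sup>2 \<le> (\<zeta> (x + \<tau>) - \<zeta> x)\<^sup>2"
    proof (cases "norm x < r")
      case True
      then have "norm (x + \<tau>) \<ge> r" using \<tau> norm_diff_ineq[of \<tau> x] by (simp add: add.commute)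
      then show ?thesis using z by simp
    qed (use z in simp)
  qed
  with translation_estimate[OF sm, of \<tau>] show ?thesis by (simp add: \<tau>)
qed

section \<open>Limits in the space of square integrable functions\<close>

text \<open>For a sequence that converges at a geometric rate no subsequence has to be chosen: the sum of
  \<open>2\<^sup>k |f\<^sub>k\<^sub>+\<^sub>1 - f\<^sub>k|\<^sup>2\<close> is integrable, hence finite almost everywhere, and it dominates the sum of
  the increments because \<open>t \<le> 2\<^sup>k t\<^sup>2 + 2\<^bsup>-k\<^esup>\<close>. The rate passes to the limit by Fatou's lemma.\<close>

lemma Riesz_Fischer_fast:
  fixes f :: "nat \<Rightarrow> 'a \<Rightarrow> 'b::{banach, second_countable_topology}"
  assumes [measurable]: "\<And>k. f k \<in> borel_measurable M"
    and C: "C \<ge> 0" "\<And>j k. j \<ge> k \<Longrightarrow> sq_int M (\<lambda>x. f j x - f k x) \<le> ennreal (C / 4 ^ k)"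
  shows "(\<lambda>x. lim (\<lambda>k. f k x)) \<in> borel_measurable M"
    and "sq_int M (\<lambda>x. f k x - lim (\<lambda>k. f k x)) \<le> ennreal (C / 4 ^ k)"
proof -
  show [measurable]: "(\<lambda>x. lim (\<lambda>k. f k x)) \<in> borel_measurable M" by measurable
  have "(\<integral>\<^sup>+x. (\<Sum>k. ennreal (2 ^ k * (norm (f (Suc k) x - f k x))\<^sup>2)) \<partial>M)
      = (\<Sum>k. \<integral>\<^sup>+x. ennreal (2 ^ k * (norm (f (Suc k) x - f k x))\<^sup>2) \<partial>M)"
    by (rule nn_integral_suminf) measurable
  also have "\<dots> \<le> (\<Sum>k. ennreal (C * (1/2) ^ k))"
  proof (intro suminf_le summableI)
    fix k
    have "(\<integral>\<^sup>+x. ennreal (2 ^ k * (norm (f (Suc k) x - f k x))\<^sup>2) \<partial>M)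
        = ennreal (2 ^ k) * sq_int M (\<lambda>x. f (Suc k) x - f k x)"
      by (subst nn_integral_cmult[symmetric]) (auto simp: ennreal_mult)
    also have "\<dots> \<le> ennreal (2 ^ k) * ennreal (C / 4 ^ k)"
      using C(2)[of k "Suc k"] by (intro mult_left_mono) auto
    also have "\<dots> = ennreal (C * (1/2) ^ k)"
    proof -
      have "(4::real) ^ k = 2 ^ k * 2 ^ k" by (simp flip: power_mult_distrib)
      then show ?thesis using C(1) by (simp add: power_divide flip: ennreal_mult)
    qed
    finally show "(\<integral>\<^sup>+x. ennreal (2 ^ k * (norm (f (Suc k) x - f k x))\<^sup>2) \<partial>M) \<le> ennreal (C * (1/2) ^ k)" .
  qed
  also have "\<dots> < \<infinity>"
    using C(1) by (subst suminf_ennreal2) (auto intro!: summable_mult summable_geometric)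
  finally have "AE x in M. (\<Sum>k. ennreal (2 ^ k * (norm (f (Suc k) x - f k x))\<^sup>2)) \<noteq> \<infinity>"
    by (intro nn_integral_noteq_infinite) auto
  then have conv: "AE x in M. convergent (\<lambda>k. f k x)"
  proof eventually_elim
    case (elim x)
    define d where "d k = norm (f (Suc k) x - f k x)" for k
    have "summable (\<lambda>k. 2 ^ k * (d k)\<^sup>2)"
      using elim unfolding d_def by (intro summable_suminf_not_top) auto
    then have s: "summable (\<lambda>k. 2 ^ k * (d k)\<^sup>2 + (1/2) ^ k)"
      by (intro summable_add summable_geometric) auto
    have "summable d"
    proof (rule summable_comparison_test'[OF s])
      fix k
      define q :: real where "q = 2 ^ k"
      have q: "q > 0" by (simp add: q_def)
      have "0 \<le> (q * d k - 1)\<^sup>2 / q + d k" using q by (simp add: d_def)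
      also have "\<dots> = q * (d k)\<^sup>2 + 1 / q - d k"
        using q by (simp add: power2_eq_square field_simps)
      finally show "norm (d k) \<le> 2 ^ k * (d k)\<^sup>2 + (1/2) ^ k"
        by (simp add: q_def power_divide d_def)
    qed
    then have "summable (\<lambda>k. f (Suc k) x - f k x)"
      unfolding d_def by (rule summable_norm_cancel)
    then have "convergent (\<lambda>n. \<Sum>k<n. f (Suc k) x - f k x)"
      by (simp add: summable_iff_convergent)
    then have "convergent (\<lambda>n. (f n x - f 0 x) + f 0 x)"
      unfolding sum_lessThan_telescope[of "\<lambda>k. f k x"] by (intro convergent_add convergent_const)
    then show ?case by simp
  qed
  have "sq_int M (\<lambda>x. f k x - lim (\<lambda>k. f k x))
      = (\<integral>\<^sup>+x. liminf (\<lambda>j. ennreal ((norm (f k x - f j x))\<^sup>2)) \<partial>M)"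
  proof (intro nn_integral_cong_AE)
    show "AE x in M. ennreal ((norm (f k x - lim (\<lambda>k. f k x)))\<^sup>2) = liminf (\<lambda>j. ennreal ((norm (f k x - f j x))\<^sup>2))"
      using conv
    proof eventually_elim
      case (elim x)
      then have "(\<lambda>j. f j x) \<longlonglongrightarrow> lim (\<lambda>k. f k x)" by (simp add: convergent_LIMSEQ_iff)
      then have L: "(\<lambda>j. ennreal ((norm (f k x - f j x))\<^sup>2)) \<longlonglongrightarrow> ennreal ((norm (f k x - lim (\<lambda>k. f k x)))\<^sup>2)"
        by (intro tendsto_intros)
      show ?case by (rule lim_imp_Liminf[OF sequentially_bot L, symmetric])
    qed
  qed
  also have "\<dots> \<le> liminf (\<lambda>j. \<integral>\<^sup>+x. ennreal ((norm (f k x - f j x))\<^sup>2) \<partial>M)"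
    by (rule nn_integral_liminf) measurable
  also have "\<dots> \<le> ennreal (C / 4 ^ k)"
  proof (rule Liminf_le)
    show "\<forall>\<^sub>F j in sequentially. sq_int M (\<lambda>x. f k x - f j x) \<le> ennreal (C / 4 ^ k)"
      using C(2)[of k] by (intro eventually_sequentiallyI[of k]) (simp add: norm_minus_commute)
  qed simp
  finally show "sq_int M (\<lambda>x. f k x - lim (\<lambda>k. f k x)) \<le> ennreal (C / 4 ^ k)" .
qed

section \<open>Test functions and integration by parts\<close>

lemma integrable_compact_support:
  fixes f :: "real^'n \<Rightarrow> 'b::{banach, second_countable_topology}"
  assumes "continuous_on UNIV f" "compact K" "\<And>x. x \<notin> K \<Longrightarrow> f x = 0"
  shows "integrable lborel f"
proof -
  have "integrable lborel (\<lambda>x. indicator K x *\<^sub>R f x)"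
    using assms by (intro borel_integrable_compact continuous_on_subset[OF assms(1)]) auto
  moreover have "(\<lambda>x. indicator K x *\<^sub>R f x) = f"
    using assms(3) by (auto simp: indicator_def fun_eq_iff)
  ultimately show ?thesis by simp
qed

lemma test_functionsD:
  assumes "\<phi> \<in> test_functions U"
  shows "smooth \<phi>" "compact (closure {x. \<phi> x \<noteq> 0})" "x \<notin> U \<Longrightarrow> \<phi> x = 0" "x \<notin> U \<Longrightarrow> grad \<phi> x = 0"
    "\<phi> \<in> test_functions UNIV"
  using assms closure_subset[of "{x. \<phi> x \<noteq> 0}"]
  by (auto simp: test_functions_def intro: grad_eq_0)

lemma test_functions_combine:
  assumes "\<phi> \<in> test_functions U" "\<psi> \<in> test_functions U" "smooth \<upsilon>"
    and "\<And>x. \<phi> x = 0 \<Longrightarrow> \<psi> x = 0 \<Longrightarrow> \<upsilon> x = 0"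
  shows "\<upsilon> \<in> test_functions U"
proof -
  let ?K = "closure {x. \<phi> x \<noteq> 0} \<union> closure {x. \<psi> x \<noteq> 0}"
  have "closure {x. \<upsilon> x \<noteq> 0} \<subseteq> ?K"
    using assms(4) unfolding closure_Un[symmetric] by (intro closure_mono) auto
  moreover have "compact ?K" "?K \<subseteq> U"
    using assms(1,2) by (auto simp: test_functions_def intro!: compact_Un)
  ultimately show ?thesis
    using assms(3) unfolding test_functions_def mem_Collect_eq
    by (meson bounded_subset closed_closure compact_eq_bounded_closed order_trans)
qed

lemma test_functions_add:
  "\<phi> \<in> test_functions U \<Longrightarrow> \<psi> \<in> test_functions U \<Longrightarrow> (\<lambda>x. \<phi> x + c * \<psi> x) \<in> test_functions U"
  by (rule test_functions_combine[of \<phi> U \<psi>])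
     (auto dest!: test_functionsD(1) intro!: smooth_add smooth_mult smooth_const)

lemma test_functions_scale: "\<phi> \<in> test_functions U \<Longrightarrow> (\<lambda>x. c * \<phi> x) \<in> test_functions U"
  by (rule test_functions_combine[of \<phi> _ \<phi>])
     (auto dest!: test_functionsD(1) intro!: smooth_mult smooth_const)

lemma zero_test_function: "(\<lambda>x. 0) \<in> test_functions U"
  by (simp add: test_functions_def smooth_const)

text \<open>The translates of a compactly supported function have the same integral, so the integral of
  a difference quotient vanishes; the quotients converge boundedly to the partial derivative.\<close>

lemma integral_pderiv_eq_0:
  fixes w :: "real^'n \<Rightarrow> real"
  assumes w: "w \<in> test_functions UNIV"
  shows "(LINT x|lborel. pderiv_at i w x) = 0"
proof -
  note sm = test_functionsD(1)[OF w] and K = test_functionsD(2)[OF w]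
  obtain M where M: "M > 0" "\<And>x. norm (grad w x) \<le> M" using grad_bounded[OF sm K] by blast
  have "bounded {x. w x \<noteq> 0}" using K compact_closure by blast
  then obtain r where r: "r > 0" "\<And>x. w x \<noteq> 0 \<Longrightarrow> norm x \<le> r"
    unfolding bounded_pos by blast
  define v :: "real^'n" where "v = axis i 1"
  have nv: "norm v = 1" by (simp add: v_def)
  define h where "h k = 1 / real (Suc k)" for k
  have h: "h k > 0" "h k \<le> 1" "h \<longlonglongrightarrow> 0" for k
    using LIMSEQ_inverse_real_of_nat by (auto simp: h_def[abs_def] inverse_eq_divide)
  define q where "q k x = (w (x + h k *\<^sub>R v) - w x) / h k" for k x
  have ws: "integrable lborel w"
    by (rule integrable_compact_support[OF continuous_on_smooth[OF sm] K])
       (use closure_subset[of "{x. w x \<noteq> 0}"] in auto)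
  have wt: "integrable lborel (\<lambda>x. w (x + a))" and wi: "(LINT x|lborel. w (x + a)) = (LINT x|lborel. w x)" for a
  proof -
    have [measurable]: "w \<in> borel_measurable borel" using sm by measurable
    have "integrable (distr lborel borel ((+) a)) w" using ws by (simp add: lborel_distr_plus)
    then show "integrable lborel (\<lambda>x. w (x + a))"
      by (subst (asm) integrable_distr_eq) (auto simp: add.commute)
    have "(LINT x|distr lborel borel ((+) a). w x) = (LINT x|lborel. w x)" by (simp add: lborel_distr_plus)
    then show "(LINT x|lborel. w (x + a)) = (LINT x|lborel. w x)"
      by (subst (asm) integral_distr) (auto simp: add.commute)
  qed
  have "(\<lambda>k. LINT x|lborel. q k x) \<longlonglongrightarrow> (LINT x|lborel. pderiv_at i w x)"
  proof (rule integral_dominated_convergence[where w = "\<lambda>x. M * indicator (cball 0 (r + 1)) x"])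
    show "pderiv_at i w \<in> borel_measurable lborel"
      using smooth_pderiv[OF sm] by measurable
    show "q k \<in> borel_measurable lborel" for k
      unfolding q_def using sm by measurable
    show "integrable lborel (\<lambda>x::real^'n. M * indicator (cball 0 (r + 1)) x)"
      using emeasure_lborel_cball_finite[of "0::real^'n" "r+1"]
      by (intro integrable_mult_right integrable_real_indicator) auto
    show "AE x in lborel. (\<lambda>k. q k x) \<longlonglongrightarrow> pderiv_at i w x"
    proof (intro AE_I2)
      fix x
      have "((\<lambda>t. w (x + t *\<^sub>R v)) has_derivative (\<lambda>t. grad w (x + 0 *\<^sub>R v) \<bullet> (t *\<^sub>R v))) (at 0)"
        by (rule has_derivative_compose[OF _ smooth_has_derivative[OF sm]])
           (auto intro!: derivative_eq_intros)
      then have "((\<lambda>t. w (x + t *\<^sub>R v)) has_real_derivative pderiv_at i w x) (at 0)"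
        by (simp add: has_field_derivative_def grad_def v_def inner_axis mult_commute_abs)
      then have "((\<lambda>t. (w (x + t *\<^sub>R v) - w x) / t) \<longlongrightarrow> pderiv_at i w x) (at 0)"
        by (simp add: DERIV_def)
      moreover have "filterlim h (at 0) sequentially"
        using h by (intro filterlim_atI) (auto intro!: always_eventually simp: less_imp_neq[symmetric])
      ultimately show "(\<lambda>k. q k x) \<longlonglongrightarrow> pderiv_at i w x"
        unfolding q_def by (rule filterlim_compose)
    qed
    show "AE x in lborel. norm (q k x) \<le> M * indicator (cball 0 (r + 1)) x" for k
    proof (intro AE_I2)
      fix x
      show "norm (q k x) \<le> M * indicator (cball 0 (r + 1)) x"
      proof (cases "x \<in> cball 0 (r + 1)")
        case True
        have "norm (w (x + h k *\<^sub>R v) - w x) \<le> M * norm (x + h k *\<^sub>R v - x)"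
        proof (rule differentiable_bound[where S = UNIV and f' = "\<lambda>y h. grad w y \<bullet> h"])
          show "onorm (\<lambda>h. grad w y \<bullet> h) \<le> M" for y
            using M(2)[of y] by (intro onorm_le) (auto intro!: order_trans[OF Cauchy_Schwarz_ineq2] mult_right_mono)
        qed (use smooth_has_derivative[OF sm] in auto)
        then show ?thesis using True h(1,2)[of k] nv by (simp add: q_def divide_le_eq)
      next
        case False
        then have n: "norm x > r + 1" by simp
        then have "norm (x + h k *\<^sub>R v) > r"
          using norm_diff_ineq[of x "h k *\<^sub>R v"] h(1,2)[of k] nv by simp
        then have "w (x + h k *\<^sub>R v) = 0" "w x = 0" using r(2) n by force+
        then show ?thesis using M by (simp add: q_def)
      qed
    qed
  qed
  moreover have "(LINT x|lborel. q k x) = 0" for k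
    unfolding q_def using wt[of "h k *\<^sub>R v"] ws by (simp add: wi)
  ultimately show ?thesis by (simp add: LIMSEQ_const_iff)
qed

lemma integration_by_parts:
  assumes \<upsilon>: "\<upsilon> \<in> test_functions U" and \<xi>: "\<xi> \<in> test_functions V"
  shows "(LINT x|lborel. \<upsilon> x * pderiv_at i \<xi> x) = - (LINT x|lborel. pderiv_at i \<upsilon> x * \<xi> x)"
proof -
  note sm = test_functionsD(1)[OF \<upsilon>] test_functionsD(1)[OF \<xi>]
  note K = test_functionsD(2)[OF \<upsilon>] test_functionsD(2)[OF \<xi>]
  have w: "(\<lambda>x. \<upsilon> x * \<xi> x) \<in> test_functions UNIV"
    using test_functionsD(5)[OF \<upsilon>] sm by (rule_tac test_functions_combine[of \<upsilon> _ \<upsilon>]) (auto intro: smooth_mult)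
  have "pderiv_at i (\<lambda>x. \<upsilon> x * \<xi> x) x = \<upsilon> x * pderiv_at i \<xi> x + pderiv_at i \<upsilon> x * \<xi> x" for x
    using arg_cong[OF grad_mult[OF sm, of x], of "\<lambda>v. v $ i"] by (simp add: grad_def mult.commute)
  moreover have "integrable lborel (\<lambda>x. \<upsilon> x * pderiv_at i \<xi> x)"
    by (rule integrable_compact_support[OF _ K(1)])
       (use closure_subset[of "{x. \<upsilon> x \<noteq> 0}"] in
         \<open>auto intro!: continuous_on_smooth smooth_mult smooth_pderiv sm\<close>)
  moreover have "integrable lborel (\<lambda>x. pderiv_at i \<upsilon> x * \<xi> x)"
    by (rule integrable_compact_support[OF _ K(2)])
       (use closure_subset[of "{x. \<xi> x \<noteq> 0}"] in
         \<open>auto intro!: continuous_on_smooth smooth_mult smooth_pderiv sm\<close>)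
  ultimately show ?thesis
    using integral_pderiv_eq_0[OF w, of i] by simp
qed

section \<open>Pairings of square integrable functions\<close>

lemma L2_product_integrable:
  fixes f h :: "'a \<Rightarrow> 'b::euclidean_space"
  assumes [measurable]: "f \<in> borel_measurable M" "h \<in> borel_measurable M"
    and fin: "sq_int M f < \<infinity>" "sq_int M h < \<infinity>"
  shows "integrable M (\<lambda>x. f x \<bullet> h x)"
proof (rule integrableI_bounded)
  have "(\<integral>\<^sup>+x. ennreal (norm (f x \<bullet> h x)) \<partial>M) \<le> (\<integral>\<^sup>+x. ennreal ((norm (f x))\<^sup>2) + ennreal ((norm (h x))\<^sup>2) \<partial>M)"
  proof (intro nn_integral_mono)
    fix x
    have "\<bar>f x \<bullet> h x\<bar> \<le> norm (f x) * norm (h x)" by (rule Cauchy_Schwarz_ineq2)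
    also have "\<dots> \<le> (norm (f x))\<^sup>2 + (norm (h x))\<^sup>2"
    proof -
      have "0 \<le> norm (f x) * norm (h x)" by simp
      then show ?thesis using sum_squares_bound[of "norm (f x)" "norm (h x)"] by linarith
    qed
    finally show "ennreal (norm (f x \<bullet> h x)) \<le> ennreal ((norm (f x))\<^sup>2) + ennreal ((norm (h x))\<^sup>2)"
      by (simp flip: ennreal_plus)
  qed
  also have "\<dots> = sq_int M f + sq_int M h"
    by (rule nn_integral_add) measurable
  also have "\<dots> < \<infinity>" using fin by simp
  finally show "(\<integral>\<^sup>+x. ennreal (norm (f x \<bullet> h x)) \<partial>M) < \<infinity>" .
qed measurable

text \<open>The geometric rate allows Young's inequality with weights \<open>2\<^sup>k\<close> and \<open>2\<^bsup>-k\<^esup>\<close>: both resulting terms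
  tend to zero.\<close>

lemma L2_tendsto_inner:
  fixes f h :: "'a \<Rightarrow> 'b::euclidean_space"
  assumes [measurable]: "\<And>k. F k \<in> borel_measurable M" "f \<in> borel_measurable M" "h \<in> borel_measurable M"
    and F: "\<And>k. sq_int M (\<lambda>x. F k x - f x) \<le> ennreal (C / 4 ^ k)"
    and fin: "\<And>k. sq_int M (F k) < \<infinity>" "sq_int M h < \<infinity>"
      "sq_int M f < \<infinity>"
    and C: "C \<ge> 0"
  shows "(\<lambda>k. LINT x|M. F k x \<bullet> h x) \<longlonglongrightarrow> (LINT x|M. f x \<bullet> h x)"
proof -
  have diff: "(LINT x|M. F k x \<bullet> h x) - (LINT x|M. f x \<bullet> h x) = (LINT x|M. (F k x - f x) \<bullet> h x)" for k
    by (subst Bochner_Integration.integral_diff[symmetric])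
       (auto simp: inner_diff_left intro!: L2_product_integrable fin)
  define H where "H = enn2real (sq_int M h)"
  have H: "sq_int M h = ennreal H" "H \<ge> 0"
    using fin(2) by (auto simp: H_def)
  have b: "norm (LINT x|M. (F k x - f x) \<bullet> h x) \<le> (1/2) ^ k * (C + H)" for k
  proof -
    have "integrable M (\<lambda>x. (F k x - f x) \<bullet> h x)"
      by (intro L2_product_integrable) (use order_le_less_trans[OF F[of k]] fin in auto)
    then have "ennreal (norm (LINT x|M. (F k x - f x) \<bullet> h x)) \<le> (\<integral>\<^sup>+x. ennreal (norm ((F k x - f x) \<bullet> h x)) \<partial>M)"
      by (rule integral_norm_bound_ennreal)
    also have "\<dots> \<le> (\<integral>\<^sup>+x. ennreal (2 ^ k) * ennreal ((norm (F k x - f x))\<^sup>2) + ennreal ((1/2) ^ k) * ennreal ((norm (h x))\<^sup>2) \<partial>M)"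
    proof (intro nn_integral_mono)
      fix x
      define a b q where "a = norm (F k x - f x)" and "b = norm (h x)" and "q = (2::real) ^ k"
      have q: "q > 0" by (simp add: q_def)
      have "\<bar>(F k x - f x) \<bullet> h x\<bar> \<le> a * b" unfolding a_def b_def by (rule Cauchy_Schwarz_ineq2)
      also have "\<dots> \<le> q * a\<^sup>2 + b\<^sup>2 / q"
      proof -
        have "0 \<le> (q * a - b)\<^sup>2 / q + a * b" using q by (simp add: a_def b_def)
        also have "\<dots> = q * a\<^sup>2 + b\<^sup>2 / q - a * b" using q by (simp add: power2_eq_square field_simps)
        finally show ?thesis by simp
      qed
      also have "\<dots> = 2 ^ k * a\<^sup>2 + (1/2) ^ k * b\<^sup>2" by (simp add: q_def power_divide)
      finally have "ennreal (norm ((F k x - f x) \<bullet> h x)) \<le> ennreal (2 ^ k * a\<^sup>2 + (1/2) ^ k * b\<^sup>2)"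
        by (intro ennreal_leI) simp
      also have "\<dots> = ennreal (2 ^ k * a\<^sup>2) + ennreal ((1/2) ^ k * b\<^sup>2)" by (rule ennreal_plus) auto
      finally show "ennreal (norm ((F k x - f x) \<bullet> h x))
          \<le> ennreal (2 ^ k) * ennreal ((norm (F k x - f x))\<^sup>2) + ennreal ((1/2) ^ k) * ennreal ((norm (h x))\<^sup>2)"
        by (simp add: a_def b_def ennreal_mult)
    qed
    also have "\<dots> = ennreal (2 ^ k) * sq_int M (\<lambda>x. F k x - f x) + ennreal ((1/2) ^ k) * ennreal H"
      by (simp add: nn_integral_add nn_integral_cmult H)
    also have "\<dots> \<le> ennreal (2 ^ k) * ennreal (C / 4 ^ k) + ennreal ((1/2) ^ k) * ennreal H"
      by (intro add_right_mono mult_left_mono F) auto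
    also have "\<dots> = ennreal ((1/2) ^ k * (C + H))"
    proof -
      have "(4::real) ^ k = 2 ^ k * 2 ^ k" by (simp flip: power_mult_distrib)
      then have "2 ^ k * (C / 4 ^ k) + (1/2) ^ k * H = (1/2) ^ k * (C + H)"
        by (simp add: field_simps)
      then show ?thesis using C H(2) by (simp flip: ennreal_mult ennreal_plus)
    qed
    finally show ?thesis using C H(2) by (subst (asm) ennreal_le_iff) auto
  qed
  have "(\<lambda>k. (1/2) ^ k * (C + H)) \<longlonglongrightarrow> 0"
    by (intro tendsto_mult_left_zero LIMSEQ_power_zero) auto
  then have "(\<lambda>k. LINT x|M. (F k x - f x) \<bullet> h x) \<longlonglongrightarrow> 0"
    by (rule Lim_null_comparison[rotated]) (use b in auto)
  then show ?thesis unfolding diff[symmetric] by (simp add: LIM_zero_iff)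
qed

section \<open>The projection onto gradients\<close>

definition dirichlet_form :: "(real^'n \<Rightarrow> real) \<Rightarrow> (real^'n \<Rightarrow> real) \<Rightarrow> real" where
  "dirichlet_form a b = (LINT x|lborel. grad a x \<bullet> grad b x)"

lemma integrable_dirichlet_form:
  assumes a: "a \<in> test_functions UNIV" and b: "b \<in> test_functions UNIV"
  shows "integrable lborel (\<lambda>x. grad a x \<bullet> grad b x)"
  by (rule integrable_compact_support[OF _ test_functionsD(2)[OF a]])
     (auto intro!: continuous_on_inner continuous_on_grad test_functionsD(1)[OF a] test_functionsD(1)[OF b]
       simp: grad_eq_0)

lemma dirichlet_form_commute: "dirichlet_form a b = dirichlet_form b a"
  by (simp add: dirichlet_form_def inner_commute)

lemma dirichlet_form_nonneg: "dirichlet_form a a \<ge> 0"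
  by (simp add: dirichlet_form_def)

lemma dirichlet_form_add:
  assumes "a \<in> test_functions UNIV" "b \<in> test_functions UNIV" "e \<in> test_functions UNIV"
  shows "dirichlet_form (\<lambda>x. a x + c * b x) e = dirichlet_form a e + c * dirichlet_form b e"
proof -
  have "grad (\<lambda>x. a x + c * b x) x = grad a x + c *\<^sub>R grad b x" for x
    using assms by (simp add: grad_add grad_cmult test_functionsD smooth_mult smooth_const)
  then show ?thesis
    using assms by (simp add: dirichlet_form_def inner_add_left integrable_dirichlet_form)
qed

lemma dirichlet_form_square:
  assumes "a \<in> test_functions UNIV" "b \<in> test_functions UNIV"
  shows "dirichlet_form (\<lambda>x. a x + c * b x) (\<lambda>x. a x + c * b x)
    = dirichlet_form a a + 2 * c * dirichlet_form a b + c\<^sup>2 * dirichlet_form b b"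
proof -
  note t = test_functions_add[OF assms, of c]
  have "dirichlet_form (\<lambda>x. a x + c * b x) (\<lambda>x. a x + c * b x)
    = dirichlet_form (\<lambda>x. a x + c * b x) a + c * dirichlet_form (\<lambda>x. a x + c * b x) b"
    using dirichlet_form_add[OF assms t] by (simp add: dirichlet_form_commute)
  also have "\<dots> = dirichlet_form a a + 2 * c * dirichlet_form a b + c\<^sup>2 * dirichlet_form b b"
    using assms by (simp add: dirichlet_form_add dirichlet_form_commute[of b a] algebra_simps power2_eq_square)
  finally show ?thesis .
qed

lemma nn_integral_dirichlet_form:
  assumes "a \<in> test_functions UNIV"
  shows "sq_int lborel (grad a) = ennreal (dirichlet_form a a)"
  using nn_integral_eq_integral[OF integrable_dirichlet_form[OF assms assms]]
  by (simp add: dirichlet_form_def power2_norm_eq_inner)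

lemma test_functions_diff:
  "\<phi> \<in> test_functions U \<Longrightarrow> \<psi> \<in> test_functions U \<Longrightarrow> (\<lambda>x. \<phi> x - \<psi> x) \<in> test_functions U"
  using test_functions_add[of \<phi> U \<psi> "-1"] by simp

text \<open>The solution minimises the distance of its gradient to \<open>\<nabla>\<phi>\<close>. For test functions \<open>w k\<close> within
  \<open>4\<^bsup>-k\<^esup>\<close> of the infimum, the parallelogram identity with the midpoint as competitor shows that
  their gradients form a Cauchy sequence, and the competitors \<open>w k \<plusminus> 2\<^bsup>-k\<^esup> \<xi>\<close> show that the Euler
  equation holds up to \<open>2\<^bsup>-k\<^esup>\<close>.\<close>

lemma minimizing_sequence:
  fixes \<phi> :: "real^'n \<Rightarrow> real"
  assumes \<phi>: "\<phi> \<in> test_functions UNIV"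
  obtains w where "\<And>k. w k \<in> test_functions U"
    and "\<And>j k. k \<le> j \<Longrightarrow> dirichlet_form (\<lambda>x. w j x - w k x) (\<lambda>x. w j x - w k x) \<le> 4 / 4 ^ k"
    and "\<And>k \<xi>. \<xi> \<in> test_functions U \<Longrightarrow>
      \<bar>dirichlet_form (\<lambda>x. w k x - \<phi> x) \<xi>\<bar> \<le> (1/2) ^ k * (1 + dirichlet_form \<xi> \<xi>)"
proof -
  define D where "D a = dirichlet_form (\<lambda>x. a x - \<phi> x) (\<lambda>x. a x - \<phi> x)" for a
  define I where "I = Inf (D ` test_functions U)"
  have U: "a \<in> test_functions U \<Longrightarrow> a \<in> test_functions UNIV" for a by (rule test_functionsD)
  have bdd: "bdd_below (D ` test_functions U)"
    by (rule bdd_belowI[of _ 0]) (auto simp: D_def dirichlet_form_nonneg)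
  have I: "I \<le> D a" if "a \<in> test_functions U" for a
    unfolding I_def using that bdd by (intro cInf_lower) auto
  have "\<exists>a\<in>test_functions U. D a < I + 1 / 4 ^ k" for k :: nat
  proof -
    have "Inf (D ` test_functions U) < I + 1 / 4 ^ k" by (simp add: I_def)
    then show ?thesis
      using zero_test_function[of U] bdd by (subst (asm) cInf_less_iff) auto
  qed
  then obtain w where w: "\<And>k::nat. w k \<in> test_functions U" "\<And>k. D (w k) < I + 1 / 4 ^ k"
    by metis
  note d = test_functions_diff[OF U[OF w(1)] \<phi>]
  show thesis
  proof (rule that[of w])
    show "w k \<in> test_functions U" for k by (rule w)
    show "dirichlet_form (\<lambda>x. w j x - w k x) (\<lambda>x. w j x - w k x) \<le> 4 / 4 ^ k" if "k \<le> j" for j k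
    proof -
      define \<delta> where "\<delta> x = w j x - w k x" for x
      have \<delta>: "\<delta> \<in> test_functions U" unfolding \<delta>_def by (intro test_functions_diff w)
      have 1: "(\<lambda>x. w k x - \<phi> x) = (\<lambda>x. (w j x - \<phi> x) + (-1) * \<delta> x)" by (auto simp: \<delta>_def)
      have 2: "(\<lambda>x. (w j x + (-1/2) * \<delta> x) - \<phi> x) = (\<lambda>x. (w j x - \<phi> x) + (-1/2) * \<delta> x)" by auto
      have "I \<le> D (\<lambda>x. w j x + (-1/2) * \<delta> x)"
        by (intro I test_functions_add w \<delta>)
      moreover have "D (\<lambda>x. w j x + (-1/2) * \<delta> x) = D (w j) - dirichlet_form (\<lambda>x. w j x - \<phi> x) \<delta> + dirichlet_form \<delta> \<delta> / 4"
        unfolding D_def 2 dirichlet_form_square[OF d U[OF \<delta>]] by (simp add: power2_eq_square)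
      moreover have "D (w k) = D (w j) - 2 * dirichlet_form (\<lambda>x. w j x - \<phi> x) \<delta> + dirichlet_form \<delta> \<delta>"
        unfolding D_def 1 dirichlet_form_square[OF d U[OF \<delta>]] by simp
      moreover have "(1::real) / 4 ^ j \<le> 1 / 4 ^ k" using that by (intro divide_left_mono power_increasing) auto
      moreover have "(\<lambda>x. w j x - w k x) = \<delta>" "(4::real) / 4 ^ k = 4 * (1 / 4 ^ k)"
        by (auto simp: \<delta>_def)
      ultimately show ?thesis using w(2)[of j] w(2)[of k] by (simp only:)
    qed
    show "\<bar>dirichlet_form (\<lambda>x. w k x - \<phi> x) \<xi>\<bar> \<le> (1/2) ^ k * (1 + dirichlet_form \<xi> \<xi>)"
      if \<xi>: "\<xi> \<in> test_functions U" for k \<xi>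
    proof -
      define a q where "a = dirichlet_form (\<lambda>x. w k x - \<phi> x) \<xi>" and "q = dirichlet_form \<xi> \<xi>"
      define h where "h = (1/2 :: real) ^ k"
      have h: "h > 0" "1 / 4 ^ k = h * h" by (simp_all add: h_def power_divide flip: power_mult_distrib)
      have var: "- (h * h) \<le> 2 * t * a + t\<^sup>2 * q" for t
      proof -
        have e: "(\<lambda>x. (w k x + t * \<xi> x) - \<phi> x) = (\<lambda>x. (w k x - \<phi> x) + t * \<xi> x)" by auto
        have "I \<le> D (\<lambda>x. w k x + t * \<xi> x)" by (intro I test_functions_add w \<xi>)
        also have "\<dots> = D (w k) + 2 * t * a + t\<^sup>2 * q"
          unfolding D_def e dirichlet_form_square[OF d U[OF \<xi>]] a_def q_def by simp
        finally show ?thesis using w(2)[of k] h(2) by simp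
      qed
      have "h * (2 * \<bar>a\<bar>) \<le> h * (h * (1 + q))"
        using var[of h] var[of "- h"] by (auto simp: abs_if power2_eq_square algebra_simps)
      then have "2 * \<bar>a\<bar> \<le> h * (1 + q)" using h by simp
      then show ?thesis by (simp add: a_def q_def h_def)
    qed
  qed
qed

text \<open>The limit \<open>(u, g)\<close> of a minimising sequence \<open>w\<close>, with \<open>u\<close> and \<open>g\<close> extended by zero. The last
  assumption says that the energies of \<open>w k - \<phi>\<close> tend to \<open>\<parallel>\<nabla>\<phi> - g\<parallel>\<^sup>2\<close>, in the form in which the
  projection property \<open>\<parallel>g\<parallel>\<^sup>2 = \<integral> g \<bullet> \<nabla>\<phi>\<close> has been used. It allows to work with the smooth functions
  \<open>w k - \<phi>\<close> in place of \<open>u - \<phi>\<close>.\<close>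

locale gradient_projection =
  fixes U :: "(real^'n) set" and \<phi> :: "real^'n \<Rightarrow> real" and w :: "nat \<Rightarrow> real^'n \<Rightarrow> real"
    and u :: "real^'n \<Rightarrow> real" and g :: "real^'n \<Rightarrow> real^'n" and C :: real
  assumes \<phi>: "\<phi> \<in> test_functions UNIV" and w: "w k \<in> test_functions U"
    and um: "u \<in> borel_measurable borel" and gm: "g \<in> borel_measurable borel" and C: "0 \<le> C"
    and uconv: "sq_int lborel (\<lambda>x. w k x - u x) \<le> ennreal (C / 4 ^ k)"
    and gconv: "sq_int lborel (\<lambda>x. grad (w k) x - g x) \<le> ennreal (C / 4 ^ k)"
    and finu: "sq_int lborel u < \<infinity>"
    and fing: "sq_int lborel g < \<infinity>"
    and zero: "x \<notin> U \<Longrightarrow> u x = 0" "x \<notin> U \<Longrightarrow> g x = 0"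
    and orth: "\<xi> \<in> test_functions U \<Longrightarrow> (LINT x|lborel. g x \<bullet> grad \<xi> x) = dirichlet_form \<phi> \<xi>"
    and lim: "(\<lambda>k. dirichlet_form (\<lambda>x. w k x - \<phi> x) (\<lambda>x. w k x - \<phi> x))
      \<longlonglongrightarrow> dirichlet_form \<phi> \<phi> - (LINT x|lborel. g x \<bullet> grad \<phi> x)"

lemma gradient_projection_exists:
  fixes \<phi> :: "real^'n \<Rightarrow> real"
  assumes \<phi>: "\<phi> \<in> test_functions UNIV" and "bounded U"
  obtains w u g C where "gradient_projection U \<phi> w u g C"
proof -
  obtain w where w: "\<And>k. w k \<in> test_functions U"
    and cau: "\<And>j k. k \<le> j \<Longrightarrow> dirichlet_form (\<lambda>x. w j x - w k x) (\<lambda>x. w j x - w k x) \<le> 4 / 4 ^ k"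
    and orth: "\<And>k \<xi>. \<xi> \<in> test_functions U \<Longrightarrow>
      \<bar>dirichlet_form (\<lambda>x. w k x - \<phi> x) \<xi>\<bar> \<le> (1/2) ^ k * (1 + dirichlet_form \<xi> \<xi>)"
    using minimizing_sequence[OF \<phi>] by blast
  obtain r where r: "r > 0" "\<And>x. x \<in> U \<Longrightarrow> norm x < r"
    using \<open>bounded U\<close> by (metis bounded_pos_less)
  have U: "a \<in> test_functions U \<Longrightarrow> a \<in> test_functions UNIV" for a by (rule test_functionsD)
  note wU = U[OF w]
  have sm: "smooth (w k)" for k using test_functionsD(1)[OF w] .
  have wz: "w k x = 0" if "norm x \<ge> r" for k x
    using that r(2)[of x] test_functionsD(3)[OF w] by fastforce
  define C where "C = 4 * (1 + (2 * r)\<^sup>2)"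
  have C: "C \<ge> 0" "4 \<le> C" "(2 * r)\<^sup>2 * 4 \<le> C" by (auto simp: C_def)
  define u where "u x = lim (\<lambda>k. w k x)" for x
  define g where "g x = lim (\<lambda>k. grad (w k) x)" for x
  have mw [measurable]: "w k \<in> borel_measurable lborel" "grad (w k) \<in> borel_measurable lborel" for k
    using sm[of k] by measurable
  have grad_cau: "sq_int lborel (\<lambda>x. grad (w j) x - grad (w k) x) \<le> ennreal (4 / 4 ^ k)" if "k \<le> j" for j k
  proof -
    have "sq_int lborel (\<lambda>x. grad (w j) x - grad (w k) x)
        = ennreal (dirichlet_form (\<lambda>x. w j x - w k x) (\<lambda>x. w j x - w k x))"
      using nn_integral_dirichlet_form[OF test_functions_diff[OF wU wU], of j k]
      by (simp add: grad_diff[OF sm sm])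
    also have "\<dots> \<le> ennreal (4 / 4 ^ k)" using cau[OF that] by (rule ennreal_leI)
    finally show ?thesis .
  qed
  have gC: "sq_int lborel (\<lambda>x. grad (w j) x - grad (w k) x) \<le> ennreal (C / 4 ^ k)" if "k \<le> j" for j k
    using C by (intro order_trans[OF grad_cau[OF that]] ennreal_leI divide_right_mono) auto
  have uC: "sq_int lborel (\<lambda>x. w j x - w k x) \<le> ennreal (C / 4 ^ k)" if "k \<le> j" for j k
  proof -
    have "sq_int lborel (\<lambda>x. w j x - w k x)
        \<le> ennreal ((2 * r)\<^sup>2) * sq_int lborel (\<lambda>x. grad (\<lambda>x. w j x - w k x) x)"
      using poincare_inequality[of "\<lambda>x. w j x - w k x" r] sm r(1) wz by (simp add: smooth_diff)
    also have "\<dots> \<le> ennreal ((2 * r)\<^sup>2) * ennreal (4 / 4 ^ k)"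
      using grad_cau[OF that] by (intro mult_left_mono) (simp_all add: grad_diff[OF sm sm])
    also have "\<dots> = ennreal ((2 * r)\<^sup>2 * 4 / 4 ^ k)" by (simp flip: ennreal_mult)
    also have "\<dots> \<le> ennreal (C / 4 ^ k)"
      using C by (intro ennreal_leI divide_right_mono) auto
    finally show ?thesis .
  qed
  have um [measurable]: "u \<in> borel_measurable lborel" unfolding u_def
    by (rule Riesz_Fischer_fast(1)[OF mw(1) C(1) uC])
  have gm [measurable]: "g \<in> borel_measurable lborel" unfolding g_def
    by (rule Riesz_Fischer_fast(1)[OF mw(2) C(1) gC])
  have uconv: "sq_int lborel (\<lambda>x. w k x - u x) \<le> ennreal (C / 4 ^ k)" for k
    unfolding u_def by (rule Riesz_Fischer_fast(2)[OF mw(1) C(1) uC])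
  have gconv: "sq_int lborel (\<lambda>x. grad (w k) x - g x) \<le> ennreal (C / 4 ^ k)" for k
    unfolding g_def by (rule Riesz_Fischer_fast(2)[OF mw(2) C(1) gC])
  have fing: "sq_int lborel (grad \<xi>) < \<infinity>" if "\<xi> \<in> test_functions UNIV" for \<xi> :: "real^'n \<Rightarrow> real"
    by (simp add: nn_integral_dirichlet_form[OF that])
  have fin_limit: "sq_int lborel f < \<infinity>"
    if [measurable]: "F \<in> borel_measurable lborel" "f \<in> borel_measurable lborel"
      and F: "sq_int lborel F < \<infinity>" "sq_int lborel (\<lambda>x. F x - f x) \<le> ennreal c"
    for F f :: "real^'n \<Rightarrow> 'c::euclidean_space" and c
  proof -
    have "sq_int lborel f
        \<le> (\<integral>\<^sup>+x. 2 * ennreal ((norm (F x))\<^sup>2) + 2 * ennreal ((norm (F x - f x))\<^sup>2) \<partial>lborel)"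
    proof (intro nn_integral_mono)
      fix x
      have "norm (f x) \<le> norm (F x) + norm (F x - f x)"
        using norm_triangle_ineq4[of "F x" "F x - f x"] by simp
      then have "(norm (f x))\<^sup>2 \<le> (norm (F x) + norm (F x - f x))\<^sup>2" by (intro power_mono) auto
      also have "\<dots> \<le> 2 * (norm (F x))\<^sup>2 + 2 * (norm (F x - f x))\<^sup>2"
        using sum_squares_bound[of "norm (F x)" "norm (F x - f x)"] by (simp add: power2_sum)
      finally have "ennreal ((norm (f x))\<^sup>2) \<le> ennreal (2 * (norm (F x))\<^sup>2 + 2 * (norm (F x - f x))\<^sup>2)"
        by (rule ennreal_leI)
      also have "\<dots> = 2 * ennreal ((norm (F x))\<^sup>2) + 2 * ennreal ((norm (F x - f x))\<^sup>2)"
        by (simp add: ennreal_mult)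
      finally show "ennreal ((norm (f x))\<^sup>2) \<le> 2 * ennreal ((norm (F x))\<^sup>2) + 2 * ennreal ((norm (F x - f x))\<^sup>2)" .
    qed
    also have "\<dots> = 2 * sq_int lborel F + 2 * sq_int lborel (\<lambda>x. F x - f x)"
      by (simp add: nn_integral_add nn_integral_cmult)
    also have "\<dots> < \<infinity>" using F by (simp add: ennreal_mult_less_top order_le_less_trans[OF F(2)])
    finally show ?thesis .
  qed
  have finw: "sq_int lborel (w k) < \<infinity>" for k
  proof -
    have "(\<integral>\<^sup>+x. ennreal ((w k x)\<^sup>2) \<partial>lborel) \<le> ennreal ((2 * r)\<^sup>2) * sq_int lborel (grad (w k))"
      using poincare_inequality[OF sm wz r(1)] by simp
    also have "\<dots> < \<infinity>" using fing[OF wU] by (simp add: ennreal_mult_less_top)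
    finally show ?thesis by simp
  qed
  have finu: "sq_int lborel u < \<infinity>"
    by (rule fin_limit[OF mw(1) um finw uconv])
  have fingg: "sq_int lborel g < \<infinity>"
    by (rule fin_limit[OF mw(2) gm fing[OF wU] gconv])
  have lim: "(\<lambda>k. dirichlet_form (w k) \<xi>) \<longlonglongrightarrow> (LINT x|lborel. g x \<bullet> grad \<xi> x)" if "\<xi> \<in> test_functions UNIV" for \<xi>
  proof -
    have [measurable]: "grad \<xi> \<in> borel_measurable lborel"
      using test_functionsD(1)[OF that] by measurable
    show ?thesis
      unfolding dirichlet_form_def
      by (rule L2_tendsto_inner[OF mw(2) gm _ gconv fing[OF wU] fing[OF that] fingg C(1)]) fact
  qed
  have diff: "dirichlet_form (\<lambda>x. w k x - \<phi> x) \<xi> = dirichlet_form (w k) \<xi> - dirichlet_form \<phi> \<xi>"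
    if "\<xi> \<in> test_functions UNIV" for \<xi> k
    using dirichlet_form_add[OF wU \<phi> that, of k "-1"] by simp
  have half: "(\<lambda>k. (1/2 :: real) ^ k * c) \<longlonglongrightarrow> 0" for c
    by (intro tendsto_mult_left_zero LIMSEQ_power_zero) auto
  have "gradient_projection U \<phi> w u g C"
  proof
    fix \<xi> assume \<xi>: "\<xi> \<in> test_functions U"
    have "(\<lambda>k. dirichlet_form (\<lambda>x. w k x - \<phi> x) \<xi>) \<longlonglongrightarrow> 0"
      by (rule Lim_null_comparison[OF _ half[of "1 + dirichlet_form \<xi> \<xi>"]]) (use orth[OF \<xi>] in auto)
    then have "(\<lambda>k. dirichlet_form (w k) \<xi>) \<longlonglongrightarrow> dirichlet_form \<phi> \<xi>"
      unfolding diff[OF U[OF \<xi>]] by (simp add: LIM_zero_iff)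
    with lim[OF U[OF \<xi>]] show "(LINT x|lborel. g x \<bullet> grad \<xi> x) = dirichlet_form \<phi> \<xi>"
      using LIMSEQ_unique by blast
  next
    let ?a = "\<lambda>k x. w k x - \<phi> x"
    note a = test_functions_diff[OF wU \<phi>]
    obtain B where B: "\<And>k. dirichlet_form (w k) (w k) \<le> B"
    proof -
      have "dirichlet_form (w k) (w k) \<le> 2 * dirichlet_form (w 0) (w 0) + 8" for k
      proof -
        let ?d = "\<lambda>x. w k x - w 0 x"
        note d = test_functions_diff[OF wU wU, of k 0]
        have "0 \<le> dirichlet_form (\<lambda>x. w 0 x + (-1) * ?d x) (\<lambda>x. w 0 x + (-1) * ?d x)"
          by (rule dirichlet_form_nonneg)
        also have "\<dots> = dirichlet_form (w 0) (w 0) - 2 * dirichlet_form (w 0) ?d + dirichlet_form ?d ?d"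
          using dirichlet_form_square[OF wU d, of 0 "-1"] by simp
        finally have "2 * dirichlet_form (w 0) ?d \<le> dirichlet_form (w 0) (w 0) + dirichlet_form ?d ?d" by simp
        moreover have "dirichlet_form (w k) (w k) = dirichlet_form (w 0) (w 0) + 2 * dirichlet_form (w 0) ?d + dirichlet_form ?d ?d"
          using dirichlet_form_square[OF wU d, of 0 1] by simp
        moreover have "dirichlet_form ?d ?d \<le> 4" using cau[of 0 k] by simp
        ultimately show ?thesis by simp
      qed
      then show thesis by (rule that)
    qed
    \<comment> \<open>The energy of \<open>w k - \<phi>\<close> is the difference of its pairings with \<open>w k\<close> and with \<open>\<phi>\<close>. The first
      one tends to zero by the Euler equation, because the energies of the \<open>w k\<close> are bounded.\<close>
    have "(\<lambda>k. dirichlet_form (?a k) (w k)) \<longlonglongrightarrow> 0"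
    proof (rule Lim_null_comparison[OF _ half[of "1 + B"]])
      show "\<forall>\<^sub>F k in sequentially. norm (dirichlet_form (?a k) (w k)) \<le> (1/2) ^ k * (1 + B)"
      proof (intro always_eventually allI)
        fix k
        have "norm (dirichlet_form (?a k) (w k)) \<le> (1/2) ^ k * (1 + dirichlet_form (w k) (w k))"
          using orth[OF w, of k k] by simp
        also have "\<dots> \<le> (1/2) ^ k * (1 + B)" using B by (intro mult_left_mono) auto
        finally show "norm (dirichlet_form (?a k) (w k)) \<le> (1/2) ^ k * (1 + B)" .
      qed
    qed
    moreover have "(\<lambda>k. dirichlet_form (?a k) \<phi>) \<longlonglongrightarrow> (LINT x|lborel. g x \<bullet> grad \<phi> x) - dirichlet_form \<phi> \<phi>"
      unfolding diff[OF \<phi>] by (intro tendsto_intros lim \<phi>)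
    ultimately have "(\<lambda>k. dirichlet_form (?a k) (w k) - dirichlet_form (?a k) \<phi>)
        \<longlonglongrightarrow> 0 - ((LINT x|lborel. g x \<bullet> grad \<phi> x) - dirichlet_form \<phi> \<phi>)"
      by (rule tendsto_diff)
    moreover have "dirichlet_form (?a k) (w k) - dirichlet_form (?a k) \<phi> = dirichlet_form (?a k) (?a k)" for k
      using diff[OF a, of k k] by (simp add: dirichlet_form_commute[of "w k" "?a k"] dirichlet_form_commute[of \<phi> "?a k"])
    ultimately show "(\<lambda>k. dirichlet_form (?a k) (?a k)) \<longlonglongrightarrow> dirichlet_form \<phi> \<phi> - (LINT x|lborel. g x \<bullet> grad \<phi> x)"
      by simp
  next
    fix x assume "x \<notin> U"
    then have "w k x = 0" "grad (w k) x = 0" for k using test_functionsD(3,4)[OF w] by blast+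
    then show "u x = 0" "g x = 0" by (simp_all add: u_def g_def)
  qed (use \<phi> w uconv gconv finu fingg C(1) um gm in simp_all)
  then show thesis by (rule that)
qed

section \<open>The projection as a weak solution\<close>

text \<open>All estimates are carried out for Borel functions and the Borel measure on the whole space, with
  functions extended by zero. The following lemmas translate to the Lebesgue measure on \<open>U\<close>.\<close>

lemma nn_integral_lebesgue_on:
  fixes f :: "real^'n \<Rightarrow> ennreal"
  assumes [measurable]: "U \<in> sets borel" "f \<in> borel_measurable borel"
  shows "(\<integral>\<^sup>+x. f x \<partial>lebesgue_on U) = (\<integral>\<^sup>+x. f x * indicator U x \<partial>lborel)"
proof -
  have "(\<integral>\<^sup>+x. f x \<partial>lebesgue_on U) = (\<integral>\<^sup>+x. f x * indicator U x \<partial>lebesgue)"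
    by (rule nn_integral_restrict_space) (use assms in auto)
  also have "\<dots> = (\<integral>\<^sup>+x. f x * indicator U x \<partial>lborel)"
    by (rule nn_integral_completion) measurable
  finally show ?thesis .
qed

lemma integral_lebesgue_on:
  fixes f :: "real^'n \<Rightarrow> real"
  assumes [measurable]: "U \<in> sets borel" "f \<in> borel_measurable borel" and z: "\<And>x. x \<notin> U \<Longrightarrow> f x = 0"
  shows "(LINT x|lebesgue_on U. f x) = (LINT x|lborel. f x)"
proof -
  have "(LINT x|lebesgue_on U. f x) = (LINT x|lebesgue. indicator U x *\<^sub>R f x)"
    by (rule integral_restrict_space) (use assms in auto)
  also have "(\<lambda>x. indicator U x *\<^sub>R f x) = f" using z by (auto simp: indicator_def fun_eq_iff)
  also have "(LINT x|lebesgue. f x) = (LINT x|lborel. f x)"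
    by (rule integral_completion) measurable
  finally show ?thesis .
qed

lemma borel_measurable_lebesgue_on:
  fixes f :: "real^'n \<Rightarrow> 'b::real_normed_vector"
  assumes "f \<in> borel_measurable borel"
  shows "f \<in> borel_measurable (lebesgue_on U)"
  using assms by (intro measurable_restrict_space1 measurable_completion) simp

lemma Lp_norm_le:
  fixes f :: "real^'n \<Rightarrow> 'b::real_normed_vector"
  assumes U: "U \<in> sets borel" and [measurable]: "f \<in> borel_measurable borel" and c: "0 \<le> c" and p: "p > 0"
    and b: "(\<integral>\<^sup>+x. ennreal (norm (f x) powr p) * indicator U x \<partial>lborel) \<le> ennreal c"
  shows "Lp_norm p U f \<le> ennreal (c powr (1 / p))"
proof -
  let ?I = "\<integral>\<^sup>+x. ennreal (norm (f x) powr p) \<partial>lebesgue_on U"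
  have I: "?I \<le> ennreal c" using b by (simp add: nn_integral_lebesgue_on[OF U])
  then have "?I \<noteq> \<infinity>" "enn2real ?I \<le> c" using c by (auto simp: enn2real_leI top_unique)
  then show ?thesis using p by (auto simp: Lp_norm_def Let_def intro!: ennreal_leI powr_mono2)
qed

lemma integral_le_of_Lp_norm_le:
  fixes f :: "real^'n \<Rightarrow> 'b::real_normed_vector"
  assumes U: "U \<in> sets borel" and [measurable]: "f \<in> borel_measurable borel" and b: "0 \<le> b" and p: "p > 0"
    and n: "Lp_norm p U f \<le> ennreal b"
  shows "(\<integral>\<^sup>+x. ennreal (norm (f x) powr p) * indicator U x \<partial>lborel) \<le> ennreal (b powr p)"
proof -
  let ?I = "\<integral>\<^sup>+x. ennreal (norm (f x) powr p) \<partial>lebesgue_on U"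
  have fin: "?I \<noteq> \<infinity>" using n by (auto simp: Lp_norm_def Let_def top_unique split: if_splits)
  then have "enn2real ?I powr (1 / p) \<le> b"
    using n b by (simp add: Lp_norm_def Let_def ennreal_le_iff)
  then have "(enn2real ?I powr (1 / p)) powr p \<le> b powr p"
    using p by (intro powr_mono2) auto
  then have "enn2real ?I \<le> b powr p" using p by (simp add: powr_powr)
  then have "?I \<le> ennreal (b powr p)"
    using fin by (metis ennreal_enn2real_if ennreal_leI infinity_ennreal_def)
  then show ?thesis by (simp add: nn_integral_lebesgue_on[OF U])
qed

lemma Lp_norm_2_le:
  fixes f :: "real^'n \<Rightarrow> 'b::real_normed_vector"
  assumes U: "U \<in> sets borel" and [measurable]: "f \<in> borel_measurable borel" and c: "0 \<le> c"
    and b: "sq_int lborel f \<le> ennreal c"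
  shows "Lp_norm 2 U f \<le> ennreal (sqrt c)"
proof -
  have "(\<integral>\<^sup>+x. ennreal (norm (f x) powr 2) * indicator U x \<partial>lborel) \<le> sq_int lborel f"
    by (intro nn_integral_mono) (auto simp: indicator_def)
  from Lp_norm_le[OF U assms(2) c _ order_trans[OF this b]] show ?thesis
    using c by (simp add: powr_half_sqrt)
qed

lemma in_Lp_2:
  fixes f :: "real^'n \<Rightarrow> 'b::real_normed_vector"
  assumes U: "U \<in> sets borel" and f: "f \<in> borel_measurable borel"
    and b: "sq_int lborel f < \<infinity>"
  shows "f \<in> Lp 2 U"
proof -
  obtain c where c: "0 \<le> c" "sq_int lborel f = ennreal c"
    using b by (metis ennreal_cases infinity_ennreal_def less_irrefl)
  have "Lp_norm 2 U f < \<infinity>"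
    using Lp_norm_2_le[OF U f c(1)] c(2) by (simp add: order_le_less_trans[OF _ ennreal_less_top])
  then show ?thesis using f by (simp add: Lp_def borel_measurable_lebesgue_on)
qed

lemma (in gradient_projection) weak_solution:
  assumes U [measurable]: "U \<in> sets borel"
  shows "weak_solution U (\<lambda>x. 0) (\<lambda>x. - grad \<phi> x) u g"
proof -
  have sm: "smooth \<phi>" "smooth (w k)" for k using test_functionsD(1) \<phi> w by blast+
  note um [measurable] and gm [measurable]
  have mw [measurable]: "w k \<in> borel_measurable borel" "grad (w k) \<in> borel_measurable borel"
    "pderiv_at i (w k) \<in> borel_measurable borel" "grad \<phi> \<in> borel_measurable borel" for k i
    using sm smooth_pderiv[OF sm(2)] by measurable
  have wg: "weak_gradient U u g"
    unfolding weak_gradient_def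
  proof (intro ballI allI)
    fix \<xi> :: "real^'n \<Rightarrow> real" and i assume \<xi>: "\<xi> \<in> test_functions U"
    note sx = test_functionsD(1)[OF \<xi>]
    have [measurable]: "\<xi> \<in> borel_measurable borel" "pderiv_at i \<xi> \<in> borel_measurable borel"
      using sx smooth_pderiv[OF sx] by measurable
    have [measurable]: "(\<lambda>x. g x $ i) \<in> borel_measurable borel"
      using borel_measurable_inner[OF gm borel_measurable_const[of "axis i 1"]] by (simp add: inner_axis)
    have fin_cont: "sq_int lborel f < \<infinity>"
      if "smooth f" "\<And>x. x \<notin> closure {x. \<psi> x \<noteq> 0} \<Longrightarrow> f x = 0" "\<psi> \<in> test_functions U" for f \<psi> :: "real^'n \<Rightarrow> real"
    proof -
      have "integrable lborel (\<lambda>x. (f x)\<^sup>2)"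
        by (rule integrable_compact_support[OF _ test_functionsD(2)[OF that(3)]])
           (use that(2) continuous_on_power[OF continuous_on_smooth[OF that(1)]] in auto)
      from nn_integral_eq_integral[OF this] show ?thesis by simp
    qed
    have cl: "x \<notin> closure {x. \<psi> x \<noteq> 0} \<Longrightarrow> \<psi> x = 0" for x and \<psi> :: "real^'n \<Rightarrow> real"
      using closure_subset[of "{x. \<psi> x \<noteq> 0}"] by auto
    have pd: "x \<notin> closure {x. \<psi> x \<noteq> 0} \<Longrightarrow> pderiv_at i \<psi> x = 0" for x and \<psi> :: "real^'n \<Rightarrow> real"
      using grad_eq_0[of x \<psi>] by (metis grad_def vec_lambda_beta zero_index)
    have l1: "(\<lambda>k. LINT x|lborel. w k x \<bullet> pderiv_at i \<xi> x) \<longlonglongrightarrow> (LINT x|lborel. u x \<bullet> pderiv_at i \<xi> x)"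
    proof (rule L2_tendsto_inner[where C = C])
      show "sq_int lborel (w k) < \<infinity>" for k
        by (rule fin_cont[OF sm(2) cl[where \<psi> = "w k"] w])
      show "sq_int lborel (\<lambda>x. pderiv_at i \<xi> x) < \<infinity>"
        by (rule fin_cont[OF smooth_pderiv[OF sx] pd[where \<psi> = \<xi>] \<xi>])
    qed (use uconv finu C in auto)
    have l2: "(\<lambda>k. LINT x|lborel. pderiv_at i (w k) x \<bullet> \<xi> x) \<longlonglongrightarrow> (LINT x|lborel. g x $ i \<bullet> \<xi> x)"
    proof (rule L2_tendsto_inner[where C = C])
      show "sq_int lborel (\<lambda>x. pderiv_at i (w k) x - g x $ i) \<le> ennreal (C / 4 ^ k)" for k
      proof (rule order_trans[OF _ gconv], intro nn_integral_mono ennreal_leI power_mono)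
        fix x
        show "norm (pderiv_at i (w k) x - g x $ i) \<le> norm (grad (w k) x - g x)"
          using component_le_norm_cart[of "grad (w k) x - g x" i] by (simp add: grad_def)
      qed auto
      show "sq_int lborel (\<lambda>x. g x $ i) < \<infinity>"
        by (rule order_le_less_trans[OF _ fing], intro nn_integral_mono ennreal_leI power_mono)
           (auto simp: component_le_norm_cart)
      show "sq_int lborel (\<lambda>x. pderiv_at i (w k) x) < \<infinity>" for k
        by (rule fin_cont[OF smooth_pderiv[OF sm(2)] pd[where \<psi> = "w k"] w])
      show "sq_int lborel \<xi> < \<infinity>"
        by (rule fin_cont[OF sx cl[where \<psi> = \<xi>] \<xi>])
    qed (use C in auto)
    have "(\<lambda>k. LINT x|lborel. w k x \<bullet> pderiv_at i \<xi> x) \<longlonglongrightarrow> - (LINT x|lborel. g x $ i \<bullet> \<xi> x)"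
      using tendsto_minus[OF l2] integration_by_parts[OF w \<xi>] by simp
    with l1 have "(LINT x|lborel. u x * pderiv_at i \<xi> x) = - (LINT x|lborel. g x $ i * \<xi> x)"
      using LIMSEQ_unique by fastforce
    then show "(LINT x|lebesgue_on U. u x * pderiv_at i \<xi> x) = - (LINT x|lebesgue_on U. g x $ i * \<xi> x)"
      using zero by (simp add: integral_lebesgue_on[OF U])
  qed
  have H1: "H1 U u g"
    unfolding H1_def using wg in_Lp_2[OF U um finu] in_Lp_2[OF U gm fing] by simp
  have "(\<lambda>k. Lp_norm 2 U (\<lambda>x. u x - w k x) + Lp_norm 2 U (\<lambda>x. g x - grad (w k) x)) \<longlonglongrightarrow> 0"
  proof (rule tendsto_sandwich[OF _ _ tendsto_const])
    have half: "Lp_norm 2 U f \<le> ennreal (sqrt C * (1/2) ^ k)"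
      if "f \<in> borel_measurable borel" "sq_int lborel f \<le> ennreal (C / 4 ^ k)"
      for f :: "real^'n \<Rightarrow> 'c::real_normed_vector" and k
    proof -
      have "sqrt (4 ^ k) = 2 ^ k" by (simp add: real_sqrt_power)
      then have "sqrt (C / 4 ^ k) = sqrt C * (1/2) ^ k"
        by (simp add: real_sqrt_divide power_divide)
      then show ?thesis using Lp_norm_2_le[OF U that(1) _ that(2)] C by simp
    qed
    show "\<forall>\<^sub>F k in sequentially. Lp_norm 2 U (\<lambda>x. u x - w k x) + Lp_norm 2 U (\<lambda>x. g x - grad (w k) x)
        \<le> ennreal (sqrt C * (1/2) ^ k) + ennreal (sqrt C * (1/2) ^ k)"
      using uconv gconv by (intro always_eventually allI add_mono half) (auto simp: norm_minus_commute power2_commute)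
    have "(\<lambda>k. sqrt C * (1/2) ^ k) \<longlonglongrightarrow> 0"
      by (intro tendsto_mult_right_zero LIMSEQ_power_zero) auto
    then have "(\<lambda>k. ennreal (sqrt C * (1/2) ^ k)) \<longlonglongrightarrow> 0"
      using tendsto_ennrealI[of _ 0] by simp
    from tendsto_add[OF this this]
    show "(\<lambda>k. ennreal (sqrt C * (1/2) ^ k) + ennreal (sqrt C * (1/2) ^ k)) \<longlonglongrightarrow> 0" by simp
  qed auto
  with H1 w have "H10 U u g" unfolding H10_def by blast
  moreover have "(LINT x|lebesgue_on U. g x \<bullet> grad \<xi> x)
      = (LINT x|lebesgue_on U. 0 * \<xi> x) - (LINT x|lebesgue_on U. - grad \<phi> x \<bullet> grad \<xi> x)"
    if \<xi>: "\<xi> \<in> test_functions U" for \<xi>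
  proof -
    have [measurable]: "grad \<xi> \<in> borel_measurable borel" using test_functionsD(1)[OF \<xi>] by measurable
    show ?thesis
      using orth[OF \<xi>] zero test_functionsD(4)[OF \<xi>]
      by (simp add: integral_lebesgue_on[OF U] dirichlet_form_def)
  qed
  ultimately show ?thesis unfolding weak_solution_def by blast
qed

text \<open>An infinite constant satisfies every lower bound, so only real constants have to be considered.\<close>

lemma A_p_geI:
  assumes "\<And>a B. 0 \<le> a \<Longrightarrow> gradient_estimate p U (ennreal a) B \<Longrightarrow> X \<le> a"
  shows "ennreal X \<le> A_p p U"
  unfolding A_p_def
proof (intro Inf_greatest)
  fix A assume "A \<in> {A. \<exists>B. gradient_estimate p U A B}"
  then obtain B where B: "gradient_estimate p U A B" by blast
  show "ennreal X \<le> A"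
    using B assms by (cases A) (auto intro: ennreal_leI)
qed

lemma zero_in_Lp: "p > 0 \<Longrightarrow> (\<lambda>x. 0) \<in> Lp p U" "p > 0 \<Longrightarrow> Lp_norm p U (\<lambda>x. 0) = 0"
  by (auto simp: Lp_def Lp_norm_def)

text \<open>With \<open>F = 0\<close> the term with \<open>B\<close> vanishes, also for \<open>B = \<infinity>\<close>.\<close>

lemma gradient_estimate_projection:
  fixes \<phi> :: "real^'n \<Rightarrow> real"
  assumes est: "gradient_estimate p U (ennreal a) B" and a: "0 \<le> a" and p: "p > 0"
    and U: "U \<in> sets borel" and \<phi>: "\<phi> \<in> test_functions UNIV" and sol: "weak_solution U (\<lambda>x. 0) (\<lambda>x. - grad \<phi> x) u g"
    and gm: "g \<in> borel_measurable borel"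
    and P: "0 \<le> P" "(\<integral>\<^sup>+x. ennreal (norm (grad \<phi> x) powr p) \<partial>lborel) \<le> ennreal P"
  shows "(\<integral>\<^sup>+x. ennreal (norm (g x) powr p) * indicator U x \<partial>lborel) \<le> ennreal (a powr p * P)"
proof -
  have m: "(\<lambda>x. - grad \<phi> x) \<in> borel_measurable borel" using test_functionsD(1)[OF \<phi>] by measurable
  have "(\<integral>\<^sup>+x. ennreal (norm (- grad \<phi> x) powr p) * indicator U x \<partial>lborel) \<le> ennreal P"
    by (rule order_trans[OF _ P(2)], intro nn_integral_mono) (auto simp: indicator_def)
  from Lp_norm_le[OF U m P(1) p this]
  have n: "Lp_norm p U (\<lambda>x. - grad \<phi> x) \<le> ennreal (P powr (1 / p))" .
  then have "(\<lambda>x. - grad \<phi> x) \<in> Lp p U"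
    using m by (auto simp: Lp_def borel_measurable_lebesgue_on intro: order_le_less_trans[OF _ ennreal_less_top])
  then have "Lp_norm p U g \<le> ennreal a * Lp_norm p U (\<lambda>x. - grad \<phi> x) + B * Lp_norm p U (\<lambda>x::real^'n. 0::real)"
    using est zero_in_Lp(1)[OF p] sol unfolding gradient_estimate_def by blast
  also have "\<dots> \<le> ennreal a * ennreal (P powr (1 / p))"
    using n by (simp add: zero_in_Lp(2)[OF p] mult_left_mono)
  also have "\<dots> = ennreal (a * P powr (1 / p))" using a by (simp add: ennreal_mult)
  finally have "(\<integral>\<^sup>+x. ennreal (norm (g x) powr p) * indicator U x \<partial>lborel) \<le> ennreal ((a * P powr (1 / p)) powr p)"
    using a by (intro integral_le_of_Lp_norm_le[OF U gm _ p]) auto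
  also have "(a * P powr (1 / p)) powr p = a powr p * P"
    using a P(1) p by (simp add: powr_mult powr_powr)
  finally show ?thesis .
qed

section \<open>Cutoff functions and the core inequality\<close>

locale plateau =
  fixes \<theta> :: "real^'n \<Rightarrow> real" and M :: real
  assumes smooth_theta: "smooth \<theta>"
    and theta_bounds: "0 \<le> \<theta> x" "\<theta> x \<le> 1"
    and theta_1: "norm x \<le> 1/2 \<Longrightarrow> \<theta> x = 1"
    and theta_0: "norm x \<ge> 1 \<Longrightarrow> \<theta> x = 0"
    and M: "0 < M" "norm (grad \<theta> x) \<le> M"
begin

definition bump :: "real^'n \<Rightarrow> real \<Rightarrow> real^'n \<Rightarrow> real" where
  "bump c r x = \<theta> ((1 / r) *\<^sub>R (x - c))"

lemma smooth_bump: "smooth (bump c r)"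
  unfolding bump_def[abs_def] by (rule smooth_affine(1)[OF smooth_theta])

lemma bump_bounds: "0 \<le> bump c r x" "bump c r x \<le> 1"
  by (simp_all add: bump_def theta_bounds)

lemma bump_1: "0 < r \<Longrightarrow> dist x c \<le> r / 2 \<Longrightarrow> bump c r x = 1"
  unfolding bump_def by (rule theta_1) (simp add: dist_norm divide_le_eq)

lemma bump_0: "0 < r \<Longrightarrow> r \<le> dist x c \<Longrightarrow> bump c r x = 0"
  unfolding bump_def by (rule theta_0) (simp add: dist_norm le_divide_eq)

lemma bump_support: "0 < r \<Longrightarrow> closure {x. bump c r x \<noteq> 0} \<subseteq> cball c r"
  by (rule closure_minimal) (use bump_0[of r _ c] in \<open>force simp: dist_commute\<close>)+

lemma grad_bump_le: "0 < r \<Longrightarrow> norm (grad (bump c r) x) \<le> M / r"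
  unfolding bump_def[abs_def] smooth_affine(2)[OF smooth_theta]
  using M(2) by (simp add: divide_right_mono)

lemma grad_bump_0: "0 < r \<Longrightarrow> x \<notin> cball c r \<Longrightarrow> grad (bump c r) x = 0"
  using bump_support by (intro grad_eq_0) blast

lemma bump_test_function: "0 < r \<Longrightarrow> cball c r \<subseteq> U \<Longrightarrow> bump c r \<in> test_functions U"
  using bump_support[of r c] smooth_bump[of c r] bounded_subset[OF bounded_cball, of _ c r]
  by (auto simp: test_functions_def compact_eq_bounded_closed)

text \<open>A test function \<open>\<phi>\<close> is itself the solution for \<open>f = - \<nabla>\<phi>\<close>, so both sides of the estimate have the
  same norm. This norm is not zero by the Poincare inequality.\<close>

lemma gradient_estimate_ge_1:
  fixes c :: "real^'n"
  assumes est: "gradient_estimate p U (ennreal a) B" and a: "0 \<le> a" and p: "p > 0"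
    and U: "U \<in> sets borel" and c: "cball c r \<subseteq> U" "0 < r"
  shows "1 \<le> a"
proof (rule ccontr)
  assume "\<not> 1 \<le> a"
  then have a1: "a powr p < 1" using a p powr_less_mono2[of p a 1] by simp
  define \<phi> where "\<phi> = bump c r"
  have \<phi>: "\<phi> \<in> test_functions U" "\<phi> \<in> test_functions UNIV"
    using c by (auto simp: \<phi>_def intro: bump_test_function)
  note sm = test_functionsD(1)[OF \<phi>(1)]
  have [measurable]: "\<phi> \<in> borel_measurable borel" "grad \<phi> \<in> borel_measurable borel" using sm by measurable
  have int: "integrable lborel (\<lambda>x. (\<phi> x)\<^sup>2)"
    by (rule integrable_compact_support[OF _ test_functionsD(2)[OF \<phi>(1)]])
       (use continuous_on_power[OF continuous_on_smooth[OF sm]] closure_subset[of "{x. \<phi> x \<noteq> 0}"] in auto)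
  have "gradient_projection U \<phi> (\<lambda>k. \<phi>) \<phi> (grad \<phi>) 0"
  proof
    show "sq_int lborel \<phi> < \<infinity>"
      using nn_integral_eq_integral[OF int] by simp
    show "sq_int lborel (grad \<phi>) < \<infinity>"
      by (simp add: nn_integral_dirichlet_form[OF \<phi>(2)])
  qed (use \<phi> test_functionsD(3,4)[OF \<phi>(1)] in \<open>auto simp: dirichlet_form_def grad_const\<close>)
  then have sol: "weak_solution U (\<lambda>x. 0) (\<lambda>x. - grad \<phi> x) \<phi> (grad \<phi>)"
    by (rule gradient_projection.weak_solution[OF _ U])
  have intp: "integrable lborel (\<lambda>x. norm (grad \<phi> x) powr p)"
    by (rule integrable_compact_support[OF _ test_functionsD(2)[OF \<phi>(1)]])
       (use p in \<open>auto intro!: continuous_on_powr' continuous_on_norm continuous_on_grad sm continuous_on_const simp: grad_eq_0\<close>)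
  define P where "P = (LINT x|lborel. norm (grad \<phi> x) powr p)"
  have P: "(\<integral>\<^sup>+x. ennreal (norm (grad \<phi> x) powr p) \<partial>lborel) = ennreal P" "0 \<le> P"
    using nn_integral_eq_integral[OF intp] by (auto simp: P_def)
  have "(\<integral>\<^sup>+x. ennreal (norm (grad \<phi> x) powr p) * indicator U x \<partial>lborel) \<le> ennreal (a powr p * P)"
    by (rule gradient_estimate_projection[OF est a p U \<phi>(2) sol _ P(2)]) (simp_all add: P)
  also have "(\<integral>\<^sup>+x. ennreal (norm (grad \<phi> x) powr p) * indicator U x \<partial>lborel) = ennreal P"
    unfolding P(1)[symmetric] using test_functionsD(4)[OF \<phi>(1)] p
    by (intro nn_integral_cong) (auto simp: indicator_def)
  finally have "P \<le> a powr p * P" using P(2) by (simp add: ennreal_le_iff)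
  then have "\<not> 0 < P" using mult_strict_right_mono[OF a1, of P] by auto
  then have "P = 0" using P(2) by simp
  then have "AE x in lborel. ennreal (norm (grad \<phi> x) powr p) = 0"
    using P(1) by (subst nn_integral_0_iff_AE[symmetric]) auto
  then have "sq_int lborel (grad \<phi>) = 0"
    by (subst nn_integral_0_iff_AE) auto
  moreover have "\<phi> x = 0" if "norm x \<ge> norm c + r" for x
  proof -
    have "dist x c \<ge> r" using that norm_triangle_ineq2[of x c] by (simp add: dist_norm)
    then show ?thesis using c by (simp add: \<phi>_def bump_0)
  qed
  ultimately have "(\<integral>\<^sup>+x. ennreal ((\<phi> x)\<^sup>2) \<partial>lborel) = 0"
    using poincare_inequality[OF sm, of "norm c + r"] c by (simp add: add_nonneg_pos)
  moreover have "emeasure lborel (ball c (r / 2)) \<le> (\<integral>\<^sup>+x. ennreal ((\<phi> x)\<^sup>2) \<partial>lborel)"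
  proof -
    have "emeasure lborel (ball c (r / 2)) = (\<integral>\<^sup>+x. indicator (ball c (r / 2)) x \<partial>lborel)" by simp
    also have "\<dots> \<le> (\<integral>\<^sup>+x. ennreal ((\<phi> x)\<^sup>2) \<partial>lborel)"
      using c by (intro nn_integral_mono) (auto simp: indicator_def \<phi>_def bump_1 dist_commute)
    finally show ?thesis .
  qed
  moreover have "emeasure lborel (ball c (r / 2)) > 0"
    using c by (simp add: emeasure_ball unit_ball_vol_pos)
  ultimately show False by simp
qed

text \<open>\<open>Z\<close> contains the centres around which \<open>\<phi>\<close> is cut off. It has to cover all holes that meet the
  support of \<open>\<phi>\<close>, but may contain further points. \<open>Z'\<close> contains centres of genuine holes
  inside the plateau of \<open>\<phi>\<close>, and the translate by \<open>\<tau>\<close> of such a hole lies outside the support of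
  \<open>\<phi>\<close>, in another hole or outside the domain. The solution \<open>u\<close> of the problem with data \<open>- \<nabla>\<phi>\<close>
  vanishes on both. The number \<open>E\<close> in the proof is \<open>\<parallel>\<nabla>\<phi> - g\<parallel>\<^sup>2\<close>: it is bounded from above
  because \<open>\<nabla>\<phi> - g\<close> is orthogonal to \<open>\<nabla>(\<phi> - v)\<close> and \<open>g\<close>, so that only the cutoff error \<open>v\<close>
  contributes, and from below by the capacity inequality.\<close>

lemma core_inequality:
  fixes Z Z' U :: "(real^'n) set"
  assumes est: "gradient_estimate p U (ennreal a) B" and a: "0 < a" and p: "p > 1"
    and U: "U \<in> sets borel" "bounded U"
    and h: "0 < h" "h \<le> L" and \<eta>: "0 < \<eta>" and C1: "0 \<le> C1"
    and Z: "finite Z" "\<And>z w. z \<in> Z \<Longrightarrow> w \<in> Z \<Longrightarrow> z \<noteq> w \<Longrightarrow> 2 * h < dist z w"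
    and cover: "cball x1 L - (\<Union>z\<in>Z. ball z (h / 2)) \<subseteq> U"
    and cZ: "real (card Z) * h ^ CARD('n) \<le> C1 * L ^ CARD('n) * \<eta> ^ CARD('n)"
    and Z': "finite Z'" "\<And>z w. z \<in> Z' \<Longrightarrow> w \<in> Z' \<Longrightarrow> z \<noteq> w \<Longrightarrow> ball z R \<inter> ball w R = {}"
    and r: "0 < \<rho>" "\<rho> \<le> R"
    and hole: "\<And>z. z \<in> Z' \<Longrightarrow> ball z \<rho> \<subseteq> cball x1 (L / 2) - U"
    and hole': "\<And>z. z \<in> Z' \<Longrightarrow> ball (z + \<tau>) \<rho> \<inter> (U \<union> ball x1 L) = {}"
    and T: "0 < T" "norm \<tau> \<le> T"
    and J: "0 \<le> J" "(\<integral>\<^sup>+s. ennreal (1 / s ^ (CARD('n) - 1)) * indicator {\<rho>..R} s \<partial>lborel) \<le> ennreal J"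
  shows "real (card Z') * L\<^sup>2 \<le> 24 * (J / 2 + T\<^sup>2 / (4 * R ^ CARD('n))) * M\<^sup>2 * (C1 + 1)
    * (L ^ (CARD('n) + 1) / h) * \<eta> ^ CARD('n) * (1 + a * \<eta> powr (- real CARD('n) / p))"
proof -
  let ?d = "CARD('n)"
  define \<omega> where "\<omega> = unit_ball_vol (real ?d)"
  define K where "K = J / 2 + T\<^sup>2 / (4 * R ^ ?d)"
  define q where "q = \<eta> powr (- real ?d / p)"
  have \<omega>: "\<omega> > 0" by (simp add: \<omega>_def unit_ball_vol_pos)
  have L: "L > 0" using h by simp
  have K: "K \<ge> 0" using J T r by (auto simp: K_def intro!: add_nonneg_nonneg)
  have q: "q > 0" using \<eta> by (simp add: q_def)
  define \<phi> where "\<phi> x = L * bump x1 L x" for x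
  define \<sigma> where "\<sigma> x = (\<Sum>z\<in>Z. bump z h x)" for x
  define v where "v x = \<phi> x * \<sigma> x" for x
  have \<phi>: "\<phi> \<in> test_functions UNIV"
    unfolding \<phi>_def using L by (intro test_functions_scale bump_test_function) auto
  note sm\<phi> = test_functionsD(1)[OF \<phi>]
  have sm\<sigma>: "smooth \<sigma>" unfolding \<sigma>_def by (intro smooth_sum smooth_bump)
  have v: "v \<in> test_functions UNIV"
    by (rule test_functions_combine[OF \<phi> \<phi>]) (auto simp: v_def[abs_def] intro: smooth_mult sm\<phi> sm\<sigma>)
  have \<phi>b: "0 \<le> \<phi> x" "\<phi> x \<le> L" for x
    using L bump_bounds[of x1 L x] by (auto simp: \<phi>_def mult_left_le)
  have g\<phi>: "norm (grad \<phi> x) \<le> M * indicator (cball x1 L) x" for x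
  proof -
    have "grad \<phi> x = L *\<^sub>R grad (bump x1 L) x"
      unfolding \<phi>_def by (rule grad_cmult[OF smooth_bump])
    then show ?thesis
      using grad_bump_le[OF L, of x1 x] grad_bump_0[OF L, of x x1] L M(1)
      by (auto simp: indicator_def field_simps)
  qed
  have g\<phi>M: "norm (grad \<phi> x) \<le> M" for x
    using g\<phi>[of x] M(1) by (cases "x \<in> cball x1 L") auto
  \<comment> \<open>At each point at most one of the cutoff functions is active.\<close>
  have only: "bump w h x = 0 \<and> grad (bump w h) x = 0" if "z \<in> Z" "x \<in> cball z h" "w \<in> Z" "w \<noteq> z" for x z w
  proof -
    have "2 * h < dist w z" using Z(2)[OF that(3,1)] that by simp
    also have "\<dots> \<le> dist w x + dist x z" by (rule dist_triangle)
    finally have "h < dist w x" using that(2) by (simp add: dist_commute)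
    then show ?thesis using bump_0[OF h(1)] grad_bump_0[OF h(1)] by (auto simp: dist_commute)
  qed
  define S where "S = (\<Union>z\<in>Z. cball z h)"
  have gv: "norm (grad v x) \<le> 2 * M * L / h * indicator S x" for x
  proof -
    have gs: "grad v x = \<phi> x *\<^sub>R grad \<sigma> x + \<sigma> x *\<^sub>R grad \<phi> x"
      unfolding v_def by (rule grad_mult[OF sm\<phi> sm\<sigma>])
    have g\<sigma>: "grad \<sigma> x = (\<Sum>z\<in>Z. grad (bump z h) x)"
      unfolding \<sigma>_def by (rule grad_sum[OF smooth_bump])
    show ?thesis
    proof (cases "x \<in> S")
      case True
      then obtain z where z: "z \<in> Z" "x \<in> cball z h" by (auto simp: S_def)
      have "grad \<sigma> x = (\<Sum>w\<in>Z. if w = z then grad (bump z h) x else 0)"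
        unfolding g\<sigma> using only[OF z] by (intro sum.cong) auto
      then have 1: "grad \<sigma> x = grad (bump z h) x" using z Z by simp
      have "\<sigma> x = (\<Sum>w\<in>Z. if w = z then bump z h x else 0)"
        unfolding \<sigma>_def using only[OF z] by (intro sum.cong) auto
      then have 2: "\<sigma> x = bump z h x" using z Z by simp
      have "norm (grad v x) \<le> norm (\<phi> x *\<^sub>R grad \<sigma> x) + norm (\<sigma> x *\<^sub>R grad \<phi> x)"
        unfolding gs by (rule norm_triangle_ineq)
      also have "\<dots> \<le> L * (M / h) + 1 * M"
        unfolding norm_scaleR 1 2
        using \<phi>b[of x] bump_bounds[of z h x] grad_bump_le[OF h(1), of z x] g\<phi>M[of x] L M(1)
        by (intro add_mono mult_mono) auto
      also have "\<dots> \<le> 2 * M * L / h" using h M(1) by (simp add: field_simps)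
      finally show ?thesis using True by simp
    next
      case False
      then have "grad (bump z h) x = 0" "bump z h x = 0" if "z \<in> Z" for z
        using that grad_bump_0[OF h(1)] bump_0[OF h(1), of x z] by (auto simp: S_def dist_commute)
      then show ?thesis using False by (simp add: gs g\<sigma> \<sigma>_def)
    qed
  qed
  have test: "(\<lambda>x. \<phi> x - v x) \<in> test_functions U"
  proof -
    let ?K = "cball x1 L - (\<Union>z\<in>Z. ball z (h / 2))"
    have "\<phi> x - v x = 0" if x: "x \<notin> ?K" for x
    proof (cases "x \<in> cball x1 L")
      case True
      then obtain z where z: "z \<in> Z" "x \<in> ball z (h / 2)" using x by blast
      then have zh: "x \<in> cball z h" using h by auto
      have "\<sigma> x = (\<Sum>w\<in>Z. if w = z then bump z h x else 0)"
        unfolding \<sigma>_def using only[OF z(1) zh] by (intro sum.cong) auto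
      then have "\<sigma> x = 1" using z Z bump_1[OF h(1), of x z] by (simp add: dist_commute)
      then show ?thesis by (simp add: v_def)
    next
      case False
      then show ?thesis using bump_0[OF L, of x x1] by (simp add: v_def \<phi>_def dist_commute)
    qed
    then have "{x. \<phi> x - v x \<noteq> 0} \<subseteq> ?K" by blast
    moreover have "closed ?K" by (intro closed_Diff) auto
    ultimately have sub: "closure {x. \<phi> x - v x \<noteq> 0} \<subseteq> ?K" by (rule closure_minimal)
    then have "bounded (closure {x. \<phi> x - v x \<noteq> 0})"
      by (intro bounded_subset[OF bounded_cball[of x1 L]]) blast
    then show ?thesis
      using sub cover smooth_diff[OF sm\<phi> test_functionsD(1)[OF v]]
      unfolding test_functions_def compact_eq_bounded_closed mem_Collect_eq by blast
  qed
  obtain w u g C where "gradient_projection U \<phi> w u g C"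
    by (rule gradient_projection_exists[OF \<phi> U(2)])
  then interpret P: gradient_projection U \<phi> w u g C .
  note gm [measurable] = P.gm and sol = P.weak_solution[OF U(1)]
  have mg [measurable]: "grad \<phi> \<in> borel_measurable borel" "grad v \<in> borel_measurable borel"
    using sm\<phi> test_functionsD(1)[OF v] by measurable
  define P where "P = M powr p * (\<omega> * L ^ ?d)"
  have P: "0 \<le> P" using \<omega> L by (simp add: P_def)
  have "(\<integral>\<^sup>+x. ennreal (norm (grad \<phi> x) powr p) \<partial>lborel) \<le> (\<integral>\<^sup>+x. ennreal (M powr p) * indicator (cball x1 L) x \<partial>lborel)"
  proof (intro nn_integral_mono)
    fix x
    show "ennreal (norm (grad \<phi> x) powr p) \<le> ennreal (M powr p) * indicator (cball x1 L) x"
      using g\<phi>[of x] p by (auto simp: indicator_def intro!: ennreal_leI powr_mono2 split: if_splits)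
  qed
  also have "\<dots> = ennreal P"
    using L \<omega> by (simp add: nn_integral_cmult_indicator emeasure_cball P_def \<omega>_def ennreal_mult)
  finally have "(\<integral>\<^sup>+x. ennreal (norm (g x) powr p) * indicator U x \<partial>lborel) \<le> ennreal (a powr p * P)"
    using a p by (intro gradient_estimate_projection[OF est _ _ U(1) \<phi> sol gm P]) auto
  also have "(\<integral>\<^sup>+x. ennreal (norm (g x) powr p) * indicator U x \<partial>lborel) = (\<integral>\<^sup>+x. ennreal (norm (g x) powr p) \<partial>lborel)"
    using P.zero(2) p by (intro nn_integral_cong) (auto simp: indicator_def)
  finally have gp: "(\<integral>\<^sup>+x. ennreal (norm (g x) powr p) \<partial>lborel) \<le> ennreal (a powr p * P)" .
  define E where "E = dirichlet_form \<phi> \<phi> - (LINT x|lborel. g x \<bullet> grad \<phi> x)"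
  have E_eq: "E = (LINT x|lborel. (grad \<phi> x - g x) \<bullet> grad v x)"
    and int_E: "integrable lborel (\<lambda>x. (grad \<phi> x - g x) \<bullet> grad v x)"
  proof -
    have fin: "sq_int lborel (grad \<xi>) < \<infinity>" if "\<xi> \<in> test_functions UNIV" for \<xi> :: "real^'n \<Rightarrow> real"
      by (simp add: nn_integral_dirichlet_form[OF that])
    have ig: "integrable lborel (\<lambda>x. g x \<bullet> grad v x)" "integrable lborel (\<lambda>x. g x \<bullet> grad \<phi> x)"
      using P.fing fin[OF v] fin[OF \<phi>] by (auto intro!: L2_product_integrable)
    note iv = integrable_dirichlet_form[OF \<phi> v] integrable_dirichlet_form[OF \<phi> \<phi>]
    show "integrable lborel (\<lambda>x. (grad \<phi> x - g x) \<bullet> grad v x)"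
      unfolding inner_diff_left by (intro Bochner_Integration.integrable_diff ig iv)
    have gd: "grad (\<lambda>x. \<phi> x - v x) x = grad \<phi> x - grad v x" for x
      by (rule grad_diff[OF sm\<phi> test_functionsD(1)[OF v]])
    have "(LINT x|lborel. g x \<bullet> grad \<phi> x) - (LINT x|lborel. g x \<bullet> grad v x)
        = dirichlet_form \<phi> \<phi> - dirichlet_form \<phi> v"
      using P.orth[OF test] ig iv by (simp add: gd dirichlet_form_def inner_diff_right)
    moreover have "(LINT x|lborel. (grad \<phi> x - g x) \<bullet> grad v x) = dirichlet_form \<phi> v - (LINT x|lborel. g x \<bullet> grad v x)"
      using ig iv by (simp add: inner_diff_left dirichlet_form_def)
    ultimately show "E = (LINT x|lborel. (grad \<phi> x - g x) \<bullet> grad v x)" by (simp add: E_def)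
  qed
  define Ebar where "Ebar = 2 * M * L / h * (M * \<omega> * (C1 + 1) * L ^ ?d * \<eta> ^ ?d * (1 + a * q))"
  have Ebar: "Ebar \<ge> 0" using M(1) L h \<omega> C1 \<eta> a q by (simp add: Ebar_def)
  have "E \<le> Ebar"
  proof -
    \<comment> \<open>The typical size of \<open>g\<close> on \<open>S\<close> if the \<open>L\<^sup>p\<close>-bound for \<open>g\<close> is attained there, as \<open>S\<close> has a
      fraction \<open>\<eta>\<^sup>d\<close> of the volume of the support of \<open>\<phi>\<close>. It balances the two terms of Young's
      inequality below.\<close>
    define b where "b = a * M * q"
    have b: "b > 0" using a M(1) q by (simp add: b_def)
    have S: "S \<in> sets borel" unfolding S_def using Z by (intro borel_closed closed_UN) auto
    have mS: "emeasure lborel S \<le> ennreal (\<omega> * C1 * L ^ ?d * \<eta> ^ ?d)"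
    proof -
      have "emeasure lborel S \<le> (\<Sum>z\<in>Z. emeasure lborel (cball z h))"
        unfolding S_def using Z by (intro emeasure_subadditive_finite) auto
      also have "\<dots> = ennreal (card Z * (\<omega> * h ^ ?d))"
        using h \<omega> by (simp add: emeasure_cball \<omega>_def ennreal_mult ennreal_of_nat_eq_real_of_nat)
      also have "\<dots> \<le> ennreal (\<omega> * C1 * L ^ ?d * \<eta> ^ ?d)"
        using mult_left_mono[OF cZ, of \<omega>] \<omega> by (intro ennreal_leI) (simp add: mult_ac)
      finally show ?thesis .
    qed
    have bP: "b powr (1 - p) * (a powr p * P) = a * M * q * \<eta> ^ ?d * \<omega> * L ^ ?d"
    proof -
      have qp: "q powr (1 - p) = q * \<eta> ^ ?d"
      proof -
        have "q * \<eta> ^ ?d = \<eta> powr (- real ?d / p + real ?d)"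
          by (simp only: q_def powr_add powr_realpow[OF \<eta>])
        also have "- real ?d / p + real ?d = (- real ?d / p) * (1 - p)"
          using p by (simp add: field_simps)
        finally show ?thesis by (simp only: q_def powr_powr)
      qed
      have "b powr (1 - p) * (a powr p * P)
          = (a powr (1 - p) * a powr p) * (M powr (1 - p) * M powr p) * q powr (1 - p) * (\<omega> * L ^ ?d)"
        using a M(1) q by (simp add: b_def P_def powr_mult)
      also have "\<dots> = a * M * (q * \<eta> ^ ?d) * (\<omega> * L ^ ?d)"
        using a M(1) unfolding qp by (simp flip: powr_add)
      finally show ?thesis by simp
    qed
    have "ennreal E \<le> ennreal (norm (LINT x|lborel. (grad \<phi> x - g x) \<bullet> grad v x))"
      unfolding E_eq by (intro ennreal_leI) simp
    also have "\<dots> \<le> (\<integral>\<^sup>+x. ennreal (norm ((grad \<phi> x - g x) \<bullet> grad v x)) \<partial>lborel)"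
      by (rule integral_norm_bound_ennreal[OF int_E])
    also have "\<dots> \<le> (\<integral>\<^sup>+x. ennreal (2 * M * L / h) * (ennreal (M + b) * indicator S x + ennreal (b powr (1 - p)) * ennreal (norm (g x) powr p)) \<partial>lborel)"
    proof (intro nn_integral_mono)
      fix x
      \<comment> \<open>Young's inequality in its crudest form: either \<open>t \<le> b\<close> or \<open>t \<le> t\<^sup>p b\<^sup>1\<^sup>-\<^sup>p\<close>.\<close>
      have young: "t \<le> b + b powr (1 - p) * t powr p" if "t \<ge> 0" for t
      proof (cases "t \<le> b")
        case False
        then have "1 \<le> (t / b) powr (p - 1)" using b p by (intro ge_one_powr_ge_zero) auto
        also have "\<dots> = t powr (p - 1) * b powr (1 - p)"
          using b False by (simp add: powr_divide powr_minus_divide[of b "p - 1", simplified])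
        finally have "t \<le> t * (t powr (p - 1) * b powr (1 - p))" using False b by simp
        also have "\<dots> = b powr (1 - p) * t powr p"
          using False b by (simp add: powr_diff)
        finally show ?thesis using b by simp
      qed (simp add: add_increasing2)
      have "norm ((grad \<phi> x - g x) \<bullet> grad v x) \<le> norm (grad \<phi> x - g x) * norm (grad v x)"
        by (simp add: Cauchy_Schwarz_ineq2)
      also have "\<dots> \<le> (norm (grad \<phi> x) + norm (g x)) * (2 * M * L / h * indicator S x)"
        by (intro mult_mono norm_triangle_ineq4 gv) auto
      also have "\<dots> \<le> (M + (b + b powr (1 - p) * norm (g x) powr p)) * (2 * M * L / h * indicator S x)"
        using g\<phi>M[of x] M(1) L h young[of "norm (g x)"]
        by (intro mult_right_mono add_mono) auto
      also have "\<dots> \<le> 2 * M * L / h * ((M + b) * indicator S x + b powr (1 - p) * norm (g x) powr p)"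
      proof -
        have "(M + (b + y)) * (c * i) \<le> c * ((M + b) * i + y)" if "0 \<le> c" "0 \<le> y" "i = 0 \<or> i = 1" for c y i :: real
          using that by (auto simp: algebra_simps)
        from this[of "2 * M * L / h" "b powr (1 - p) * norm (g x) powr p" "indicator S x"]
        show ?thesis using M(1) L h by (simp only: indicator_eq_0_iff indicator_eq_1_iff) auto
      qed
      finally have "ennreal (norm ((grad \<phi> x - g x) \<bullet> grad v x))
          \<le> ennreal (2 * M * L / h * ((M + b) * indicator S x + b powr (1 - p) * norm (g x) powr p))"
        by (rule ennreal_leI)
      also have "\<dots> = ennreal (2 * M * L / h) * (ennreal (M + b) * indicator S x + ennreal (b powr (1 - p)) * ennreal (norm (g x) powr p))"
      proof -
        have "ennreal ((M + b) * indicator S x + b powr (1 - p) * norm (g x) powr p)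
          = ennreal ((M + b) * indicator S x) + ennreal (b powr (1 - p) * norm (g x) powr p)"
          using M(1) b by (intro ennreal_plus) auto
        also have "\<dots> = ennreal (M + b) * indicator S x + ennreal (b powr (1 - p)) * ennreal (norm (g x) powr p)"
          by (auto simp: ennreal_mult indicator_def)
        finally show ?thesis using M(1) L h b by (subst ennreal_mult) auto
      qed
      finally show "ennreal (norm ((grad \<phi> x - g x) \<bullet> grad v x))
        \<le> ennreal (2 * M * L / h) * (ennreal (M + b) * indicator S x + ennreal (b powr (1 - p)) * ennreal (norm (g x) powr p))" .
    qed
    also have "\<dots> = ennreal (2 * M * L / h) * (ennreal (M + b) * emeasure lborel S
        + ennreal (b powr (1 - p)) * (\<integral>\<^sup>+x. ennreal (norm (g x) powr p) \<partial>lborel))"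
      using S by (simp add: nn_integral_cmult nn_integral_add nn_integral_cmult_indicator)
    also have "\<dots> \<le> ennreal (2 * M * L / h) * (ennreal (M + b) * ennreal (\<omega> * C1 * L ^ ?d * \<eta> ^ ?d)
        + ennreal (b powr (1 - p)) * ennreal (a powr p * P))"
      by (intro mult_left_mono add_mono mS gp) auto
    also have "\<dots> = ennreal (2 * M * L / h * ((M + b) * (\<omega> * C1 * L ^ ?d * \<eta> ^ ?d) + b powr (1 - p) * (a powr p * P)))"
    proof -
      have nn: "0 \<le> \<omega> * C1 * L ^ ?d * \<eta> ^ ?d" "0 \<le> a powr p * P" "0 \<le> 2 * M * L / h" "0 \<le> M + b"
        using \<omega> C1 L \<eta> P M(1) h b by auto
      then show ?thesis
        by (simp only: ennreal_mult ennreal_plus mult_nonneg_nonneg add_nonneg_nonneg powr_ge_zero)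
    qed
    also have "\<dots> \<le> ennreal Ebar"
    proof (intro ennreal_leI)
      have "(M + b) * (\<omega> * C1 * L ^ ?d * \<eta> ^ ?d) + b powr (1 - p) * (a powr p * P)
        = M * \<omega> * L ^ ?d * \<eta> ^ ?d * ((1 + a * q) * C1 + a * q)"
        unfolding bP by (simp add: b_def algebra_simps)
      also have "\<dots> \<le> M * \<omega> * L ^ ?d * \<eta> ^ ?d * ((C1 + 1) * (1 + a * q))"
        using M(1) \<omega> L \<eta> by (intro mult_left_mono) (auto simp: algebra_simps)
      finally have "(M + b) * (\<omega> * C1 * L ^ ?d * \<eta> ^ ?d) + b powr (1 - p) * (a powr p * P)
          \<le> M * \<omega> * (C1 + 1) * L ^ ?d * \<eta> ^ ?d * (1 + a * q)" by (simp add: mult_ac)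
      then show "2 * M * L / h * ((M + b) * (\<omega> * C1 * L ^ ?d * \<eta> ^ ?d) + b powr (1 - p) * (a powr p * P)) \<le> Ebar"
        unfolding Ebar_def using M(1) L h by (intro mult_left_mono) auto
    qed
    finally show ?thesis using Ebar by (simp add: ennreal_le_iff)
  qed
  have cap: "real (card Z') * L\<^sup>2 * \<omega> \<le> 12 * K * dirichlet_form (\<lambda>x. w k x - \<phi> x) (\<lambda>x. w k x - \<phi> x)" for k
  proof -
    let ?\<zeta> = "\<lambda>x. w k x - \<phi> x"
    have \<zeta>: "?\<zeta> \<in> test_functions UNIV"
      by (intro test_functions_diff test_functionsD(5)[OF P.w] \<phi>)
    have wz: "w k x = 0" if "x \<notin> U" for x using test_functionsD(3)[OF P.w that] .
    have "real (card Z') * L\<^sup>2 * measure lborel (ball 0 1 :: (real^'n) set) \<le> 12 * (J / 2 + T\<^sup>2 / (4 * R ^ ?d)) * dirichlet_form ?\<zeta> ?\<zeta>"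
    proof (rule capacity_inequality[OF test_functionsD(1)[OF \<zeta>] Z'(1) r Z'(2) L _ _ T J dirichlet_form_nonneg])
      show "L \<le> \<bar>w k x - \<phi> x\<bar>" if "z \<in> Z'" "x \<in> ball z \<rho>" for z x
      proof -
        have "x \<in> cball x1 (L / 2)" "x \<notin> U" using hole[OF that(1)] that(2) by blast+
        then show ?thesis using wz L bump_1[OF L, of x x1] by (simp add: \<phi>_def dist_commute)
      qed
      show "w k x - \<phi> x = 0" if "z \<in> Z'" "x \<in> ball (z + \<tau>) \<rho>" for z x
      proof -
        have "x \<notin> ball x1 L" "x \<notin> U" using hole'[OF that(1)] that(2) by blast+
        then show ?thesis using wz bump_0[OF L, of x x1] by (simp add: \<phi>_def dist_commute)
      qed
    qed (simp_all add: nn_integral_dirichlet_form[OF \<zeta>])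
    then show ?thesis by (simp add: K_def \<omega>_def content_ball)
  qed
  have "real (card Z') * L\<^sup>2 * \<omega> \<le> 12 * K * E"
    using cap unfolding E_def by (intro LIMSEQ_le_const[OF tendsto_mult_left[OF P.lim]]) auto
  also have "\<dots> \<le> 12 * K * Ebar" using \<open>E \<le> Ebar\<close> K by (intro mult_left_mono) auto
  also have "\<dots> = 24 * K * M\<^sup>2 * (C1 + 1) * (L ^ (?d + 1) / h) * \<eta> ^ ?d * (1 + a * q) * \<omega>"
    by (simp add: Ebar_def power2_eq_square)
  finally have "real (card Z') * L\<^sup>2 \<le> 24 * K * M\<^sup>2 * (C1 + 1) * (L ^ (?d + 1) / h) * \<eta> ^ ?d * (1 + a * q)"
    using \<omega> by (rule mult_right_le_imp_le)
  then show ?thesis by (simp only: K_def q_def)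
qed

end

section \<open>Lattice points and the perforated domain\<close>

definition lattice_box :: "real^'n \<Rightarrow> nat \<Rightarrow> (real^'n) set" where
  "lattice_box c k = {z. (\<forall>i. z $ i \<in> \<int>) \<and> (\<forall>i. \<bar>z $ i - c $ i\<bar> \<le> real k)}"

lemma lattice_box_card:
  fixes c :: "real^'n"
  assumes c: "\<forall>i. c $ i \<in> \<int>"
  shows "finite (lattice_box c k)" and "card (lattice_box c k) = (2 * k + 1) ^ CARD('n)"
proof -
  let ?F = "\<Pi>\<^sub>E i\<in>(UNIV :: 'n set). {- int k..int k}"
  let ?f = "\<lambda>f. (\<chi> i. c $ i + of_int (f i)) :: real^'n"
  have bij: "bij_betw ?f ?F (lattice_box c k)"
  proof (rule bij_betw_imageI)
    show "inj_on ?f ?F" by (auto simp: inj_on_def vec_eq_iff)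
    show "?f ` ?F = lattice_box c k"
    proof
      show "?f ` ?F \<subseteq> lattice_box c k"
      proof
        fix z assume "z \<in> ?f ` ?F"
        then obtain f where f: "f \<in> ?F" "z = ?f f" by blast
        have "\<bar>f i\<bar> \<le> int k" for i using f(1) by (auto simp: PiE_iff abs_le_iff minus_le_iff)
        then have "real_of_int \<bar>f i\<bar> \<le> real_of_int (int k)" for i by (simp only: of_int_le_iff)
        then show "z \<in> lattice_box c k" using c by (simp add: f lattice_box_def)
      qed
      show "lattice_box c k \<subseteq> ?f ` ?F"
      proof
        fix z assume z: "z \<in> lattice_box c k"
        define f where "f i = \<lfloor>z $ i - c $ i\<rfloor>" for i
        have f: "of_int (f i) = z $ i - c $ i" for i
          using z c by (auto simp: f_def lattice_box_def)
        have "real_of_int \<bar>f i\<bar> \<le> real_of_int (int k)" for i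
          using z by (simp add: f lattice_box_def)
        then have "\<bar>f i\<bar> \<le> int k" for i by (simp only: of_int_le_iff)
        then have "f \<in> ?F" by (auto simp: abs_le_iff minus_le_iff)
        moreover have "z = ?f f" by (simp add: vec_eq_iff f)
        ultimately show "z \<in> ?f ` ?F" by blast
      qed
    qed
  qed
  have "finite ?F" by (rule finite_PiE) auto
  then show "finite (lattice_box c k)" using bij_betw_finite[OF bij] by simp
  have "card ?F = (2 * k + 1) ^ CARD('n)"
    by (simp add: card_PiE nat_add_distrib nat_mult_distrib)
  then show "card (lattice_box c k) = (2 * k + 1) ^ CARD('n)"
    using bij_betw_same_card[OF bij] by simp
qed

lemma lattice_dist_ge_1:
  fixes z w :: "real^'n"
  assumes "\<forall>i. z $ i \<in> \<int>" "\<forall>i. w $ i \<in> \<int>" "z \<noteq> w"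
  shows "1 \<le> dist z w"
proof -
  obtain i where "z $ i \<noteq> w $ i" using assms(3) by (auto simp: vec_eq_iff)
  then have "1 \<le> \<bar>(z - w) $ i\<bar>"
    using assms by (intro Ints_nonzero_abs_ge1) auto
  also have "\<dots> \<le> norm (z - w)" by (rule component_le_norm_cart)
  finally show ?thesis by (simp add: dist_norm)
qed

lemma norm_le_of_components:
  fixes x :: "real^'n" and b :: real
  assumes "\<And>i. \<bar>x $ i\<bar> \<le> b"
  shows "norm x \<le> CARD('n) * b"
proof -
  have "norm x \<le> (\<Sum>i\<in>UNIV. \<bar>x $ i\<bar>)" by (rule norm_le_l1_cart)
  also have "\<dots> \<le> (\<Sum>i\<in>(UNIV::'n set). b)" using assms by (rule sum_mono)
  finally show ?thesis by simp
qed

text \<open>The reciprocal capacity of a hole of radius \<open>c\<epsilon>\<eta>\<close> in a cell of size \<open>\<epsilon>\<close>. In all dimensions it is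
  comparable to \<open>\<epsilon>\<^bsup>-d\<^esup> \<sigma>\<^sub>\<epsilon>\<^sup>2\<close>, which is the right hand side up to the constant. For \<open>d = 2\<close> the
  integral is \<open>|ln \<eta>| - ln (2c)\<close>, and \<open>|ln \<eta>| \<ge> 1/2\<close> absorbs the constant.\<close>

lemma radial_integral_le:
  assumes d: "2 \<le> d" and r: "0 < c" "c \<le> 1/4" and e: "0 < \<epsilon>" and \<eta>: "0 < \<eta>" "\<eta> < 1/2"
  shows "(\<integral>\<^sup>+s. ennreal (1 / s ^ (d - 1)) * indicator {c * \<epsilon> * \<eta>..\<epsilon> / 2} s \<partial>lborel)
    \<le> ennreal ((1 / c ^ d + 2 * \<bar>ln (2 * c)\<bar>) * (\<eta>\<^sup>2 * \<epsilon>\<^sup>2 * (if d \<ge> 3 then 1 else \<bar>ln \<eta>\<bar>) / (\<epsilon> * \<eta>) ^ d))"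
proof -
  define \<rho> R where "\<rho> = c * \<epsilon> * \<eta>" and "R = \<epsilon> / 2"
  have c\<eta>: "c * \<eta> \<le> 1/4 * (1/2)" using r \<eta> by (intro mult_mono) auto
  have \<rho>: "0 < \<rho>" "\<rho> \<le> R"
    using r e \<eta> mult_left_mono[OF c\<eta>, of \<epsilon>] by (auto simp: \<rho>_def R_def mult_ac)
  show ?thesis
  proof (cases "d = 2")
    case True
    have "(\<integral>\<^sup>+s. ennreal (1 / s ^ (d - 1)) * indicator {\<rho>..R} s \<partial>lborel) = ennreal (ln R - ln \<rho>)"
      using True \<rho>
      by (intro nn_integral_FTC_Icc)
         (auto intro!: derivative_eq_intros simp flip: has_real_derivative_iff_has_vector_derivative simp: divide_inverse)
    also have "\<dots> \<le> ennreal ((1 / c ^ d + 2 * \<bar>ln (2 * c)\<bar>) * \<bar>ln \<eta>\<bar>)"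
    proof -
      have "ln (1/2) \<ge> ln \<eta>" using \<eta> by (subst ln_le_cancel_iff) auto
      then have l: "\<bar>ln \<eta>\<bar> \<ge> 1/2" using ln2_ge_two_thirds by (simp add: ln_div)
      have "1 / c ^ d \<ge> 1" using r by (simp add: le_divide_eq power_le_one)
      then have "1 * \<bar>ln \<eta>\<bar> \<le> 1 / c ^ d * \<bar>ln \<eta>\<bar>" by (rule mult_right_mono) simp
      moreover have "2 * \<bar>ln (2 * c)\<bar> * (1/2) \<le> 2 * \<bar>ln (2 * c)\<bar> * \<bar>ln \<eta>\<bar>"
        using l by (intro mult_left_mono) auto
      ultimately have "- ln (2 * c) + \<bar>ln \<eta>\<bar> \<le> (1 / c ^ d + 2 * \<bar>ln (2 * c)\<bar>) * \<bar>ln \<eta>\<bar>"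
        by (simp add: algebra_simps)
      moreover have "ln R - ln \<rho> = - ln (2 * c) + \<bar>ln \<eta>\<bar>"
        using r e \<eta> by (simp add: R_def \<rho>_def ln_div ln_mult)
      ultimately show ?thesis by (intro ennreal_leI) simp
    qed
    finally show ?thesis
      using True e \<eta> by (simp add: \<rho>_def R_def power_mult_distrib mult.commute)
  next
    case False
    then have d3: "d \<ge> 3" using d by simp
    define k where "k = d - 2"
    have k: "k \<ge> 1" "d = k + 2" "d - 1 = k + 1" using d3 by (auto simp: k_def)
    have "(\<integral>\<^sup>+s. ennreal (1 / s ^ (d - 1)) * indicator {\<rho>..R} s \<partial>lborel)
        = ennreal (- (inverse R ^ k) / real k - (- (inverse \<rho> ^ k) / real k))"
    proof (intro nn_integral_FTC_Icc)
      fix s assume "s \<in> {\<rho>..R}"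
      then have s: "s > 0" using \<rho> by simp
      have "((\<lambda>s. - (inverse s ^ k) / real k) has_real_derivative - (real k * ((- inverse (s\<^sup>2)) * inverse s ^ (k - 1))) / real k) (at s)"
      proof -
        have "((\<lambda>s. inverse s ^ k) has_real_derivative real k * ((- inverse (s\<^sup>2)) * inverse s ^ (k - 1))) (at s)"
          using DERIV_power[OF DERIV_inverse[of s UNIV], of k] s by (simp add: numeral_2_eq_2 power_inverse)
        from DERIV_cdivide[OF DERIV_minus[OF this], of "real k"] show ?thesis by simp
      qed
      moreover have "- (real k * ((- inverse (s\<^sup>2)) * inverse s ^ (k - 1))) / real k = 1 / s ^ (d - 1)"
      proof -
        have "- (real k * ((- inverse (s\<^sup>2)) * inverse s ^ (k - 1))) / real k = inverse (s\<^sup>2) * inverse s ^ (k - 1)"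
          using k(1) by simp
        also have "\<dots> = 1 / s ^ (k + 1)"
          using k(1) s by (cases k) (simp_all add: power2_eq_square power_inverse divide_inverse)
        finally show ?thesis unfolding k(3) .
      qed
      ultimately show "((\<lambda>s. - (inverse s ^ k) / real k) has_real_derivative 1 / s ^ (d - 1)) (at s)"
        by (simp only:)
    qed (use \<rho> in auto)
    also have "\<dots> \<le> ennreal (inverse \<rho> ^ k)"
    proof (intro ennreal_leI)
      have "inverse \<rho> ^ k / real k \<le> inverse \<rho> ^ k / 1"
        using k(1) \<rho> by (intro divide_left_mono) auto
      moreover have "0 \<le> inverse R ^ k / real k" using \<rho> by simp
      ultimately show "- (inverse R ^ k) / real k - (- (inverse \<rho> ^ k) / real k) \<le> inverse \<rho> ^ k" by simp
    qed
    also have "\<dots> \<le> ennreal ((1 / c ^ d + 2 * \<bar>ln (2 * c)\<bar>) * (\<eta>\<^sup>2 * \<epsilon>\<^sup>2 * 1 / (\<epsilon> * \<eta>) ^ d))"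
    proof (intro ennreal_leI)
      have "c ^ d \<le> c ^ k" unfolding k(2) using r by (intro power_decreasing) auto
      then have 1: "1 / c ^ k \<le> 1 / c ^ d" using r by (intro divide_left_mono) auto
      have "inverse \<rho> ^ k = 1 / c ^ k * (\<eta>\<^sup>2 * \<epsilon>\<^sup>2 * 1 / (\<epsilon> * \<eta>) ^ d)"
        unfolding k(2) \<rho>_def using r e \<eta>
        by (simp add: power_add power_mult_distrib power_inverse power2_eq_square field_simps)
      also have "\<dots> \<le> (1 / c ^ d + 2 * \<bar>ln (2 * c)\<bar>) * (\<eta>\<^sup>2 * \<epsilon>\<^sup>2 * 1 / (\<epsilon> * \<eta>) ^ d)"
        using 1 e \<eta> by (intro mult_right_mono) auto
      finally show "inverse \<rho> ^ k \<le> (1 / c ^ d + 2 * \<bar>ln (2 * c)\<bar>) * (\<eta>\<^sup>2 * \<epsilon>\<^sup>2 * 1 / (\<epsilon> * \<eta>) ^ d)" .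
    qed
    finally show ?thesis using d3 by (simp add: \<rho>_def R_def)
  qed
qed

locale perforation =
  fixes \<Omega> Y :: "(real^'n) set" and c0 \<epsilon> \<eta> :: real
  assumes dim: "CARD('n) \<ge> 2"
    and Omega: "open \<Omega>" "bounded \<Omega>" "\<Omega> \<noteq> {}"
    and Y: "0 < c0" "ball 0 c0 \<subseteq> Y" "Y \<subseteq> ball 0 (1/4)"
    and eps: "0 < \<epsilon>" "\<epsilon> \<le> 1" and eta: "0 < \<eta>" "\<eta> < 1/2"
begin

abbreviation "U \<equiv> perforated \<Omega> Y \<epsilon> \<eta>"

definition hole :: "real^'n \<Rightarrow> (real^'n) set" where
  "hole z = (\<lambda>y. \<epsilon> *\<^sub>R (z + \<eta> *\<^sub>R y)) ` closure Y"

lemma U_eq: "U = \<Omega> - (\<Union>z\<in>hole_centers \<Omega> \<epsilon>. hole z)"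
  by (simp add: perforated_def hole_def)

lemma c0_le: "c0 \<le> 1/4"
proof -
  have "ball (0::real^'n) c0 \<subseteq> ball 0 (1/4)" using Y by blast
  then show ?thesis using Y(1) by (auto simp: ball_subset_ball_iff)
qed

lemma closure_Y: "closure Y \<subseteq> cball 0 (1/4)"
  using Y(3) by (meson ball_subset_cball closed_cball closure_minimal order_trans)

lemma hole_subset: "hole z \<subseteq> cball (\<epsilon> *\<^sub>R z) (\<epsilon> * \<eta> / 4)"
proof
  fix x assume "x \<in> hole z"
  then obtain y where y: "y \<in> closure Y" "x = \<epsilon> *\<^sub>R (z + \<eta> *\<^sub>R y)" by (auto simp: hole_def)
  then have "norm y \<le> 1/4" using closure_Y by auto
  then have "\<epsilon> * \<eta> * norm y \<le> \<epsilon> * \<eta> * (1/4)" using eps eta by (intro mult_left_mono) auto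
  then show "x \<in> cball (\<epsilon> *\<^sub>R z) (\<epsilon> * \<eta> / 4)"
    using eps eta by (simp add: y dist_norm algebra_simps)
qed

lemma ball_subset_hole: "ball (\<epsilon> *\<^sub>R z) (c0 * \<epsilon> * \<eta>) \<subseteq> hole z"
proof
  fix x assume x: "x \<in> ball (\<epsilon> *\<^sub>R z) (c0 * \<epsilon> * \<eta>)"
  define y where "y = (1 / (\<epsilon> * \<eta>)) *\<^sub>R (x - \<epsilon> *\<^sub>R z)"
  have "norm y < c0"
    using x eps eta by (simp add: y_def dist_norm norm_minus_commute divide_less_eq mult_ac)
  then have "y \<in> closure Y" using Y(2) closure_subset by force
  moreover have "x = \<epsilon> *\<^sub>R (z + \<eta> *\<^sub>R y)" using eps eta by (simp add: y_def algebra_simps)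
  ultimately show "x \<in> hole z" by (auto simp: hole_def)
qed

lemma hole_centers_lattice: "z \<in> hole_centers \<Omega> \<epsilon> \<Longrightarrow> \<forall>i. z $ i \<in> \<int>"
  by (simp add: hole_centers_def)

lemma U_borel: "U \<in> sets borel"
proof -
  have "countable {z :: real^'n. \<forall>i. z $ i \<in> \<int>}"
  proof (rule countable_subset)
    show "{z :: real^'n. \<forall>i. z $ i \<in> \<int>} \<subseteq> range (\<lambda>f :: 'n \<Rightarrow> int. \<chi> i. of_int (f i))"
    proof
      fix z :: "real^'n" assume "z \<in> {z. \<forall>i. z $ i \<in> \<int>}"
      then have "\<forall>i. \<exists>k. z $ i = of_int k" by (auto simp: Ints_def)
      then obtain f where "\<forall>i. z $ i = of_int (f i)" by metis
      then have "z = (\<chi> i. of_int (f i))" by (simp add: vec_eq_iff)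
      then show "z \<in> range (\<lambda>f :: 'n \<Rightarrow> int. \<chi> i. of_int (f i))" by blast
    qed
  qed auto
  then have "countable (hole_centers \<Omega> \<epsilon>)"
    by (rule countable_subset[rotated]) (auto simp: hole_centers_def)
  moreover have "hole z \<in> sets borel" for z
  proof -
    have "compact (closure Y)" using closure_Y bounded_subset[OF bounded_cball closure_Y]
      by (simp add: compact_eq_bounded_closed)
    then have "compact (hole z)" unfolding hole_def
      by (intro compact_continuous_image continuous_intros)
    then show ?thesis by (simp add: borel_compact)
  qed
  ultimately have "(\<Union>z\<in>hole_centers \<Omega> \<epsilon>. hole z) \<in> sets borel" by (intro sets.countable_UN') auto
  then show ?thesis unfolding U_eq using Omega(1) by (intro sets.Diff) auto
qed

lemma U_bounded: "bounded U"
  using Omega(2) by (rule bounded_subset) (auto simp: perforated_def)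

lemma ball_disjoint_U: "z \<in> hole_centers \<Omega> \<epsilon> \<Longrightarrow> ball (\<epsilon> *\<^sub>R z) (c0 * \<epsilon> * \<eta>) \<inter> U = {}"
  using ball_subset_hole[of z] unfolding U_eq by blast

text \<open>If there is a hole, the point at distance \<open>3\<epsilon>/8\<close> from its centre in a coordinate direction keeps
  a distance of more than \<open>\<epsilon>/16\<close> from the boundary of the cell and from all holes, whose radius is
  at most \<open>\<epsilon>/8\<close>.\<close>

lemma U_contains_ball:
  obtains c r where "0 < r" "cball c r \<subseteq> U"
proof (cases "hole_centers \<Omega> \<epsilon> = {}")
  case True
  obtain x where "x \<in> \<Omega>" using Omega by blast
  then obtain r where "r > 0" "cball x r \<subseteq> \<Omega>" using Omega(1) open_contains_cball by blast
  then show thesis using True by (intro that[of r x]) (auto simp: U_eq)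
next
  case False
  then obtain z where z: "z \<in> hole_centers \<Omega> \<epsilon>" by blast
  obtain i :: 'n where True by simp
  define q where "q = z + axis i (3/8)"
  have "cball (\<epsilon> *\<^sub>R q) (\<epsilon> / 16) \<subseteq> U"
  proof
    fix x assume x: "x \<in> cball (\<epsilon> *\<^sub>R q) (\<epsilon> / 16)"
    define y where "y = (1 / \<epsilon>) *\<^sub>R x"
    have xy: "x = \<epsilon> *\<^sub>R y" using eps by (simp add: y_def)
    have "norm (\<epsilon> *\<^sub>R (q - y)) \<le> \<epsilon> / 16" using x by (simp add: xy dist_norm algebra_simps)
    then have yq: "norm (q - y) \<le> 1/16" using eps by simp
    have comp: "\<bar>q $ j - y $ j\<bar> \<le> 1/16" for j
      using component_le_norm_cart[of "q - y" j] yq by simp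
    have ax: "\<bar>axis i (3/8 :: real) $ j\<bar> \<le> 3/8" for j by (simp add: axis_def)
    have "\<bar>y $ j - z $ j\<bar> < 1/2" for j
      using comp[of j] ax[of j] unfolding q_def vector_add_component by linarith
    then have "y \<in> open_cube z 1" by (simp add: open_cube_def)
    then have "x \<in> \<Omega>" using z by (auto simp: hole_centers_def xy)
    moreover have "x \<notin> hole w" if w: "w \<in> hole_centers \<Omega> \<epsilon>" for w
    proof
      assume "x \<in> hole w"
      then have "norm (\<epsilon> *\<^sub>R (w - y)) \<le> \<epsilon> * \<eta> / 4" using hole_subset[of w] by (auto simp: xy dist_norm algebra_simps)
      then have "\<epsilon> * norm (w - y) \<le> \<epsilon> * (\<eta> / 4)" unfolding norm_scaleR using eps by simp
      then have "norm (w - y) \<le> \<eta> / 4" using eps by simp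
      then have wy: "norm (w - y) \<le> 1/8" using eta by simp
      have wc: "\<bar>w $ j - y $ j\<bar> \<le> 1/8" for j
        using component_le_norm_cart[of "w - y" j] wy by simp
      show False
      proof (cases "w = z")
        case True
        have "q $ i = z $ i + 3/8" by (simp add: q_def)
        then show False using wc[of i] comp[of i] unfolding True by linarith
      next
        case False
        then obtain j where j: "w $ j \<noteq> z $ j" by (auto simp: vec_eq_iff)
        have "1 \<le> \<bar>w $ j - z $ j\<bar>"
          using hole_centers_lattice[OF w] hole_centers_lattice[OF z] j by (intro Ints_nonzero_abs_ge1) auto
        then show False using wc[of j] comp[of j] ax[of j] unfolding q_def vector_add_component by linarith
      qed
    qed
    ultimately show "x \<in> U" unfolding U_eq by blast
  qed
  then show thesis using eps by (intro that[of "\<epsilon> / 16" "\<epsilon> *\<^sub>R q"]) auto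
qed

end

section \<open>The local estimate\<close>

text \<open>The factor that distinguishes dimension two. With it \<open>\<sigma>\<^sub>\<epsilon>\<^sup>2 = \<epsilon>\<^sup>2 \<eta>\<^bsup>2-d\<^esup> log_factor d \<eta>\<close> in all
  dimensions, so that no later argument has to distinguish them.\<close>

definition log_factor :: "nat \<Rightarrow> real \<Rightarrow> real" where
  "log_factor d \<eta> = (if d \<ge> 3 then 1 else \<bar>ln \<eta>\<bar>)"

lemma log_factor_ge_half:
  assumes "0 < \<eta>" "\<eta> < 1/2"
  shows "1/2 \<le> log_factor d \<eta>"
proof -
  have "ln \<eta> \<le> ln (1/2)" using assms by (subst ln_le_cancel_iff) auto
  then have "1/2 \<le> \<bar>ln \<eta>\<bar>" using ln2_ge_two_thirds by (simp add: ln_div)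
  then show ?thesis by (simp add: log_factor_def)
qed

lemma sigma_eps_square:
  assumes "0 < \<epsilon>" "0 < \<eta>" "\<eta> < 1/2" "2 \<le> d"
  shows "(sigma_eps d \<epsilon> \<eta>)\<^sup>2 = \<epsilon>\<^sup>2 * \<eta>\<^sup>2 * log_factor d \<eta> / \<eta> ^ d"
proof (cases "d \<ge> 3")
  case True
  have "(\<eta> powr (1 - real d / 2))\<^sup>2 = \<eta> powr (2 - real d)"
    by (simp add: power2_eq_square flip: powr_add)
  also have "\<dots> = \<eta>\<^sup>2 / \<eta> ^ d"
    using assms by (simp add: powr_diff powr_realpow flip: powr_numeral)
  finally show ?thesis using True by (simp add: sigma_eps_def log_factor_def power_mult_distrib)
next
  case False
  then have "d = 2" using assms by simp
  moreover have "(\<bar>ln \<eta>\<bar> powr (1/2))\<^sup>2 = \<bar>ln \<eta>\<bar>"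
    by (simp add: powr_half_sqrt)
  ultimately show ?thesis using assms by (simp add: sigma_eps_def log_factor_def power_mult_distrib)
qed

lemma sigma_eps_ge:
  assumes "0 < \<epsilon>" "0 < \<eta>" "\<eta> < 1/2" "2 \<le> d"
  shows "\<epsilon> / 2 \<le> sigma_eps d \<epsilon> \<eta>"
proof (rule power2_le_imp_le)
  have "\<eta> ^ d \<le> \<eta>\<^sup>2" using assms by (intro power_decreasing) auto
  then have "1 \<le> \<eta>\<^sup>2 / \<eta> ^ d" using assms by (simp add: le_divide_eq)
  then have "1 * (1/2) \<le> \<eta>\<^sup>2 / \<eta> ^ d * log_factor d \<eta>"
    using log_factor_ge_half[OF assms(2,3), of d] by (intro mult_mono) auto
  then have "1/4 \<le> \<eta>\<^sup>2 / \<eta> ^ d * log_factor d \<eta>" by linarith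
  then have "\<epsilon>\<^sup>2 * (1/4) \<le> \<epsilon>\<^sup>2 * (\<eta>\<^sup>2 / \<eta> ^ d * log_factor d \<eta>)"
    by (rule mult_left_mono) simp
  then show "(\<epsilon> / 2)\<^sup>2 \<le> (sigma_eps d \<epsilon> \<eta>)\<^sup>2"
    using assms by (simp add: sigma_eps_square power_divide mult_ac)
  show "0 \<le> sigma_eps d \<epsilon> \<eta>" using assms by (simp add: sigma_eps_def)
qed

definition (in plateau) local_constant :: "real \<Rightarrow> real \<Rightarrow> real \<Rightarrow> real" where
  "local_constant c CT \<kappa> =
    24 * ((1 / c ^ CARD('n) + 2 * \<bar>ln (2 * c)\<bar>) / 2 + CT\<^sup>2 * 2 ^ CARD('n) / 4) * M\<^sup>2
      * ((2 + 5 / \<kappa>) ^ CARD('n) + 1) * (4 * CARD('n)) ^ CARD('n)"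

lemma (in plateau) local_constant_pos: "0 < c \<Longrightarrow> 0 < \<kappa> \<Longrightarrow> 0 < local_constant c CT \<kappa>"
  unfolding local_constant_def using M(1)
  by (intro mult_pos_pos add_pos_nonneg add_nonneg_pos divide_pos_pos zero_less_power) (auto intro: add_pos_nonneg)

text \<open>The core inequality for cells of size \<open>\<epsilon>\<close>. Both families of centres are lattice boxes: the large
  one covers the support of \<open>\<phi>\<close> and has at most \<open>((2 + 5/\<kappa>) L/\<epsilon>)\<^sup>d\<close> points, the small one has at
  least \<open>(L/(4d\<epsilon>))\<^sup>d\<close> points and stays inside the plateau; the factor \<open>d\<close> comes from comparing the
  Euclidean norm with the maximum norm. For small \<open>L/\<epsilon>\<close> the small box consists of its centre only.
  The assumption \<open>\<eta> \<le> \<kappa>\<close> makes the holes small compared to \<open>L\<close> even then. As \<open>L \<le> \<sigma>\<^sub>\<epsilon>\<close>, the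
  cost of the translation is at most of the order of the cost of leaving a hole.\<close>

lemma (in plateau) local_estimate:
  fixes \<Omega> Y :: "(real^'n) set" and c0 \<epsilon> \<eta> \<kappa> L T CT a p :: real and k :: nat
  assumes perf: "perforation \<Omega> Y c0 \<epsilon> \<eta>"
    and est: "gradient_estimate p (perforated \<Omega> Y \<epsilon> \<eta>) (ennreal a) B" and a: "0 < a" and p: "1 < p"
    and z1: "\<forall>i. z1 $ i \<in> \<int>" and \<kappa>: "0 < \<kappa>" "\<kappa> * \<epsilon> \<le> L" "\<eta> \<le> \<kappa>"
    and cb: "cball (\<epsilon> *\<^sub>R z1) L \<subseteq> \<Omega>"
    and k: "real k * (4 * CARD('n) * \<epsilon>) \<le> L" "L \<le> (2 * real k + 1) * (4 * CARD('n) * \<epsilon>)"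
    and holes: "lattice_box z1 k \<subseteq> hole_centers \<Omega> \<epsilon>"
    and T: "0 < T" "norm \<tau> \<le> T" "T \<le> CT * L"
    and shifted: "\<And>z. z \<in> lattice_box z1 k \<Longrightarrow>
      ball (\<epsilon> *\<^sub>R z + \<tau>) (c0 * \<epsilon> * \<eta>) \<inter> (perforated \<Omega> Y \<epsilon> \<eta> \<union> ball (\<epsilon> *\<^sub>R z1) L) = {}"
    and L\<sigma>: "L \<le> sigma_eps CARD('n) \<epsilon> \<eta>"
  shows "L / (\<epsilon> * \<eta> * log_factor CARD('n) \<eta>)
    \<le> local_constant c0 CT \<kappa> * (1 + a * \<eta> powr (- real CARD('n) / p))"
proof -
  interpret perforation \<Omega> Y c0 \<epsilon> \<eta> by (rule perf)
  let ?d = "CARD('n)"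
  define h where "h = \<epsilon> * \<eta>"
  define l where "l = log_factor ?d \<eta>"
  define q where "q = \<eta> powr (- real ?d / p)"
  define CJ where "CJ = 1 / c0 ^ ?d + 2 * \<bar>ln (2 * c0)\<bar>"
  define CK where "CK = CJ / 2 + CT\<^sup>2 * 2 ^ ?d / 4"
  define C1 where "C1 = (2 + 5 / \<kappa>) ^ ?d"
  define s2 where "s2 = \<epsilon>\<^sup>2 * \<eta>\<^sup>2 * l / \<eta> ^ ?d"
  define K where "K = CJ * (\<eta>\<^sup>2 * \<epsilon>\<^sup>2 * l / (\<epsilon> * \<eta>) ^ ?d) / 2 + T\<^sup>2 / (4 * (\<epsilon> / 2) ^ ?d)"
  have l: "l > 0" using log_factor_ge_half[OF eta, of ?d] by (simp add: l_def)
  have L: "L > 0" using \<kappa>(2) mult_pos_pos[OF \<kappa>(1) eps(1)] by simp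
  have q: "q > 0" using eta by (simp add: q_def)
  have CJ: "CJ \<ge> 0" using Y(1) by (simp add: CJ_def)
  have s2: "L\<^sup>2 \<le> s2" "s2 > 0"
    using power_mono[OF L\<sigma>, of 2] L sigma_eps_square[OF eps(1) eta dim] eps eta l by (auto simp: s2_def l_def)
  have h: "0 < h" "h \<le> L"
    using eps eta order_trans[OF mult_left_mono[OF \<kappa>(3), of \<epsilon>]] \<kappa>(2) by (auto simp: h_def mult.commute)
  have hq: "c0 * \<epsilon> * \<eta> \<le> h / 4" using c0_le h(1) mult_right_mono[OF c0_le, of h] by (simp add: h_def)
  have close: "norm (\<epsilon> *\<^sub>R z - \<epsilon> *\<^sub>R z1) \<le> L / 4" if "z \<in> lattice_box z1 k" for z
  proof -
    have "norm (z - z1) \<le> ?d * real k"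
      using that by (intro norm_le_of_components) (auto simp: lattice_box_def)
    then have "\<epsilon> * norm (z - z1) \<le> \<epsilon> * (?d * real k)" using eps by (intro mult_left_mono) auto
    also have "\<dots> \<le> L / 4" using k(1) by (simp add: mult_ac)
    finally show ?thesis using eps by (simp flip: scaleR_diff_right)
  qed
  have scaled_dist: "dist (\<epsilon> *\<^sub>R z) (\<epsilon> *\<^sub>R w) \<ge> \<epsilon>" if "\<forall>i. z $ i \<in> \<int>" "\<forall>i. w $ i \<in> \<int>" "z \<noteq> w" for z w :: "real^'n"
    using mult_left_mono[OF lattice_dist_ge_1[OF that], of \<epsilon>] eps
    by (simp add: dist_norm flip: scaleR_diff_right)
  have inj: "inj_on (\<lambda>z. \<epsilon> *\<^sub>R z) A" for A :: "(real^'n) set" using eps by (auto simp: inj_on_def)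
  define k1 where "k1 = nat \<lceil>L / \<epsilon>\<rceil> + 1"
  have k1: "L / \<epsilon> + 1 \<le> real k1" "real k1 \<le> L / \<epsilon> + 2"
    using L eps by (auto simp: k1_def le_of_int_ceiling) linarith+
  define Z where "Z = (\<lambda>z. \<epsilon> *\<^sub>R z) ` lattice_box z1 k1"
  define Z' where "Z' = (\<lambda>z. \<epsilon> *\<^sub>R z) ` lattice_box z1 k"
  have cZ: "card Z = (2 * k1 + 1) ^ ?d" "finite Z" and cZ': "card Z' = (2 * k + 1) ^ ?d" "finite Z'"
    unfolding Z_def Z'_def using lattice_box_card[OF z1] by (simp_all add: card_image inj)
  have main: "real (card Z') * L\<^sup>2 \<le> 24 * K * M\<^sup>2 * (C1 + 1) * (L ^ (?d + 1) / h) * \<eta> ^ ?d * (1 + a * q)"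
    unfolding K_def q_def
  proof (rule core_inequality[OF est a p U_borel U_bounded h eta(1) _ cZ(2) _ _ _ cZ'(2), where R = "\<epsilon> / 2" and \<rho> = "c0 * \<epsilon> * \<eta>" and \<tau> = \<tau> and ?x1.0 = "\<epsilon> *\<^sub>R z1"])
    show "0 \<le> C1" using \<kappa> by (simp add: C1_def)
    show "2 * h < dist z w" if zw: "z \<in> Z" "w \<in> Z" "z \<noteq> w" for z w
    proof -
      have "\<epsilon> \<le> dist z w" using zw by (auto simp: Z_def lattice_box_def intro!: scaled_dist)
      moreover have "2 * h < \<epsilon>" using eps eta by (simp add: h_def)
      ultimately show ?thesis by simp
    qed
    show "cball (\<epsilon> *\<^sub>R z1) L - (\<Union>z\<in>Z. ball z (h / 2)) \<subseteq> U"
    proof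
      fix x assume x: "x \<in> cball (\<epsilon> *\<^sub>R z1) L - (\<Union>z\<in>Z. ball z (h / 2))"
      have "x \<notin> hole z" if z: "z \<in> hole_centers \<Omega> \<epsilon>" for z
      proof
        assume "x \<in> hole z"
        then have xz: "dist (\<epsilon> *\<^sub>R z) x \<le> h / 4" using hole_subset[of z] by (auto simp: h_def)
        then have "x \<in> ball (\<epsilon> *\<^sub>R z) (h / 2)" using h by simp
        moreover have "z \<in> lattice_box z1 k1"
          unfolding lattice_box_def mem_Collect_eq
        proof (intro conjI hole_centers_lattice[OF z] allI)
          fix i
          have "norm (\<epsilon> *\<^sub>R (z - z1)) = dist (\<epsilon> *\<^sub>R z) (\<epsilon> *\<^sub>R z1)" by (simp add: dist_norm scaleR_diff_right)
          also have "\<dots> \<le> dist (\<epsilon> *\<^sub>R z) x + dist x (\<epsilon> *\<^sub>R z1)" by (rule dist_triangle)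
          also have "\<dots> \<le> h / 4 + L" using xz x by (intro add_mono) (auto simp: dist_commute)
          also have "\<dots> \<le> \<epsilon> * (L / \<epsilon> + 1)" using eps eta by (simp add: h_def distrib_left mult_left_le)
          finally have "norm (z - z1) \<le> L / \<epsilon> + 1" using eps by simp
          then show "\<bar>z $ i - z1 $ i\<bar> \<le> real k1"
            using component_le_norm_cart[of "z - z1" i] k1 by simp
        qed
        ultimately show False using x by (auto simp: Z_def)
      qed
      then show "x \<in> U" using x cb unfolding U_eq by blast
    qed
    show "real (card Z) * h ^ ?d \<le> C1 * L ^ ?d * \<eta> ^ ?d"
    proof -
      have "5 * (\<kappa> * \<epsilon>) \<le> 5 * L" using \<kappa> by simp
      then have "5 \<le> 5 / \<kappa> * (L / \<epsilon>)" using \<kappa> eps by (simp add: field_simps)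
      then have "2 * real k1 + 1 \<le> (2 + 5 / \<kappa>) * (L / \<epsilon>)" using k1 unfolding distrib_right by linarith
      then have "(2 * real k1 + 1) ^ ?d \<le> ((2 + 5 / \<kappa>) * (L / \<epsilon>)) ^ ?d" by (rule power_mono) simp
      then have "(2 * real k1 + 1) ^ ?d * h ^ ?d \<le> ((2 + 5 / \<kappa>) * (L / \<epsilon>)) ^ ?d * h ^ ?d"
        using h by (intro mult_right_mono) auto
      also have "\<dots> = C1 * L ^ ?d * \<eta> ^ ?d"
        using eps by (simp add: C1_def h_def power_mult_distrib power_divide)
      finally show ?thesis using cZ(1) by (simp add: add.commute)
    qed
    show "ball z (\<epsilon> / 2) \<inter> ball w (\<epsilon> / 2) = {}" if zw: "z \<in> Z'" "w \<in> Z'" "z \<noteq> w" for z w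
    proof -
      have "\<epsilon> \<le> dist z w" using zw by (auto simp: Z'_def lattice_box_def intro!: scaled_dist)
      then show ?thesis by (intro disjoint_ballI) simp
    qed
    show "0 < c0 * \<epsilon> * \<eta>" using Y eps eta by simp
    show "c0 * \<epsilon> * \<eta> \<le> \<epsilon> / 2" 
    proof -
      have "h \<le> \<epsilon>" using eps eta by (simp add: h_def mult_left_le)
      then show ?thesis using hq h by linarith
    qed
    show "ball z (c0 * \<epsilon> * \<eta>) \<subseteq> cball (\<epsilon> *\<^sub>R z1) (L / 2) - U" if zZ: "z \<in> Z'" for z
    proof -
      obtain w where w: "w \<in> lattice_box z1 k" "z = \<epsilon> *\<^sub>R w" using zZ by (auto simp: Z'_def)
      have "ball z (c0 * \<epsilon> * \<eta>) \<inter> U = {}" unfolding w(2) using w(1) holes by (intro ball_disjoint_U) auto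
      moreover have "x \<in> cball (\<epsilon> *\<^sub>R z1) (L / 2)" if "x \<in> ball z (c0 * \<epsilon> * \<eta>)" for x
      proof -
        have "dist (\<epsilon> *\<^sub>R z1) x \<le> dist (\<epsilon> *\<^sub>R z1) z + dist z x" by (rule dist_triangle)
        also have "\<dots> \<le> L / 4 + L / 4"
          using close[OF w(1)] that hq h by (intro add_mono) (auto simp: w(2) dist_norm norm_minus_commute)
        finally show ?thesis by simp
      qed
      ultimately show ?thesis by blast
    qed
    show "ball (z + \<tau>) (c0 * \<epsilon> * \<eta>) \<inter> (U \<union> ball (\<epsilon> *\<^sub>R z1) L) = {}" if "z \<in> Z'" for z
      using that shifted by (auto simp: Z'_def)
    show "0 < T" "norm \<tau> \<le> T" by (rule T)+
    show "0 \<le> CJ * (\<eta>\<^sup>2 * \<epsilon>\<^sup>2 * l / (\<epsilon> * \<eta>) ^ ?d)" using CJ l eps eta by simp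
    show "(\<integral>\<^sup>+s. ennreal (1 / s ^ (?d - 1)) * indicator {c0 * \<epsilon> * \<eta>..\<epsilon> / 2} s \<partial>lborel)
        \<le> ennreal (CJ * (\<eta>\<^sup>2 * \<epsilon>\<^sup>2 * l / (\<epsilon> * \<eta>) ^ ?d))"
      unfolding CJ_def l_def log_factor_def by (rule radial_integral_le[OF dim Y(1) c0_le eps(1) eta])
  qed
  have K: "K \<le> CK * (s2 / \<epsilon> ^ ?d)"
  proof -
    have "T\<^sup>2 \<le> (CT * L)\<^sup>2" using T by (intro power_mono) auto
    also have "\<dots> \<le> CT\<^sup>2 * s2" using s2 by (simp add: power_mult_distrib mult_left_mono)
    finally have "T\<^sup>2 * (2 ^ ?d / (4 * \<epsilon> ^ ?d)) \<le> CT\<^sup>2 * s2 * (2 ^ ?d / (4 * \<epsilon> ^ ?d))"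
      using eps by (intro mult_right_mono) auto
    then show ?thesis
      using eps eta by (simp add: K_def CK_def s2_def power_divide power_mult_distrib field_simps)
  qed
  have low: "(L / (4 * ?d * \<epsilon>)) ^ ?d \<le> real (card Z')"
  proof -
    have "L / (4 * ?d * \<epsilon>) \<le> 2 * real k + 1" using k(2) eps by (simp add: divide_le_eq)
    then have "(L / (4 * ?d * \<epsilon>)) ^ ?d \<le> (2 * real k + 1) ^ ?d" using L eps by (intro power_mono) auto
    then show ?thesis by (simp add: cZ' add.commute)
  qed
  define D where "D = 24 * CK * M\<^sup>2 * (C1 + 1) * (1 + a * q)"
  have "(L / (4 * ?d * \<epsilon>)) ^ ?d * L\<^sup>2 \<le> real (card Z') * L\<^sup>2" using low by (intro mult_right_mono) auto
  also have "\<dots> \<le> 24 * K * M\<^sup>2 * (C1 + 1) * (L ^ (?d + 1) / h) * \<eta> ^ ?d * (1 + a * q)" by (rule main)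
  also have "\<dots> = K * (24 * M\<^sup>2 * (C1 + 1) * (L ^ (?d + 1) / h) * \<eta> ^ ?d * (1 + a * q))" by simp
  also have "\<dots> \<le> CK * (s2 / \<epsilon> ^ ?d) * (24 * M\<^sup>2 * (C1 + 1) * (L ^ (?d + 1) / h) * \<eta> ^ ?d * (1 + a * q))"
    using K \<kappa> L h eta a q by (intro mult_right_mono) (auto simp: C1_def)
  also have "\<dots> = D * (\<epsilon> * \<eta> * l) * (L ^ (?d + 1) / \<epsilon> ^ ?d)"
    using eps eta by (simp add: D_def s2_def h_def power2_eq_square field_simps)
  finally have "L * (L ^ (?d + 1) / \<epsilon> ^ ?d) \<le> (D * (4 * ?d) ^ ?d * (\<epsilon> * \<eta> * l)) * (L ^ (?d + 1) / \<epsilon> ^ ?d)"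
    using eps L by (simp add: power_divide power_mult_distrib field_simps power2_eq_square)
  moreover have "L ^ (?d + 1) / \<epsilon> ^ ?d > 0" using L eps by simp
  ultimately have "L \<le> D * (4 * ?d) ^ ?d * (\<epsilon> * \<eta> * l)" by (rule mult_right_le_imp_le)
  then have "L / (\<epsilon> * \<eta> * l) \<le> D * (4 * ?d) ^ ?d" using eps eta l by (simp add: divide_le_eq)
  also have "\<dots> = 24 * CK * M\<^sup>2 * (C1 + 1) * (4 * ?d) ^ ?d * (1 + a * q)" by (simp add: D_def)
  finally show ?thesis by (simp only: l_def CK_def CJ_def C1_def q_def local_constant_def)
qed

section \<open>Placing the plateau in the domain\<close>

text \<open>For small \<open>\<epsilon>\<close> all cells near a fixed interior ball of \<open>\<Omega>\<close> are perforated, and the plateau is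
  placed around the lattice point \<open>\<epsilon> z1\<close> next to the centre of this ball. Its width is \<open>L = r s / 16\<close>
  with \<open>s = min \<sigma>\<^sub>\<epsilon> 1\<close>. The translation goes to other holes in the ball, by the multiple of \<open>\<epsilon>\<close>
  next to \<open>2L + \<epsilon>\<close>.\<close>

lemma (in plateau) fine_estimate:
  fixes \<Omega> Y :: "(real^'n) set" and c0 \<epsilon> \<eta> r CT a p :: real
  defines "d \<equiv> real CARD('n)"
  assumes perf: "perforation \<Omega> Y c0 \<epsilon> \<eta>"
    and est: "gradient_estimate p (perforated \<Omega> Y \<epsilon> \<eta>) (ennreal a) B" and a: "0 < a" and p: "1 < p"
    and x0: "ball x0 r \<subseteq> \<Omega>" and r: "0 < r" "r \<le> 1"
    and \<epsilon>: "\<epsilon> * (2 * (d + 2)) \<le> r" and \<eta>: "\<eta> \<le> r / 32" and CT: "2 + 64 / r \<le> CT"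
  shows "r / 16 * min (sigma_eps CARD('n) \<epsilon> \<eta>) 1 / (\<epsilon> * \<eta> * log_factor CARD('n) \<eta>)
    \<le> local_constant c0 CT (r / 32) * (1 + a * \<eta> powr (- d / p))"
proof -
  interpret perforation \<Omega> Y c0 \<epsilon> \<eta> by (rule perf)
  have d: "d \<ge> 2" using dim by (simp add: d_def)
  define s where "s = min (sigma_eps CARD('n) \<epsilon> \<eta>) 1"
  define L where "L = r / 16 * s"
  have s: "\<epsilon> / 2 \<le> s" "s \<le> 1" "s \<le> sigma_eps CARD('n) \<epsilon> \<eta>"
    using sigma_eps_ge[OF eps(1) eta dim] eps by (auto simp: s_def)
  have L: "r / 32 * \<epsilon> \<le> L" "L \<le> r / 16" "L \<le> sigma_eps CARD('n) \<epsilon> \<eta>" "0 < L"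
  proof -
    show "r / 32 * \<epsilon> \<le> L" using mult_left_mono[OF s(1), of "r / 16"] r by (simp add: L_def)
    then show "0 < L" using r eps by (intro less_le_trans[of 0 "r / 32 * \<epsilon>" L]) auto
    show "L \<le> r / 16" using s r by (simp add: L_def)
    have "L \<le> 1 * s" unfolding L_def using s eps r by (intro mult_right_mono) auto
    then show "L \<le> sigma_eps CARD('n) \<epsilon> \<eta>" using s by simp
  qed
  have de: "d * \<epsilon> + 2 * \<epsilon> \<le> r / 2" using \<epsilon> by (simp add: algebra_simps)
  define z1 :: "real^'n" where "z1 = (\<chi> i. of_int (round (x0 $ i / \<epsilon>)))"
  have z1: "\<forall>i. z1 $ i \<in> \<int>" by (simp add: z1_def)
  have scaled: "norm (\<epsilon> *\<^sub>R x) \<le> d * \<epsilon> * b" if "\<And>i. \<bar>x $ i\<bar> \<le> b" for x :: "real^'n" and b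
    using mult_left_mono[OF norm_le_of_components[OF that], of \<epsilon>] eps by (simp add: d_def mult_ac)
  have z1x0: "dist (\<epsilon> *\<^sub>R z1) x0 \<le> d * \<epsilon> * (1/2)"
  proof -
    have "norm (\<epsilon> *\<^sub>R (z1 - (1 / \<epsilon>) *\<^sub>R x0)) \<le> d * \<epsilon> * (1/2)"
      using of_int_round_abs_le by (intro scaled) (simp add: z1_def)
    then show ?thesis using eps by (simp add: dist_norm scaleR_diff_right)
  qed
  have center: "z \<in> hole_centers \<Omega> \<epsilon>"
    if z: "\<forall>i. z $ i \<in> \<int>" and zd: "dist (\<epsilon> *\<^sub>R z) (\<epsilon> *\<^sub>R z1) + d * \<epsilon> < r" for z
  proof -
    have "\<epsilon> *\<^sub>R y \<in> \<Omega>" if "y \<in> open_cube z 1" for y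
    proof -
      have "norm (\<epsilon> *\<^sub>R (y - z)) \<le> d * \<epsilon> * (1/2)"
        using that by (intro scaled) (auto simp: open_cube_def less_imp_le)
      then have "dist (\<epsilon> *\<^sub>R y) (\<epsilon> *\<^sub>R z) \<le> d * \<epsilon> * (1/2)" by (simp add: dist_norm scaleR_diff_right)
      moreover have "dist (\<epsilon> *\<^sub>R y) x0 \<le> dist (\<epsilon> *\<^sub>R y) (\<epsilon> *\<^sub>R z) + (dist (\<epsilon> *\<^sub>R z) (\<epsilon> *\<^sub>R z1) + dist (\<epsilon> *\<^sub>R z1) x0)"
        by (intro order_trans[OF dist_triangle[of _ _ "\<epsilon> *\<^sub>R z"]] add_left_mono dist_triangle)
      ultimately have "dist (\<epsilon> *\<^sub>R y) x0 < r" using z1x0 zd by simp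
      then show ?thesis using x0 by (auto simp: dist_commute)
    qed
    then show ?thesis using z by (auto simp: hole_centers_def)
  qed
  define k where "k = nat \<lfloor>L / (4 * CARD('n) * \<epsilon>)\<rfloor>"
  have pos: "0 < 4 * CARD('n) * \<epsilon>" using eps by simp
  have kb: "real k \<le> L / (4 * CARD('n) * \<epsilon>)" "L / (4 * CARD('n) * \<epsilon>) \<le> real k + 1"
    using L pos by (auto simp: k_def of_nat_nat)
  have k: "real k * (4 * CARD('n) * \<epsilon>) \<le> L" "L \<le> (2 * real k + 1) * (4 * CARD('n) * \<epsilon>)"
  proof -
    show "real k * (4 * CARD('n) * \<epsilon>) \<le> L" using kb(1) pos by (simp add: le_divide_eq)
    have "L / (4 * CARD('n) * \<epsilon>) \<le> 2 * real k + 1" using kb(2) by simp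
    then show "L \<le> (2 * real k + 1) * (4 * CARD('n) * \<epsilon>)" using pos by (simp add: divide_le_eq)
  qed
  have close: "dist (\<epsilon> *\<^sub>R z) (\<epsilon> *\<^sub>R z1) \<le> L / 4" if "z \<in> lattice_box z1 k" for z
  proof -
    have "norm (\<epsilon> *\<^sub>R (z - z1)) \<le> d * \<epsilon> * real k"
      using that by (intro scaled) (auto simp: lattice_box_def)
    also have "\<dots> \<le> L / 4" using k(1) by (simp add: d_def mult_ac)
    finally show ?thesis by (simp add: dist_norm scaleR_diff_right)
  qed
  define m where "m = nat \<lceil>2 * L / \<epsilon>\<rceil> + 1"
  have m: "2 * L / \<epsilon> + 1 \<le> real m" "real m \<le> 2 * L / \<epsilon> + 2"
    using L eps by (auto simp: m_def) linarith+
  have me: "2 * L + \<epsilon> \<le> \<epsilon> * real m" "\<epsilon> * real m \<le> 2 * L + 2 * \<epsilon>"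
    using mult_left_mono[OF m(1), of \<epsilon>] mult_left_mono[OF m(2), of \<epsilon>] eps by (simp_all add: distrib_left)
  obtain i :: 'n where True by simp
  define e :: "real^'n" where "e = real m *\<^sub>R axis i 1"
  define \<tau> where "\<tau> = \<epsilon> *\<^sub>R e"
  have ne: "norm \<tau> = \<epsilon> * real m" using eps by (simp add: \<tau>_def e_def)
  have ez: "\<forall>j. (z + e) $ j \<in> \<int>" if "\<forall>i. z $ i \<in> \<int>" for z :: "real^'n"
    using that by (simp add: e_def axis_def)
  have "L / (\<epsilon> * \<eta> * log_factor CARD('n) \<eta>) \<le> local_constant c0 CT (r / 32) * (1 + a * \<eta> powr (- real CARD('n) / p))"
  proof (rule local_estimate[OF perf est a p z1 _ L(1) \<eta> _ k, where \<tau> = \<tau> and T = "\<epsilon> * real m"])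
    show "0 < r / 32" using r by simp
    show "cball (\<epsilon> *\<^sub>R z1) L \<subseteq> \<Omega>"
    proof
      fix x assume "x \<in> cball (\<epsilon> *\<^sub>R z1) L"
      then have "dist x x0 \<le> L + d * \<epsilon> * (1/2)"
        using dist_triangle[of x x0 "\<epsilon> *\<^sub>R z1"] z1x0 by (simp add: dist_commute)
      then have "dist x x0 < r" using L(2) de r eps by simp
      then show "x \<in> \<Omega>" using x0 by (auto simp: dist_commute)
    qed
    show "lattice_box z1 k \<subseteq> hole_centers \<Omega> \<epsilon>"
    proof
      fix z assume z: "z \<in> lattice_box z1 k"
      show "z \<in> hole_centers \<Omega> \<epsilon>"
        using z close[OF z] L de r eps by (intro center) (auto simp: lattice_box_def)
    qed
    show "0 < \<epsilon> * real m" using me L eps by simp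
    show "norm \<tau> \<le> \<epsilon> * real m" using ne by simp
    show "\<epsilon> * real m \<le> CT * L"
    proof -
      have "\<epsilon> \<le> 32 / r * L" using L(1) r by (simp add: field_simps)
      then have "\<epsilon> * real m \<le> (2 + 64 / r) * L" using me by (simp add: distrib_right)
      also have "\<dots> \<le> CT * L" using CT L by (intro mult_right_mono) auto
      finally show ?thesis .
    qed
    show "L \<le> sigma_eps CARD('n) \<epsilon> \<eta>" by (rule L)
    fix z assume z: "z \<in> lattice_box z1 k"
    have zt: "\<epsilon> *\<^sub>R z + \<tau> = \<epsilon> *\<^sub>R (z + e)" by (simp add: \<tau>_def scaleR_add_right)
    have zi: "\<forall>i. z $ i \<in> \<int>" using z by (simp add: lattice_box_def)
    have far: "dist (\<epsilon> *\<^sub>R (z + e)) (\<epsilon> *\<^sub>R z1) \<le> L / 4 + \<epsilon> * real m"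
      "\<epsilon> * real m - L / 4 \<le> dist (\<epsilon> *\<^sub>R (z + e)) (\<epsilon> *\<^sub>R z1)"
      using close[OF z] norm_triangle_ineq[of "\<epsilon> *\<^sub>R z - \<epsilon> *\<^sub>R z1" \<tau>] norm_diff_ineq[of \<tau> "\<epsilon> *\<^sub>R z - \<epsilon> *\<^sub>R z1"]
      unfolding ne by (simp_all add: dist_norm \<tau>_def scaleR_add_right algebra_simps)
    have "z + e \<in> hole_centers \<Omega> \<epsilon>"
      using far(1) me L de r eps by (intro center ez zi) auto
    then have "ball (\<epsilon> *\<^sub>R (z + e)) (c0 * \<epsilon> * \<eta>) \<inter> U = {}" by (rule ball_disjoint_U)
    moreover have "ball (\<epsilon> *\<^sub>R (z + e)) (c0 * \<epsilon> * \<eta>) \<inter> ball (\<epsilon> *\<^sub>R z1) L = {}"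
    proof (rule disjoint_ballI)
      have "c0 * \<epsilon> * \<eta> \<le> 1 * \<epsilon> * 1" using c0_le Y(1) eps eta by (intro mult_mono) auto
      then show "c0 * \<epsilon> * \<eta> + L \<le> dist (\<epsilon> *\<^sub>R (z + e)) (\<epsilon> *\<^sub>R z1)" using far(2) me L by simp
    qed
    ultimately show "ball (\<epsilon> *\<^sub>R z + \<tau>) (c0 * \<epsilon> * \<eta>) \<inter> (U \<union> ball (\<epsilon> *\<^sub>R z1) L) = {}"
      unfolding zt by blast
  qed
  then show ?thesis by (simp only: L_def s_def d_def)
qed

text \<open>If \<open>\<epsilon>\<close> is bounded below, a single hole suffices. The plateau has the width of a quarter of its
  cell, and the translation leaves the domain, where functions vanishing on the boundary are zero
  as well; its length is bounded in terms of the diameter of \<open>\<Omega>\<close>, hence by a multiple of \<open>L\<close>.\<close>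

lemma (in plateau) coarse_estimate:
  fixes \<Omega> Y :: "(real^'n) set" and c0 \<epsilon> \<eta> \<kappa> \<epsilon>0 D CT a p :: real
  assumes perf: "perforation \<Omega> Y c0 \<epsilon> \<eta>"
    and est: "gradient_estimate p (perforated \<Omega> Y \<epsilon> \<eta>) (ennreal a) B" and a: "0 < a" and p: "1 < p"
    and D: "\<And>x. x \<in> \<Omega> \<Longrightarrow> norm x < D" and \<epsilon>0: "0 < \<epsilon>0" "\<epsilon>0 \<le> \<epsilon>"
    and \<kappa>: "0 < \<kappa>" "\<kappa> \<le> 1/4" "\<eta> \<le> \<kappa>" and CT: "4 * (2 * D + 1) / \<epsilon>0 \<le> CT"
    and z1: "z1 \<in> hole_centers \<Omega> \<epsilon>"
  shows "\<epsilon>0 / 4 * min (sigma_eps CARD('n) \<epsilon> \<eta>) 1 / (\<epsilon> * \<eta> * log_factor CARD('n) \<eta>)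
    \<le> local_constant c0 CT \<kappa> * (1 + a * \<eta> powr (- real CARD('n) / p))"
proof -
  interpret perforation \<Omega> Y c0 \<epsilon> \<eta> by (rule perf)
  have z1i: "\<forall>i. z1 $ i \<in> \<int>" by (rule hole_centers_lattice[OF z1])
  have cell: "\<epsilon> *\<^sub>R y \<in> \<Omega>" if "y \<in> open_cube z1 1" for y
    using z1 that by (auto simp: hole_centers_def)
  have in\<Omega>: "\<epsilon> *\<^sub>R z1 \<in> \<Omega>" by (rule cell) (simp add: open_cube_def)
  then have nz: "norm (\<epsilon> *\<^sub>R z1) < D" by (rule D)
  then have Dp: "D > 0" using norm_ge_zero by (rule le_less_trans[rotated])
  obtain e :: "real^'n" where e: "norm e = 2 * D + 1" using vector_choose_size[of "2 * D + 1"] Dp by auto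
  have cs: "c0 * \<epsilon> * \<eta> \<le> 1/4 * 1 * (1/2)"
    using c0_le Y(1) eps eta by (intro mult_mono) auto
  have box: "lattice_box z1 0 = {z1}"
    using z1i by (auto simp: lattice_box_def vec_eq_iff)
  have main: "(\<epsilon> / 4) / (\<epsilon> * \<eta> * log_factor CARD('n) \<eta>) \<le> local_constant c0 CT \<kappa> * (1 + a * \<eta> powr (- real CARD('n) / p))"
  proof (rule local_estimate[OF perf est a p z1i \<kappa>(1) _ \<kappa>(3), where \<tau> = e and T = "2 * D + 1" and k = 0])
    show "\<kappa> * \<epsilon> \<le> \<epsilon> / 4" using mult_right_mono[OF \<kappa>(2), of \<epsilon>] eps by simp
    show "cball (\<epsilon> *\<^sub>R z1) (\<epsilon> / 4) \<subseteq> \<Omega>"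
    proof
      fix x assume x: "x \<in> cball (\<epsilon> *\<^sub>R z1) (\<epsilon> / 4)"
      define y where "y = (1 / \<epsilon>) *\<^sub>R x"
      have xy: "x = \<epsilon> *\<^sub>R y" using eps by (simp add: y_def)
      have "norm (\<epsilon> *\<^sub>R (y - z1)) \<le> \<epsilon> / 4" using x by (simp add: xy dist_norm norm_minus_commute scaleR_diff_right)
      then have n: "norm (y - z1) \<le> 1/4" using eps by simp
      have "\<bar>y $ j - z1 $ j\<bar> < 1/2" for j
        using component_le_norm_cart[of "y - z1" j] n by simp
      then show "x \<in> \<Omega>" unfolding xy by (intro cell) (simp add: open_cube_def)
    qed
    show "real 0 * (4 * CARD('n) * \<epsilon>) \<le> \<epsilon> / 4" using eps by simp
    have "\<epsilon> * 1 \<le> \<epsilon> * real CARD('n)" using eps by (intro mult_left_mono) auto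
    then have "\<epsilon> / 4 \<le> 4 * (\<epsilon> * real CARD('n))" using eps by linarith
    then show "\<epsilon> / 4 \<le> (2 * real 0 + 1) * (4 * CARD('n) * \<epsilon>)" by (simp only: of_nat_0 mult_ac) simp
    show "lattice_box z1 0 \<subseteq> hole_centers \<Omega> \<epsilon>" using z1 box by simp
    show "0 < 2 * D + 1" "norm e \<le> 2 * D + 1" using Dp e by auto
    have "2 * D + 1 = 4 * (2 * D + 1) / \<epsilon>0 * (\<epsilon>0 / 4)" using \<epsilon>0 by simp
    also have "\<dots> \<le> CT * (\<epsilon> / 4)"
      using \<epsilon>0 Dp CT by (intro mult_mono) (auto intro: order_trans[OF _ CT])
    finally show "2 * D + 1 \<le> CT * (\<epsilon> / 4)" .
    show "\<epsilon> / 4 \<le> sigma_eps CARD('n) \<epsilon> \<eta>" using sigma_eps_ge[OF eps(1) eta dim] eps by simp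
    fix z assume "z \<in> lattice_box z1 0"
    then have z: "z = z1" using box by simp
    have "x \<notin> U \<and> x \<notin> ball (\<epsilon> *\<^sub>R z1) (\<epsilon> / 4)" if x: "x \<in> ball (\<epsilon> *\<^sub>R z1 + e) (c0 * \<epsilon> * \<eta>)" for x
    proof -
      have 1: "norm (\<epsilon> *\<^sub>R z1 + e - x) < 1/8" using x cs by (simp add: dist_norm)
      have "norm e \<le> norm (\<epsilon> *\<^sub>R z1 + e - x) + norm (x - \<epsilon> *\<^sub>R z1)"
        using norm_triangle_ineq[of "\<epsilon> *\<^sub>R z1 + e - x" "x - \<epsilon> *\<^sub>R z1"] by simp
      then have 2: "2 * D + 7/8 < norm (x - \<epsilon> *\<^sub>R z1)" using 1 e by simp
      then have "norm x > D" using nz norm_triangle_ineq4[of x "\<epsilon> *\<^sub>R z1"] by simp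
      then have "x \<notin> \<Omega>" using D[of x] by auto
      moreover have "x \<notin> ball (\<epsilon> *\<^sub>R z1) (\<epsilon> / 4)" using 2 Dp eps by (simp add: dist_norm norm_minus_commute)
      ultimately show ?thesis unfolding U_eq by blast
    qed
    then show "ball (\<epsilon> *\<^sub>R z + e) (c0 * \<epsilon> * \<eta>) \<inter> (U \<union> ball (\<epsilon> *\<^sub>R z1) (\<epsilon> / 4)) = {}"
      unfolding z by blast
  qed
  have "\<epsilon>0 / 4 * min (sigma_eps CARD('n) \<epsilon> \<eta>) 1 \<le> \<epsilon> / 4 * 1"
    using \<epsilon>0 eps by (intro mult_mono) (auto intro: order_trans[OF _ sigma_eps_ge[OF eps(1) eta dim]])
  then have "\<epsilon>0 / 4 * min (sigma_eps CARD('n) \<epsilon> \<eta>) 1 / (\<epsilon> * \<eta> * log_factor CARD('n) \<eta>) \<le> (\<epsilon> / 4) / (\<epsilon> * \<eta> * log_factor CARD('n) \<eta>)"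
    using eps eta log_factor_ge_half[OF eta, of "CARD('n)"] by (intro divide_right_mono) auto
  with main show ?thesis by (rule order_trans[rotated])
qed

section \<open>Parameters for which the lower bound is bounded\<close>

text \<open>For \<open>\<eta>\<close> bounded below the claimed lower bound is itself bounded. It suffices to use
  \<open>min \<sigma>\<^sub>\<epsilon> 1 \<le> \<sigma>\<^sub>\<epsilon>\<close>, in which the factor \<open>\<epsilon>\<close> cancels.\<close>

lemma rate_bounded:
  fixes \<epsilon> \<eta> \<kappa> p :: real
  assumes e: "0 < \<epsilon>" and \<eta>: "0 < \<eta>" "\<eta> < 1/2" and d: "2 \<le> d" and \<kappa>: "0 < \<kappa>" "\<kappa> \<le> \<eta>" and p: "0 < p"
  shows "min (sigma_eps d \<epsilon> \<eta>) 1 / (\<epsilon> * log_factor d \<eta>) * \<eta> powr (real d / p - 1) \<le> 2 / \<kappa> ^ (d + 1)"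
proof -
  define l where "l = log_factor d \<eta>"
  have l: "1/2 \<le> l" using log_factor_ge_half[OF \<eta>] by (simp add: l_def)
  have "sigma_eps d \<epsilon> \<eta> / (\<epsilon> * l) \<le> 2 / \<eta> ^ d"
  proof (rule power2_le_imp_le)
    have "\<eta>\<^sup>2 \<le> 1" "\<eta> ^ d \<le> 1" using \<eta> by (auto simp: power_le_one)
    have "(sigma_eps d \<epsilon> \<eta> / (\<epsilon> * l))\<^sup>2 = \<eta>\<^sup>2 * (1 / l) / \<eta> ^ d"
      unfolding power_divide sigma_eps_square[OF e \<eta> d] using e \<eta> l by (simp add: l_def power2_eq_square)
    also have "\<dots> \<le> 1 * 2 / \<eta> ^ d"
      using \<open>\<eta>\<^sup>2 \<le> 1\<close> l \<eta> by (intro divide_right_mono mult_mono) (auto simp: divide_le_eq)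
    also have "\<dots> \<le> (2 / \<eta> ^ d) * (2 / \<eta> ^ d)"
    proof -
      have "1 \<le> 2 / \<eta> ^ d" using \<open>\<eta> ^ d \<le> 1\<close> \<eta> by (simp add: le_divide_eq)
      then show ?thesis using mult_right_mono[of 1 "2 / \<eta> ^ d" "2 / \<eta> ^ d"] \<eta> by simp
    qed
    finally show "(sigma_eps d \<epsilon> \<eta> / (\<epsilon> * l))\<^sup>2 \<le> (2 / \<eta> ^ d)\<^sup>2" by (simp only: power2_eq_square)
  qed (use \<eta> in auto)
  moreover have "min (sigma_eps d \<epsilon> \<eta>) 1 / (\<epsilon> * l) \<le> sigma_eps d \<epsilon> \<eta> / (\<epsilon> * l)"
    using e l by (intro divide_right_mono) auto
  ultimately have 1: "min (sigma_eps d \<epsilon> \<eta>) 1 / (\<epsilon> * l) \<le> 2 / \<eta> ^ d" by simp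
  have "\<eta> powr (real d / p - 1) \<le> \<eta> powr (- 1)"
    using \<eta> p by (intro powr_mono') auto
  also have "\<dots> = 1 / \<eta>" using \<eta> by (simp add: powr_neg_one)
  finally have 2: "\<eta> powr (real d / p - 1) \<le> 1 / \<eta>" .
  have "min (sigma_eps d \<epsilon> \<eta>) 1 / (\<epsilon> * l) * \<eta> powr (real d / p - 1) \<le> (2 / \<eta> ^ d) * (1 / \<eta>)"
    using \<eta> by (intro mult_mono 1 2) auto
  also have "\<dots> = 2 / \<eta> ^ (d + 1)" by simp
  also have "\<dots> \<le> 2 / \<kappa> ^ (d + 1)" using \<kappa> \<eta> by (intro divide_left_mono power_mono) auto
  finally show ?thesis by (simp add: l_def)
qed

text \<open>For coarse cells, \<open>\<sigma>\<^sub>\<epsilon> \<le> 1\<close> is only possible if the holes are not small, because \<open>\<sigma>\<^sub>\<epsilon> / \<epsilon>\<close> tends to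
  infinity with \<open>1/\<eta>\<close>. This takes care of the case without holes in the first part of the theorem.\<close>

lemma eta_lower_bound:
  fixes \<epsilon> \<eta> \<epsilon>0 :: real
  assumes e: "0 < \<epsilon>0" "\<epsilon>0 \<le> \<epsilon>" and \<eta>: "0 < \<eta>" "\<eta> < 1/2" and d: "2 \<le> d" and s: "sigma_eps d \<epsilon> \<eta> \<le> 1"
  shows "min (\<epsilon>0\<^sup>2) (exp (- (1 / \<epsilon>0\<^sup>2))) \<le> \<eta>"
proof -
  have e': "\<epsilon> > 0" using e by simp
  have "(sigma_eps d \<epsilon> \<eta>)\<^sup>2 \<le> 1"
    using s e' by (intro power_le_one) (auto simp: sigma_eps_def)
  then have "\<epsilon>\<^sup>2 * \<eta>\<^sup>2 * log_factor d \<eta> \<le> \<eta> ^ d"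
    unfolding sigma_eps_square[OF e' \<eta> d] using \<eta> by (simp add: divide_le_eq)
  moreover have "\<epsilon>0\<^sup>2 * (\<eta>\<^sup>2 * log_factor d \<eta>) \<le> \<epsilon>\<^sup>2 * (\<eta>\<^sup>2 * log_factor d \<eta>)"
    using e log_factor_ge_half[OF \<eta>, of d] by (intro mult_right_mono power_mono) auto
  ultimately have "\<epsilon>0\<^sup>2 * (\<eta>\<^sup>2 * log_factor d \<eta>) \<le> \<eta> ^ d" by simp
  also have "\<eta> ^ d = \<eta>\<^sup>2 * \<eta> ^ (d - 2)" using d by (metis power_add le_add_diff_inverse)
  finally have m: "\<epsilon>0\<^sup>2 * log_factor d \<eta> \<le> \<eta> ^ (d - 2)" using \<eta> by (simp add: mult.left_commute)
  show ?thesis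
  proof (cases "d \<ge> 3")
    case True
    have "\<eta> ^ (d - 2) \<le> \<eta> ^ 1" using True \<eta> by (intro power_decreasing) auto
    then show ?thesis using m True by (simp add: log_factor_def)
  next
    case False
    then have "\<epsilon>0\<^sup>2 * \<bar>ln \<eta>\<bar> \<le> 1" using m d by (simp add: log_factor_def)
    then have "\<bar>ln \<eta>\<bar> \<le> 1 / \<epsilon>0\<^sup>2" using e by (simp add: le_divide_eq mult.commute)
    then have "- (1 / \<epsilon>0\<^sup>2) \<le> ln \<eta>" by linarith
    then have "exp (- (1 / \<epsilon>0\<^sup>2)) \<le> \<eta>" using \<eta> by (simp add: ln_ge_iff)
    then show ?thesis by simp
  qed
qed

section \<open>The lower bound\<close>

text \<open>The common form of the lower bounds in the theorem: the two regimes \<open>\<sigma>\<^sub>\<epsilon> \<le> 1\<close> and \<open>\<sigma>\<^sub>\<epsilon> \<ge> 1\<close> only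
  differ in the value of the minimum.\<close>

definition rate :: "nat \<Rightarrow> real \<Rightarrow> real \<Rightarrow> real \<Rightarrow> real" where
  "rate d p \<epsilon> \<eta> = min (sigma_eps d \<epsilon> \<eta>) 1 / (\<epsilon> * log_factor d \<eta>) * \<eta> powr (real d / p - 1)"

text \<open>If there are holes, the estimates of the previous sections apply as soon as \<open>\<eta> \<le> \<kappa>\<close>. The last
  alternative \<open>p \<le> d\<close> of the assumption covers the case without holes: then \<open>\<epsilon>\<close> is bounded below,
  and \<open>\<eta>\<^bsup>d/p - 1\<^esup> \<le> 1\<close>.\<close>

lemma (in plateau) lower_bound_rate:
  fixes \<Omega> Y :: "(real^'n) set" and p c0 :: real
  assumes dim: "CARD('n) \<ge> 2" and p: "2 < p" and Omega: "bounded_domain \<Omega>"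
    and Y: "c0 > 0" "ball 0 c0 \<subseteq> Y" "Y \<subseteq> ball 0 (1/4)"
  obtains c where "c > 0"
    and "\<And>\<epsilon> \<eta> a B. 0 < \<epsilon> \<Longrightarrow> \<epsilon> \<le> 1 \<Longrightarrow> 0 < \<eta> \<Longrightarrow> \<eta> < 1/2 \<Longrightarrow> 0 \<le> a \<Longrightarrow>
      gradient_estimate p (perforated \<Omega> Y \<epsilon> \<eta>) (ennreal a) B \<Longrightarrow>
      hole_centers \<Omega> \<epsilon> \<noteq> {} \<or> sigma_eps CARD('n) \<epsilon> \<eta> \<le> 1 \<or> p \<le> real CARD('n) \<Longrightarrow>
      1 \<le> a \<and> c * rate CARD('n) p \<epsilon> \<eta> \<le> a"
proof -
  let ?d = "CARD('n)"
  have O: "open \<Omega>" "bounded \<Omega>" "\<Omega> \<noteq> {}" using Omega by (auto simp: bounded_domain_def)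
  obtain x0 where "x0 \<in> \<Omega>" using O by blast
  then obtain r0 where r0: "r0 > 0" "ball x0 r0 \<subseteq> \<Omega>" using O(1) open_contains_ball by blast
  define r where "r = min r0 1"
  have r: "0 < r" "r \<le> 1" "ball x0 r \<subseteq> \<Omega>" using r0 by (auto simp: r_def)
  obtain D where D: "0 < D" "\<And>x. x \<in> \<Omega> \<Longrightarrow> norm x < D" using O(2) by (metis bounded_pos_less)
  define \<epsilon>0 where "\<epsilon>0 = r / (2 * (real ?d + 2))"
  have \<epsilon>0: "0 < \<epsilon>0" using r by (simp add: \<epsilon>0_def)
  define \<kappa> where "\<kappa> = min (r / 32) (min (\<epsilon>0\<^sup>2) (exp (- (1 / \<epsilon>0\<^sup>2))))"
  have \<kappa>: "0 < \<kappa>" "\<kappa> \<le> r / 32" using r \<epsilon>0 by (auto simp: \<kappa>_def)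
  define CT where "CT = max (2 + 64 / r) (4 * (2 * D + 1) / \<epsilon>0)"
  define C where "C = local_constant c0 CT (r / 32)"
  have C: "C > 0" unfolding C_def using Y r by (intro local_constant_pos) auto
  define cs where "cs = min (r / 16) (\<epsilon>0 / 4)"
  have cs: "cs > 0" using r \<epsilon>0 by (simp add: cs_def)
  define C' where "C' = max (2 / \<kappa> ^ (?d + 1)) (1 / \<epsilon>0)"
  have C': "C' > 0" using \<epsilon>0 by (simp add: C'_def less_max_iff_disj)
  define c where "c = min (cs / (2 * C)) (1 / C')"
  show thesis
  proof (rule that[of c])
    show "c > 0" using C cs C' by (simp add: c_def)
    fix \<epsilon> \<eta> a :: real and B
    assume eps: "0 < \<epsilon>" "\<epsilon> \<le> 1" and eta: "0 < \<eta>" "\<eta> < 1/2" and a0: "0 \<le> a"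
      and est: "gradient_estimate p (perforated \<Omega> Y \<epsilon> \<eta>) (ennreal a) B"
      and cond: "hole_centers \<Omega> \<epsilon> \<noteq> {} \<or> sigma_eps ?d \<epsilon> \<eta> \<le> 1 \<or> p \<le> real ?d"
    have perf: "perforation \<Omega> Y c0 \<epsilon> \<eta>"
      using dim O Y eps eta by unfold_locales auto
    interpret perforation \<Omega> Y c0 \<epsilon> \<eta> by (rule perf)
    obtain x \<delta> where "0 < \<delta>" "cball x \<delta> \<subseteq> U" by (rule U_contains_ball)
    then have a1: "1 \<le> a" using est a0 p U_borel by (intro gradient_estimate_ge_1[of p U a B x \<delta>]) auto
    define l where "l = log_factor ?d \<eta>"
    have l: "1/2 \<le> l" using log_factor_ge_half[OF eta] by (simp add: l_def)
    define s where "s = min (sigma_eps ?d \<epsilon> \<eta>) 1"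
    have s: "0 < s" "s \<le> 1" using sigma_eps_ge[OF eps(1) eta dim] eps by (auto simp: s_def)
    define Q where "Q = rate ?d p \<epsilon> \<eta>"
    have Q_eq: "Q = s / (\<epsilon> * l) * \<eta> powr (real ?d / p - 1)" by (simp add: Q_def rate_def s_def l_def)
    have Q: "0 \<le> Q" using s eps l by (simp add: Q_eq)
    \<comment> \<open>Here the rate is bounded, and the trivial bound \<open>1 \<le> a\<close> suffices.\<close>
    have trivial: "c * Q \<le> a" if "Q \<le> C'"
    proof -
      have "c * Q \<le> 1 / C' * C'" using that C' Q by (intro mult_mono) (auto simp: c_def)
      then show ?thesis using C' a1 by simp
    qed
    have resolved: "c * Q \<le> a"
      if main: "k * s / (\<epsilon> * \<eta> * l) \<le> C * (1 + a * \<eta> powr (- real ?d / p))" and k: "cs \<le> k" for k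
    proof -
      have e1: "\<eta> powr (real ?d / p) = \<eta> * \<eta> powr (real ?d / p - 1)"
        using eta by (simp add: powr_diff)
      have e2: "\<eta> powr (real ?d / p) * \<eta> powr (- real ?d / p) = 1"
        using eta by (simp flip: powr_add)
      have "k * Q = k * s / (\<epsilon> * \<eta> * l) * \<eta> powr (real ?d / p)"
        using eta by (simp add: Q_eq e1)
      also have "\<dots> \<le> C * (1 + a * \<eta> powr (- real ?d / p)) * \<eta> powr (real ?d / p)"
        by (intro mult_right_mono main) auto
      also have "\<dots> = C * (\<eta> powr (real ?d / p) + a * (\<eta> powr (real ?d / p) * \<eta> powr (- real ?d / p)))"
        by (simp only: algebra_simps mult_1_right)
      also have "\<dots> = C * (\<eta> powr (real ?d / p) + a)" by (simp only: e2 mult_1_right)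
      also have "\<dots> \<le> C * (2 * a)"
      proof -
        have "\<eta> powr (real ?d / p) \<le> 1" using eta p by (intro powr_le1) auto
        then show ?thesis using C a1 by (intro mult_left_mono) auto
      qed
      finally have "cs * Q \<le> C * (2 * a)" using mult_right_mono[OF k Q] by simp
      then have "cs / (2 * C) * Q \<le> a" using C by (simp add: divide_le_eq mult_ac)
      moreover have "c * Q \<le> cs / (2 * C) * Q" using Q by (intro mult_right_mono) (auto simp: c_def)
      ultimately show ?thesis by simp
    qed
    have "c * Q \<le> a"
    proof (cases "\<kappa> \<le> \<eta>")
      case True
      have "Q \<le> 2 / \<kappa> ^ (?d + 1)"
        unfolding Q_def rate_def using p by (intro rate_bounded eps eta dim \<kappa> True) auto
      then show ?thesis by (intro trivial) (simp add: C'_def)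
    next
      case False
      then have \<eta>r: "\<eta> \<le> r / 32" using \<kappa> by simp
      consider "\<epsilon> \<le> \<epsilon>0" | z where "\<epsilon>0 \<le> \<epsilon>" "z \<in> hole_centers \<Omega> \<epsilon>" | "\<epsilon>0 \<le> \<epsilon>" "hole_centers \<Omega> \<epsilon> = {}"
        by fastforce
      then show ?thesis
      proof cases
        case 1
        have "r / 16 * s / (\<epsilon> * \<eta> * l) \<le> C * (1 + a * \<eta> powr (- real ?d / p))"
          unfolding s_def l_def C_def
        proof (rule fine_estimate[OF perf est _ _ r(3,1,2) _ \<eta>r])
          show "\<epsilon> * (2 * (real ?d + 2)) \<le> r"
            using 1 by (simp add: \<epsilon>0_def le_divide_eq)
        qed (use a1 p in \<open>auto simp: CT_def\<close>)
        then show ?thesis by (rule resolved) (simp add: cs_def)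
      next
        case 2
        have "\<epsilon>0 / 4 * s / (\<epsilon> * \<eta> * l) \<le> C * (1 + a * \<eta> powr (- real ?d / p))"
          unfolding s_def l_def C_def
          by (rule coarse_estimate[OF perf est _ _ D(2) \<epsilon>0 2(1) _ _ \<eta>r _ 2(2)]) (use a1 p r in \<open>auto simp: CT_def\<close>)
        then show ?thesis by (rule resolved) (simp add: cs_def)
      next
        case 3
        have "\<not> sigma_eps ?d \<epsilon> \<eta> \<le> 1"
          using eta_lower_bound[OF \<epsilon>0 3(1) eta dim] False by (auto simp: \<kappa>_def)
        then have pd: "p \<le> real ?d" using cond 3 by simp
        then have "?d \<ge> 3" using p by simp
        then have l1: "l = 1" by (simp add: l_def log_factor_def)
        have "\<eta> powr (real ?d / p - 1) \<le> 1" using eta p pd by (intro powr_le1) (auto simp: le_divide_eq)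
        then have "Q \<le> s / (\<epsilon> * l) * 1" unfolding Q_eq using s eps l by (intro mult_left_mono) auto
        also have "\<dots> \<le> 1 / \<epsilon>0" using s eps \<epsilon>0 3(1) by (simp add: l1) (intro frac_le; simp)
        finally show ?thesis by (intro trivial) (simp add: C'_def)
      qed
    qed
    with a1 show "1 \<le> a \<and> c * rate ?d p \<epsilon> \<eta> \<le> a" by (simp add: Q_def)
  qed
qed

theorem theorem9p6:
  fixes \<Omega> Y :: "(real^'n) set" and p c0 :: real
  assumes "CARD('n) \<ge> 2" and "2 < p"
    and "bounded_lipschitz_domain \<Omega>"
    and "bounded_C1_domain Y" and "connected (frontier Y)"
    and "c0 > 0" and "ball 0 c0 \<subseteq> Y" and "Y \<subseteq> ball 0 (1/4)"
  defines "d \<equiv> real CARD('n)"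
  shows "\<exists>c>0. \<forall>\<epsilon> \<eta>. 0 < \<epsilon> \<and> \<epsilon> \<le> 1 \<and> 0 < \<eta> \<and> \<eta> < 1/2 \<longrightarrow>
    (0 < sigma_eps CARD('n) \<epsilon> \<eta> \<and> sigma_eps CARD('n) \<epsilon> \<eta> \<le> 1 \<longrightarrow>
       (d \<ge> 3 \<longrightarrow>
          A_p p (perforated \<Omega> Y \<epsilon> \<eta>) \<ge> ennreal (c * \<eta> powr (- d * \<bar>1/2 - 1/p\<bar>))) \<and>
       (d = 2 \<longrightarrow>
          A_p p (perforated \<Omega> Y \<epsilon> \<eta>)
            \<ge> ennreal (c * \<eta> powr (- 2 * \<bar>1/2 - 1/p\<bar>) * \<bar>ln \<eta>\<bar> powr (- 1/2)))) \<and>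
    (sigma_eps CARD('n) \<epsilon> \<eta> \<ge> 1 \<and> (p > d \<longrightarrow> hole_centers \<Omega> \<epsilon> \<noteq> {}) \<longrightarrow>
       (d \<ge> 3 \<and> p < d \<longrightarrow>
          A_p p (perforated \<Omega> Y \<epsilon> \<eta>)
            \<ge> ennreal (c * (1 + (1 / \<epsilon>) * \<eta> powr (d / p - 1)))) \<and>
       (d \<ge> 3 \<and> d \<le> p \<longrightarrow>
          A_p p (perforated \<Omega> Y \<epsilon> \<eta>)
            \<ge> ennreal (c * (1 / \<epsilon>) * \<eta> powr (d / p - 1))) \<and>
       (d = 2 \<longrightarrow>
          A_p p (perforated \<Omega> Y \<epsilon> \<eta>)
            \<ge> ennreal (c * (1 / \<epsilon>) * \<eta> powr (2 / p - 1) * \<bar>ln \<eta>\<bar> powr (-1))))"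
proof -
  obtain \<theta> :: "real^'n \<Rightarrow> real" where \<theta>: "smooth \<theta>" "\<And>x. 0 \<le> \<theta> x" "\<And>x. \<theta> x \<le> 1"
    "\<And>x. norm x \<le> 1/2 \<Longrightarrow> \<theta> x = 1" "\<And>x. norm x \<ge> 1 \<Longrightarrow> \<theta> x = 0"
    using smooth_plateau by blast
  have "closure {x. \<theta> x \<noteq> 0} \<subseteq> cball 0 1"
    using \<theta>(5) by (intro closure_minimal) force+
  then have "compact (closure {x. \<theta> x \<noteq> 0})"
    by (meson bounded_cball bounded_subset closed_closure compact_eq_bounded_closed)
  then obtain M where M: "M > 0" "\<And>x. norm (grad \<theta> x) \<le> M" using grad_bounded[OF \<theta>(1)] by blast
  interpret plateau \<theta> M by unfold_locales (use \<theta> M in auto)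
  obtain c where c: "c > 0"
    and bound: "\<And>\<epsilon> \<eta> a B. 0 < \<epsilon> \<Longrightarrow> \<epsilon> \<le> 1 \<Longrightarrow> 0 < \<eta> \<Longrightarrow> \<eta> < 1/2 \<Longrightarrow> 0 \<le> a \<Longrightarrow>
      gradient_estimate p (perforated \<Omega> Y \<epsilon> \<eta>) (ennreal a) B \<Longrightarrow>
      hole_centers \<Omega> \<epsilon> \<noteq> {} \<or> sigma_eps CARD('n) \<epsilon> \<eta> \<le> 1 \<or> p \<le> real CARD('n) \<Longrightarrow>
      1 \<le> a \<and> c * rate CARD('n) p \<epsilon> \<eta> \<le> a"
    using lower_bound_rate[OF assms(1,2) _ assms(6-8), of \<Omega>] assms(3)
    by (auto simp: bounded_lipschitz_domain_def)
  \<comment> \<open>Half of \<open>a\<close> pays for the constant \<open>1\<close> in the case \<open>p < d\<close>, the other half for the rate.\<close>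
  define b where "b = min 1 c / 2"
  have b: "b > 0" "b \<le> 1/2" "b \<le> c / 2" using c by (auto simp: b_def)
  have A_p_ge: "ennreal X \<le> A_p p (perforated \<Omega> Y \<epsilon> \<eta>)"
    if "0 < \<epsilon>" "\<epsilon> \<le> 1" "0 < \<eta>" "\<eta> < 1/2"
      "hole_centers \<Omega> \<epsilon> \<noteq> {} \<or> sigma_eps CARD('n) \<epsilon> \<eta> \<le> 1 \<or> p \<le> real CARD('n)"
      "X \<le> b * (1 + rate CARD('n) p \<epsilon> \<eta>)" for X \<epsilon> \<eta>
  proof (rule A_p_geI)
    fix a B assume a: "0 \<le> a" "gradient_estimate p (perforated \<Omega> Y \<epsilon> \<eta>) (ennreal a) B"
    have q: "1 \<le> a" "c * rate CARD('n) p \<epsilon> \<eta> \<le> a" using bound[OF that(1-4) a that(5)] by auto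
    have "0 \<le> sigma_eps CARD('n) \<epsilon> \<eta>" "0 \<le> log_factor CARD('n) \<eta>"
      using that by (auto simp: sigma_eps_def log_factor_def)
    then have "0 \<le> rate CARD('n) p \<epsilon> \<eta>" using that by (auto simp: rate_def intro!: mult_nonneg_nonneg divide_nonneg_nonneg)
    then have "b * rate CARD('n) p \<epsilon> \<eta> \<le> c / 2 * rate CARD('n) p \<epsilon> \<eta>" using b by (intro mult_right_mono) auto
    then show "X \<le> a" using that(6) q b by (simp add: distrib_left)
  qed
  have half: "\<bar>1/2 - 1/p\<bar> = 1/2 - 1/p" using assms(2) by (simp add: field_simps)
  show ?thesis
  proof (intro exI[of _ b] conjI allI impI b(1), goal_cases)
    case (1 \<epsilon> \<eta>)
    then have d3: "CARD('n) \<ge> 3" by (simp add: d_def)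
    have "rate CARD('n) p \<epsilon> \<eta> = \<eta> powr (1 - d / 2) * \<eta> powr (d / p - 1)"
      using 1 d3 by (simp add: rate_def sigma_eps_def log_factor_def d_def)
    also have "\<dots> = \<eta> powr (- d * \<bar>1/2 - 1/p\<bar>)"
      unfolding half by (simp add: right_diff_distrib flip: powr_add)
    finally show ?case using 1 b by (intro A_p_ge) (auto simp: distrib_left)
  next
    case (2 \<epsilon> \<eta>)
    then have d2: "CARD('n) = 2" by (simp add: d_def)
    have l: "\<bar>ln \<eta>\<bar> > 0" using 2 by simp
    have "rate CARD('n) p \<epsilon> \<eta> = (\<bar>ln \<eta>\<bar> powr (1/2) * \<bar>ln \<eta>\<bar> powr (-1)) * \<eta> powr (2 / p - 1)"
      using 2 d2 l by (simp add: rate_def sigma_eps_def log_factor_def powr_neg_one)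
    also have "\<bar>ln \<eta>\<bar> powr (1/2) * \<bar>ln \<eta>\<bar> powr (-1) = \<bar>ln \<eta>\<bar> powr (- 1/2)"
      unfolding powr_add[symmetric] by simp
    also have "2 / p - 1 = - 2 * \<bar>1/2 - 1/p\<bar>" unfolding half by (simp add: right_diff_distrib)
    finally show ?case using 2 b by (intro A_p_ge) (auto simp: distrib_left mult_ac)
  next
    case (3 \<epsilon> \<eta>)
    then have d3: "CARD('n) \<ge> 3" by (simp add: d_def)
    have "rate CARD('n) p \<epsilon> \<eta> = 1 / \<epsilon> * \<eta> powr (d / p - 1)"
      using 3 d3 by (simp add: rate_def log_factor_def d_def min_def)
    then show ?case using 3 by (intro A_p_ge) (auto simp: d_def)
  next
    case (4 \<epsilon> \<eta>)
    then have d3: "CARD('n) \<ge> 3" by (simp add: d_def)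
    have "rate CARD('n) p \<epsilon> \<eta> = 1 / \<epsilon> * \<eta> powr (d / p - 1)"
      using 4 d3 by (simp add: rate_def log_factor_def d_def min_def)
    then show ?case using 4 b by (intro A_p_ge) (auto simp: d_def distrib_left)
  next
    case (5 \<epsilon> \<eta>)
    then have d2: "CARD('n) = 2" by (simp add: d_def)
    have l: "\<bar>ln \<eta>\<bar> > 0" using 5 by simp
    have "rate CARD('n) p \<epsilon> \<eta> = 1 / \<epsilon> * \<bar>ln \<eta>\<bar> powr (-1) * \<eta> powr (2 / p - 1)"
      using 5 d2 l by (simp add: rate_def log_factor_def min_def powr_neg_one)
    then have "b * (1 / \<epsilon>) * \<eta> powr (2 / p - 1) * \<bar>ln \<eta>\<bar> powr (-1) = b * rate CARD('n) p \<epsilon> \<eta>"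
      by (simp only: mult_ac)
    also have "\<dots> \<le> b * (1 + rate CARD('n) p \<epsilon> \<eta>)" using b by (simp add: distrib_left)
    finally show ?case using 5 assms(2) d2 by (intro A_p_ge) (auto simp: d_def)
  qed
qed

end
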